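(* The problem $\mathrm{OPG}_{MC}$ (Optimal Perimeter Guarding with Minimum Cost) with an arbitrary number $t$ of robot types (part of the input) can be solved exactly in pseudo-polynomial time. More precisely, in the case $m=1$ of a single region $R$ whose perimeter $P\subset\partial R$ has $q$ segments, the minimum total cost can be computed in time $$O\bigl(q^3+t\cdot\lceil \mathrm{len}(\partial R)\rceil\bigr),$$ where $\mathrm{len}(\partial R)$ is the total length of the boundary $\partial R$ and arithmetic operations on numbers are counted at unit cost.
   Context: Regions and perimeters. There are $m$ pairwise disjoint regions $R_1,\dots,R_m\subset\mathbb R^2$, each homeomorphic to the closed unit disc, with boundary $\partial R_i$ a closed curve of finite length. For each $i$, a nonempty set $P_i\subset\partial R_i$ is given which must be guarded; $P_i$ is either all of $\partial R_i$ or a union of finitely many disjoint closed arcs. The maximal connected components of $P_i$ are called segments and those of $\partial R_i\setminus P_i$ are called gaps. The perimeter set is $\mathcal P=\{P_1,\dots,P_m\}$. For complexity purposes an instance is specified by giving, for each $i$, the cyclic sequence of the lengths of the segments and gaps along $\partial R_i$ (nonnegative rational numbers), since the problem depends only on these data. Pseudo-polynomial time means time polynomial in the input size and in the magnitudes of the numerical input data. Covers. Each deployed robot $j$ is assigned a connected closed subset (arc) $C_j$ of some single $\partial R_i$; two such sets may share at most endpoints. $\mathcal C=\{C_j\}$ is a cover of $\mathcal P$ if $\bigcup_i P_i\subset\bigcup_j C_j$ (gaps may, but need not, be covered). $\mathrm{len}(C_j)$ denotes the length of $C_j$. Problem $\mathrm{OPG}_{MC}$. The input consists of the perimeter data above,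 together with $t$ types of robots, each available in unlimited quantity: a robot of type $1\le\tau\le t$ can guard a length of at most $\ell_\tau\in\mathbb Z^+$ and costs $c_\tau\in\mathbb Z^+$. A feasible cover consists of nonnegative integers $n_1,\dots,n_t$, with $n=n_1+\dots+n_t$, and a cover $\mathcal C=\{C_1,\dots,C_n\}$ of $\mathcal P$ in which exactly $n_\tau$ of the $C_j$ are assigned to robots of type $\tau$, and $\mathrm{len}(C_j)\le\ell_{\tau_j}$ for every $j$, where $\tau_j$ is the type of robot $j$. Its total cost is $\sum_{\tau=1}^t n_\tau c_\tau$. The task is to find a feasible cover of minimum total cost. *)

theory Defs
  imports "HOL-Analysis.Analysis" "HOL-Library.Log_Nat"
begin

section \<open>Regions, perimeters and arc length\<close>

text \<open>Length of the curve \<open>g\<close> between the parameters \<open>a\<close> and \<open>b\<close>: supremum of the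
  lengths of inscribed polygons.\<close>

definition curve_length :: "(real \<Rightarrow> real^2) \<Rightarrow> real \<Rightarrow> real \<Rightarrow> ennreal" where
  "curve_length g a b =
     (SUP ts \<in> {ts. sorted ts \<and> set ts \<subseteq> {a..b}}.
        ennreal (\<Sum>i < length ts - 1. dist (g (ts ! i)) (g (ts ! Suc i))))"

text \<open>The closed boundary curve of finite length is carried along as a parametrisation
  \<open>bdry\<close> by arc length, with period the total length \<open>circ\<close>; it fixes the base point and
  the orientation with respect to which lengths are listed along the boundary.\<close>

record region =
  body  :: "(real^2) set"
  bdry  :: "real \<Rightarrow> real^2"
  circ  :: real
  perim :: "(real^2) set"

definition valid_region :: "region \<Rightarrow> bool" where
  "valid_region r \<longleftrightarrow>
     body r homeomorphic cball (0 :: real^2) 1 \<and>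
     circ r > 0 \<and>
     continuous_on UNIV (bdry r) \<and>
     (\<forall>s. bdry r (s + circ r) = bdry r s) \<and>
     inj_on (bdry r) {0..<circ r} \<and>
     bdry r ` {0..<circ r} = frontier (body r) \<and>
     (\<forall>a b. a \<le> b \<longrightarrow> curve_length (bdry r) a b = ennreal (b - a)) \<and>
     perim r \<noteq> {} \<and> perim r \<subseteq> frontier (body r)"

definition segments :: "region \<Rightarrow> (real^2) set set" where
  "segments r = components (perim r)"

definition gaps :: "region \<Rightarrow> (real^2) set set" where
  "gaps r = components (frontier (body r) - perim r)"

text \<open>Connected closed subsets of the boundary. The whole boundary is admitted.\<close>

definition boundary_arc :: "region \<Rightarrow> (real^2) set \<Rightarrow> bool" where
  "boundary_arc r C \<longleftrightarrow> C \<noteq> {} \<and> closed C \<and> connected C \<and> C \<subseteq> frontier (body r)"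

definition arc_len :: "region \<Rightarrow> (real^2) set \<Rightarrow> real" where
  "arc_len r C = measure lborel {s \<in> {0..<circ r}. bdry r s \<in> C}"

text \<open>Endpoints are the boundary points of \<open>C\<close> relative to the boundary curve; a
  one-point arc is its own endpoint.\<close>

definition endpoints :: "region \<Rightarrow> (real^2) set \<Rightarrow> (real^2) set" where
  "endpoints r C = C \<inter> closure (frontier (body r) - C)"


section \<open>The problem\<close>

text \<open>A region is listed as \<open>[(s\<^sub>1, g\<^sub>1), \<dots>, (s\<^sub>q, g\<^sub>q)]\<close>, segment \<open>k\<close> of length \<open>s\<^sub>k\<close>
  being followed by a gap of length \<open>g\<^sub>k\<close>. The case where the whole boundary has to be
  guarded is \<open>[(s, 0)]\<close>; gap length \<open>0\<close> means that there is no gap. Robot types are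
  pairs of a guarding capacity and a cost.\<close>

record opg_instance =
  perims :: "(rat \<times> rat) list list"
  rtypes :: "(nat \<times> nat) list"

definition valid_perim :: "(rat \<times> rat) list \<Rightarrow> bool" where
  "valid_perim xs \<longleftrightarrow>
     xs \<noteq> [] \<and> (\<forall>(s, g) \<in> set xs. s \<ge> 0) \<and>
     ((\<forall>(s, g) \<in> set xs. g > 0) \<or> (\<exists>s > 0. xs = [(s, 0)]))"

definition valid_instance :: "opg_instance \<Rightarrow> bool" where
  "valid_instance I \<longleftrightarrow>
     perims I \<noteq> [] \<and> (\<forall>xs \<in> set (perims I). valid_perim xs) \<and>
     rtypes I \<noteq> [] \<and> (\<forall>(l, c) \<in> set (rtypes I). l > 0 \<and> c > 0)"

definition seg_start :: "(rat \<times> rat) list \<Rightarrow> nat \<Rightarrow> real" where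
  "seg_start xs k = of_rat (\<Sum>(s, g) \<leftarrow> take k xs. s + g)"

definition seg_end :: "(rat \<times> rat) list \<Rightarrow> nat \<Rightarrow> real" where
  "seg_end xs k = seg_start xs k + of_rat (fst (xs ! k))"

text \<open>\<open>xs\<close> is the cyclic sequence of segment and gap lengths along the boundary of \<open>r\<close>,
  read off from the base point of \<open>bdry r\<close>.\<close>

definition describes :: "(rat \<times> rat) list \<Rightarrow> region \<Rightarrow> bool" where
  "describes xs r \<longleftrightarrow>
     circ r = seg_start xs (length xs) \<and>
     bij_betw (\<lambda>k. bdry r ` {seg_start xs k .. seg_end xs k}) {..<length xs} (segments r) \<and>
     bij_betw (\<lambda>k. bdry r ` {seg_end xs k <..< seg_start xs (Suc k)})
       {k. k < length xs \<and> snd (xs ! k) > 0} (gaps r)"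

definition realizes :: "opg_instance \<Rightarrow> region list \<Rightarrow> bool" where
  "realizes I Rs \<longleftrightarrow>
     list_all2 describes (perims I) Rs \<and>
     (\<forall>r \<in> set Rs. valid_region r) \<and>
     (\<forall>i < length Rs. \<forall>j < length Rs. i \<noteq> j \<longrightarrow> body (Rs ! i) \<inter> body (Rs ! j) = {})"

text \<open>A feasible cover consists of the numbers \<open>n\<^sub>\<tau>\<close> of robots of each type (list \<open>ns\<close>) and
  the deployed robots (list \<open>rs\<close>), each given by its type (an index into the list of types)
  and its assigned arc.\<close>

definition feasible_cover ::
  "(nat \<times> nat) list \<Rightarrow> region list \<Rightarrow> nat list \<Rightarrow> (nat \<times> (real^2) set) list \<Rightarrow> bool" where
  "feasible_cover ty Rs ns rs \<longleftrightarrow>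
     length ns = length ty \<and>
     length rs = sum_list ns \<and>
     (\<forall>\<tau> < length ty. card {j. j < length rs \<and> fst (rs ! j) = \<tau>} = ns ! \<tau>) \<and>
     (\<forall>(\<tau>, C) \<in> set rs. \<tau> < length ty \<and>
        (\<exists>r \<in> set Rs. boundary_arc r C \<and> arc_len r C \<le> real (fst (ty ! \<tau>)))) \<and>
     (\<forall>i < length rs. \<forall>j < length rs. i \<noteq> j \<longrightarrow>
        (\<forall>r \<in> set Rs. snd (rs ! i) \<inter> snd (rs ! j) \<inter> frontier (body r)
           \<subseteq> endpoints r (snd (rs ! i)) \<inter> endpoints r (snd (rs ! j)))) \<and>
     (\<Union>r \<in> set Rs. perim r) \<subseteq> (\<Union>(\<tau>, C) \<in> set rs. C)"

definition total_cost :: "(nat \<times> nat) list \<Rightarrow> nat list \<Rightarrow> nat" where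
  "total_cost ty ns = (\<Sum>\<tau> < length ty. ns ! \<tau> * snd (ty ! \<tau>))"

definition optimal_cover ::
  "(nat \<times> nat) list \<Rightarrow> region list \<Rightarrow> nat list \<Rightarrow> (nat \<times> (real^2) set) list \<Rightarrow> bool" where
  "optimal_cover ty Rs ns rs \<longleftrightarrow>
     feasible_cover ty Rs ns rs \<and>
     (\<forall>ns' rs'. feasible_cover ty Rs ns' rs' \<longrightarrow> total_cost ty ns \<le> total_cost ty ns')"


section \<open>Machine model\<close>

text \<open>Random-access programs over rational numbers with unit-cost arithmetic. The store
  consists of arrays; \<open>Arr x i\<close> reads array \<open>x\<close> at the index given by the floor of \<open>i\<close>,
  and scalars are entries at index \<open>0\<close>. Multiplication is deliberately left out: with
  addition, subtraction and floor a number grows by a bounded number of bits per step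
  (denominators always divide a fixed product of input and program denominators), so unit
  cost cannot hide superpolynomial work and agrees with bit cost up to a polynomial.\<close>

type_synonym store = "string \<Rightarrow> int \<Rightarrow> rat"

datatype aexp =
  Const rat
| Arr string aexp
| Plus aexp aexp
| Minus aexp aexp
| Floor aexp

datatype bexp =
  Leq aexp aexp
| BNot bexp
| BAnd bexp bexp

datatype com =
  SKIP
| Assign string aexp aexp \<comment> \<open>array, index, value\<close>
| Seq com com
| If bexp com com
| While bexp com

primrec aval :: "aexp \<Rightarrow> store \<Rightarrow> rat" where
  "aval (Const q) s = q"
| "aval (Arr x i) s = s x \<lfloor>aval i s\<rfloor>"
| "aval (Plus a b) s = aval a s + aval b s"
| "aval (Minus a b) s = aval a s - aval b s"
| "aval (Floor a) s = of_int \<lfloor>aval a s\<rfloor>"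

primrec bval :: "bexp \<Rightarrow> store \<Rightarrow> bool" where
  "bval (Leq a b) s \<longleftrightarrow> aval a s \<le> aval b s"
| "bval (BNot b) s \<longleftrightarrow> \<not> bval b s"
| "bval (BAnd b c) s \<longleftrightarrow> bval b s \<and> bval c s"

primrec acost :: "aexp \<Rightarrow> nat" where
  "acost (Const q) = 1"
| "acost (Arr x i) = 1 + acost i"
| "acost (Plus a b) = 1 + acost a + acost b"
| "acost (Minus a b) = 1 + acost a + acost b"
| "acost (Floor a) = 1 + acost a"

primrec bcost :: "bexp \<Rightarrow> nat" where
  "bcost (Leq a b) = 1 + acost a + acost b"
| "bcost (BNot b) = 1 + bcost b"
| "bcost (BAnd b c) = 1 + bcost b + bcost c"

text \<open>\<open>exec p s n s'\<close>: started in \<open>s\<close>, program \<open>p\<close> halts in \<open>s'\<close> after \<open>n\<close> steps.\<close>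

inductive exec :: "com \<Rightarrow> store \<Rightarrow> nat \<Rightarrow> store \<Rightarrow> bool" where
  Skip: "exec SKIP s 1 s"
| Assign: "exec (Assign x i a) s (1 + acost i + acost a)
     (s(x := (s x)(\<lfloor>aval i s\<rfloor> := aval a s)))"
| Seq: "exec c1 s1 n1 s2 \<Longrightarrow> exec c2 s2 n2 s3 \<Longrightarrow> exec (Seq c1 c2) s1 (n1 + n2) s3"
| IfTrue: "bval b s \<Longrightarrow> exec c1 s n s' \<Longrightarrow> exec (If b c1 c2) s (1 + bcost b + n) s'"
| IfFalse: "\<not> bval b s \<Longrightarrow> exec c2 s n s' \<Longrightarrow> exec (If b c1 c2) s (1 + bcost b + n) s'"
| WhileFalse: "\<not> bval b s \<Longrightarrow> exec (While b c) s (1 + bcost b) s"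
| WhileTrue: "bval b s1 \<Longrightarrow> exec c s1 n1 s2 \<Longrightarrow> exec (While b c) s2 n2 s3 \<Longrightarrow>
     exec (While b c) s1 (1 + bcost b + n1 + n2) s3"


section \<open>Input, output and input size\<close>

definition arr :: "rat list \<Rightarrow> int \<Rightarrow> rat" where
  "arr xs k = (if 0 \<le> k \<and> k < int (length xs) then xs ! nat k else 0)"

text \<open>The segment and gap lengths of all regions are stored consecutively; array \<open>q\<close>
  holds the number of segments of each region.\<close>

definition input_store :: "opg_instance \<Rightarrow> store" where
  "input_store I = (\<lambda>_ _. 0)
     (''m'' := arr [of_nat (length (perims I))],
      ''t'' := arr [of_nat (length (rtypes I))],
      ''q'' := arr (map (\<lambda>xs. of_nat (length xs)) (perims I)),
      ''seg'' := arr (map fst (concat (perims I))),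
      ''gap'' := arr (map snd (concat (perims I))),
      ''ell'' := arr (map (\<lambda>(l, c). of_nat l) (rtypes I)),
      ''cost'' := arr (map (\<lambda>(l, c). of_nat c) (rtypes I)))"

text \<open>A cover is output as the numbers \<open>n\<^sub>\<tau>\<close> and, for every robot, its type, the region it
  guards and the arc-length positions on the boundary between which it is deployed.\<close>

definition outputs_cover ::
  "store \<Rightarrow> region list \<Rightarrow> nat list \<Rightarrow> (nat \<times> (real^2) set) list \<Rightarrow> bool" where
  "outputs_cover s Rs ns rs \<longleftrightarrow>
     (\<forall>\<tau> < length ns. s ''num'' (int \<tau>) = of_nat (ns ! \<tau>)) \<and>
     (\<forall>j < length rs.
        s ''type'' (int j) = of_nat (fst (rs ! j)) \<and>
        (\<exists>i < length Rs. s ''region'' (int j) = of_nat i \<and>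
           snd (rs ! j) =
             bdry (Rs ! i) ` {of_rat (s ''from'' (int j)) .. of_rat (s ''to'' (int j))}))"

definition input_numbers :: "opg_instance \<Rightarrow> rat list" where
  "input_numbers I =
     concat (map (\<lambda>(s, g). [s, g]) (concat (perims I))) @
     concat (map (\<lambda>(l, c). [of_nat l, of_nat c]) (rtypes I))"

definition bit_size :: "rat \<Rightarrow> nat" where
  "bit_size x = (case quotient_of x of (a, b) \<Rightarrow> floorlog 2 (nat \<bar>a\<bar>) + floorlog 2 (nat b))"

definition input_size :: "opg_instance \<Rightarrow> nat" where
  "input_size I = length (perims I) + (\<Sum>x \<leftarrow> input_numbers I. bit_size x)"

definition input_magnitude :: "opg_instance \<Rightarrow> nat" where
  "input_magnitude I = Max ((\<lambda>x. nat \<lceil>x\<rceil>) ` set (input_numbers I))"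

end

theory Submission
  imports Defs
begin

text \<open>Only the gaps that a cover leaves partly unguarded matter. Cutting the boundary at one unguarded
  point in each such gap splits it into stretches, and a robot, being deployed on a connected set
  that avoids the cut points, works inside one stretch only. A stretch runs from the start of some
  segment to the end of the same or a later one and everything in between is guarded, so the
  capacities of its robots add up to at least its length; conversely a team with that much capacity
  and no superfluous robot can guard it, placed one after the other. Capacities are integers, so what
  a stretch costs is the value of an unbounded knapsack problem at its length rounded up
  (\<open>fleet_cost\<close>), and what is left is to choose where to cut: fix the first segment after a cut and
  minimise over the start of the last stretch (\<open>part_cost\<close>). This gives the lower bound \<open>opt_cost_le_cover\<close>; that the value is attained
  is \<open>plan_optimal\<close>. If no gap is cut, the whole boundary is guarded and the same team
  can guard the stretch that omits one gap, so this case needs no separate treatment.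

  The knapsack table up to the rounded perimeter takes time proportional to its length times the
  number of types; the table of \<open>part_cost\<close> takes quadratic time for each of the \<open>q\<close> possible
  first segments. Backtracking through both tables yields an explicit optimal cover in time
  linear in \<open>q\<close> plus the perimeter. A single program does this region after region
  (\<open>opg_program_correct\<close>); summed over all regions its running time is pseudo-polynomial, and for
  one region it is the bound claimed.\<close>

section \<open>Programs with time budgets\<close>

primrec writes :: "com \<Rightarrow> string set" where
  "writes SKIP = {}"
| "writes (Assign x i a) = {x}"
| "writes (Seq c1 c2) = writes c1 \<union> writes c2"
| "writes (If b c1 c2) = writes c1 \<union> writes c2"
| "writes (While b c) = writes c"

lemma exec_frame: "exec c s n s' \<Longrightarrow> x \<notin> writes c \<Longrightarrow> s' x = s x"
  by (induction rule: exec.induct) auto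

text \<open>A loop-free program always terminates, so it acts as a function on stores (\<open>run\<close>) with a time bound
  that can be read off its text (\<open>max_time\<close>). Symbolic execution of such code is then plain rewriting;
  only loops need rules of their own. The clauses for \<open>While\<close> are dummies.\<close>

primrec loop_free :: "com \<Rightarrow> bool" where
  "loop_free SKIP = True"
| "loop_free (Assign x i a) = True"
| "loop_free (Seq c1 c2) = (loop_free c1 \<and> loop_free c2)"
| "loop_free (If b c1 c2) = (loop_free c1 \<and> loop_free c2)"
| "loop_free (While b c) = False"

primrec run :: "com \<Rightarrow> store \<Rightarrow> store" where
  "run SKIP s = s"
| "run (Assign x i a) s = s(x := (s x)(\<lfloor>aval i s\<rfloor> := aval a s))"
| "run (Seq c1 c2) s = run c2 (run c1 s)"
| "run (If b c1 c2) s = (if bval b s then run c1 s else run c2 s)"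
| "run (While b c) s = s"

primrec max_time :: "com \<Rightarrow> nat" where
  "max_time SKIP = 1"
| "max_time (Assign x i a) = 1 + acost i + acost a"
| "max_time (Seq c1 c2) = max_time c1 + max_time c2"
| "max_time (If b c1 c2) = 1 + bcost b + max (max_time c1) (max_time c2)"
| "max_time (While b c) = 0"

lemma exec_loop_free: "loop_free c \<Longrightarrow> \<exists>n \<le> max_time c. exec c s n (run c s)"
proof (induction c arbitrary: s)
  case SKIP
  show ?case using exec.Skip by auto
next
  case (Assign x i a)
  show ?case unfolding max_time.simps run.simps using exec.Assign by blast
next
  case (Seq c1 c2)
  then obtain n1 n2 where "n1 \<le> max_time c1" "exec c1 s n1 (run c1 s)"
      "n2 \<le> max_time c2" "exec c2 (run c1 s) n2 (run c2 (run c1 s))"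
    by (metis loop_free.simps(3))
  then show ?case using exec.Seq by (metis add_mono max_time.simps(3) run.simps(3))
next
  case (If b c1 c2)
  obtain n1 where n1: "n1 \<le> max_time c1" "exec c1 s n1 (run c1 s)"
    using If by (meson loop_free.simps(4))
  obtain n2 where n2: "n2 \<le> max_time c2" "exec c2 s n2 (run c2 s)"
    using If by (meson loop_free.simps(4))
  show ?case
  proof (cases "bval b s")
    case True
    then show ?thesis using exec.IfTrue[OF True n1(2), of c2] n1(1)
      by (intro exI[of _ "1 + bcost b + n1"]) (auto simp: max_def)
  next
    case False
    then show ?thesis using exec.IfFalse[OF False n2(2), of c1] n2(1)
      by (intro exI[of _ "1 + bcost b + n2"]) (auto simp: max_def)
  qed
qed auto

text \<open>Total correctness from a single start state rather than under a precondition, so that the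
  time budget and the postcondition may mention that state.\<close>

definition reach :: "com \<Rightarrow> store \<Rightarrow> nat \<Rightarrow> (store \<Rightarrow> bool) \<Rightarrow> bool" where
  "reach c s T Q \<longleftrightarrow> (\<exists>n s'. exec c s n s' \<and> n \<le> T \<and> Q s')"

lemma reach_loop_free:
  "loop_free c \<Longrightarrow> max_time c \<le> T \<Longrightarrow> Q (run c s) \<Longrightarrow> reach c s T Q"
  unfolding reach_def using exec_loop_free[of c s] by (meson le_trans)

lemma reach_mono: "reach c s T Q \<Longrightarrow> T \<le> T' \<Longrightarrow> (\<And>s'. Q s' \<Longrightarrow> Q' s') \<Longrightarrow> reach c s T' Q'"
  unfolding reach_def by (meson le_trans)

lemma reach_frame:
  "reach c s T Q \<Longrightarrow> reach c s T (\<lambda>s'. Q s' \<and> (\<forall>x. x \<notin> writes c \<longrightarrow> s' x = s x))"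
  unfolding reach_def using exec_frame by blast

text \<open>The second program may rely on every variable that the first one does not assign. Without
  this, all invariants would have to list the unchanged parts of the store.\<close>

lemma reach_Seq:
  assumes "reach c1 s T1 Q1" "\<And>s'. Q1 s' \<Longrightarrow> (\<And>x. x \<notin> writes c1 \<Longrightarrow> s' x = s x) \<Longrightarrow> reach c2 s' T2 Q"
    "T1 + T2 \<le> T"
  shows "reach (Seq c1 c2) s T Q"
proof -
  obtain n1 s1 where 1: "exec c1 s n1 s1" "n1 \<le> T1" "Q1 s1"
    using assms(1) by (auto simp: reach_def)
  then have "reach c2 s1 T2 Q" using assms(2) exec_frame by blast
  then obtain n2 s2 where 2: "exec c2 s1 n2 s2" "n2 \<le> T2" "Q s2"
    by (auto simp: reach_def)
  show ?thesis unfolding reach_def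
    using exec.Seq[OF 1(1) 2(1)] 1 2 assms(3) by (meson add_mono le_trans)
qed

lemma reach_While_False:
  "\<not> bval b s \<Longrightarrow> Q s \<Longrightarrow> 1 + bcost b \<le> T \<Longrightarrow> reach (While b c) s T Q"
  unfolding reach_def using exec.WhileFalse by blast

lemma reach_While_True:
  assumes "bval b s" "reach c s T1 Q1"
    "\<And>s'. Q1 s' \<Longrightarrow> (\<And>x. x \<notin> writes c \<Longrightarrow> s' x = s x) \<Longrightarrow> reach (While b c) s' T2 Q"
    "1 + bcost b + T1 + T2 \<le> T"
  shows "reach (While b c) s T Q"
proof -
  obtain n1 s1 where 1: "exec c s n1 s1" "n1 \<le> T1" "Q1 s1"
    using assms(2) by (auto simp: reach_def)
  then have "reach (While b c) s1 T2 Q" using assms(3) exec_frame by blast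
  then obtain n2 s2 where 2: "exec (While b c) s1 n2 s2" "n2 \<le> T2" "Q s2"
    by (auto simp: reach_def)
  show ?thesis unfolding reach_def
    using exec.WhileTrue[OF assms(1) 1(1) 2(1)] 1 2 assms(4)
    by (intro exI[of _ "1 + bcost b + n1 + n2"] exI[of _ s2]) auto
qed

lemma reach_While_count:
  assumes body: "\<And>k s. lo \<le> k \<Longrightarrow> k < hi \<Longrightarrow> I k s \<Longrightarrow> bval b s \<and> reach c s (T k) (I (Suc k))"
    and exit: "\<And>s. I hi s \<Longrightarrow> \<not> bval b s"
    and "I lo s" "lo \<le> hi"
    and time: "(\<Sum>k = lo..<hi. 1 + bcost b + T k) + 1 + bcost b \<le> T'"
  shows "reach (While b c) s T' (I hi)"
proof -
  have "reach (While b c) s ((\<Sum>k = l..<hi. 1 + bcost b + T k) + 1 + bcost b) (I hi)"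
    if "l \<le> hi" "lo \<le> l" "I l s" for l s
    using that
  proof (induction l arbitrary: s rule: inc_induct)
    case base
    then show ?case using exit reach_While_False by auto
  next
    case (step l)
    have "bval b s" "reach c s (T l) (I (Suc l))"
      using body[of l s] step by auto
    then show ?case
    proof (rule reach_While_True)
      fix s' assume "I (Suc l) s'"
      then show "reach (While b c) s' ((\<Sum>k = Suc l..<hi. 1 + bcost b + T k) + 1 + bcost b) (I hi)"
        using step by auto
    next
      show "1 + bcost b + T l + ((\<Sum>k = Suc l..<hi. 1 + bcost b + T k) + 1 + bcost b)
          \<le> (\<Sum>k = l..<hi. 1 + bcost b + T k) + 1 + bcost b"
        using sum.atLeast_Suc_lessThan[OF step(2), of "\<lambda>k. 1 + bcost b + T k"] by simp
    qed
  qed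
  from reach_mono[OF this[OF assms(4) order_refl assms(3)] time] show ?thesis by blast
qed

abbreviation V :: "string \<Rightarrow> aexp" where "V x \<equiv> Arr x (Const 0)"
abbreviation Set :: "string \<Rightarrow> aexp \<Rightarrow> com" where "Set x a \<equiv> Assign x (Const 0) a"
abbreviation Less :: "aexp \<Rightarrow> aexp \<Rightarrow> bexp" where "Less a b \<equiv> BNot (Leq b a)"

text \<open>All three minimisations (over robot types, over the start of the last stretch, over the first
  segment) are instances of this loop. No value plays the part of infinity: the first candidate is
  always accepted.\<close>

definition argmin_loop :: "string \<Rightarrow> rat \<Rightarrow> aexp \<Rightarrow> com \<Rightarrow> string \<Rightarrow> string \<Rightarrow> string \<Rightarrow> com" where
  "argmin_loop i lo hi c v b a =
     Seq (Set i (Const lo))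
      (While (Less (V i) hi)
        (Seq c
          (Seq (If (BAnd (Less (Const lo) (V i)) (Leq (V b) (V v))) SKIP
                  (Seq (Set b (V v)) (Set a (V i))))
               (Set i (Plus (V i) (Const 1))))))"

lemma writes_argmin_loop: "writes (argmin_loop i lo hi c v b a) = {i, b, a} \<union> writes c"
  by (auto simp: argmin_loop_def)

lemma Min_image_Suc:
  fixes f :: "nat \<Rightarrow> nat"
  assumes "lo < k"
  shows "Min (f ` {lo..<Suc k}) = min (f k) (Min (f ` {lo..<k}))"
proof -
  have "{lo..<Suc k} = insert k {lo..<k}" using assms by auto
  then show ?thesis using assms by simp
qed

text \<open>\<open>P\<close> collects what the surrounding program knows about variables left alone by \<open>c\<close>; \<open>Z\<close> is a property of
  variables that \<open>c\<close> does assign and that each run of \<open>c\<close> re-establishes, as needed when \<open>c\<close> refills a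
  table whose cells at indices up to \<open>0\<close> have to stay \<open>0\<close>.\<close>

lemma reach_argmin_loop:
  fixes f :: "nat \<Rightarrow> nat"
  assumes distinct: "i \<noteq> b" "i \<noteq> a" "a \<noteq> b" "v \<notin> {i, a, b}"
    and fresh: "i \<notin> writes c" "b \<notin> writes c" "a \<notin> writes c"
    and stable: "\<And>s s'. P s \<Longrightarrow> (\<And>x. x \<notin> {i, a, b} \<union> writes c \<Longrightarrow> s' x = s x) \<Longrightarrow> Z s' \<Longrightarrow> P s'"
    and Z: "\<And>s s'. Z s \<Longrightarrow> (\<And>x. x \<notin> {i, a, b} \<Longrightarrow> s' x = s x) \<Longrightarrow> Z s'"
    and hi: "\<And>s. P s \<Longrightarrow> aval hi s = of_nat n" and "lo < n"
    and body: "\<And>k s. lo \<le> k \<Longrightarrow> k < n \<Longrightarrow> P s \<Longrightarrow> Z s \<Longrightarrow> s i 0 = of_nat k \<Longrightarrow>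
      reach c s T (\<lambda>s'. s' v 0 = of_nat (f k) \<and> Z s')"
    and P: "P s" and Zs: "Z s"
    and time: "(n - lo) * (T + acost hi + 40) + acost hi + 10 \<le> T'"
  shows "reach (argmin_loop i (of_nat lo) hi c v b a) s T'
    (\<lambda>s'. P s' \<and> Z s' \<and> s' b 0 = of_nat (Min (f ` {lo..<n})) \<and>
      (\<exists>k. lo \<le> k \<and> k < n \<and> s' a 0 = of_nat k \<and> f k = Min (f ` {lo..<n})))"
proof -
  define I where "I = (\<lambda>k s. P s \<and> Z s \<and> s i 0 = of_nat k \<and> (lo < k \<longrightarrow>
     s b 0 = of_nat (Min (f ` {lo..<k})) \<and>
      (\<exists>h. lo \<le> h \<and> h < k \<and> s a 0 = of_nat h \<and> f h = Min (f ` {lo..<k}))))"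
  let ?g = "Less (V i) hi"
  let ?c2 = "Seq (If (BAnd (Less (Const (of_nat lo)) (V i)) (Leq (V b) (V v))) SKIP
                  (Seq (Set b (V v)) (Set a (V i)))) (Set i (Plus (V i) (Const 1)))"
  show ?thesis unfolding argmin_loop_def
  proof (rule reach_Seq[where ?T1.0 = 3 and ?T2.0 = "T' - 3" and ?Q1.0 = "I lo"])
    have "P (s(i := (s i)(0 := of_nat lo)))" "Z (s(i := (s i)(0 := of_nat lo)))"
      using stable[OF P] Z[OF Zs] by auto
    then show "reach (Set i (Const (of_nat lo))) s 3 (I lo)"
      by (intro reach_loop_free) (auto simp: I_def)
    show "3 + (T' - 3) \<le> T'" using time by auto
  next
    fix s1 assume I0: "I lo s1"
    have "reach (While ?g (Seq c ?c2)) s1 (T' - 3) (I n)"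
    proof (rule reach_While_count[where lo = lo and T = "\<lambda>_. T + 26"])
      fix k s assume k: "lo \<le> k" "k < n" and I: "I k s"
      have "bval ?g s" using I k hi[of s] by (auto simp: I_def)
      moreover have "reach (Seq c ?c2) s (T + 26) (I (Suc k))"
      proof (rule reach_Seq[where ?T2.0 = 26])
        show "reach c s T (\<lambda>s'. s' v 0 = of_nat (f k) \<and> Z s')"
          using body[OF k] I by (auto simp: I_def)
      next
        fix s' assume v: "s' v 0 = of_nat (f k) \<and> Z s'"
          and fr: "\<And>x. x \<notin> writes c \<Longrightarrow> s' x = s x"
        have Ps': "P s'" using stable[of s s'] I fr v by (auto simp: I_def)
        have eq: "s' i 0 = of_nat k" "s' a = s a" "s' b = s b"
          using fr fresh I by (auto simp: I_def)
        let ?s = "run ?c2 s'"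
        have fr2: "?s x = s' x" if "x \<notin> {i,a,b}" for x using that by auto
        have "Z ?s" using Z[of s' ?s] fr2 v by blast
        moreover have "P ?s" using stable[OF Ps', of ?s] fr2 \<open>Z ?s\<close> by blast
        moreover have "?s i 0 = of_nat (Suc k)" using distinct eq by auto
        moreover have "?s b 0 = of_nat (Min (f ` {lo..<Suc k})) \<and>
            (\<exists>h. lo \<le> h \<and> h < Suc k \<and> ?s a 0 = of_nat h \<and> f h = Min (f ` {lo..<Suc k}))"
        proof (cases "lo < k")
          case True
          obtain h where h: "lo \<le> h" "h < k" "s a 0 = of_nat h" "f h = Min (f ` {lo..<k})"
              "s b 0 = of_nat (Min (f ` {lo..<k}))"
            using I True by (auto simp: I_def)
          show ?thesis
          proof (cases "f h \<le> f k")
            case le: True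
            have "?s b 0 = of_nat (f h)" "?s a 0 = of_nat h"
              using distinct eq h v True le by auto
            then show ?thesis using h le Min_image_Suc[OF True, of f] by auto
          next
            case le: False
            have "?s b 0 = of_nat (f k)" "?s a 0 = of_nat k"
              using distinct eq h v True le by auto
            then show ?thesis using h le Min_image_Suc[OF True, of f] k
              by (metis le_antisym less_Suc_eq min.absorb1 nat_le_linear)
          qed
        next
          case False
          then have "k = lo" using k by simp
          then have "?s b 0 = of_nat (f k)" "?s a 0 = of_nat k"
            using distinct eq v by auto
          then show ?thesis using \<open>k = lo\<close> by auto
        qed
        ultimately have "I (Suc k) ?s" unfolding I_def by blast
        then show "reach ?c2 s' 26 (I (Suc k))"
          by (rule reach_loop_free[rotated 2]) auto
      qed simp
      ultimately show "bval ?g s \<and> reach (Seq c ?c2) s (T + 26) (I (Suc k))" by blast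
    next
      show "\<not> bval ?g s" if "I n s" for s using that hi[of s] by (auto simp: I_def)
      show "I lo s1" by fact
      show "lo \<le> n" using \<open>lo < n\<close> by simp
      have "(n - lo) * (T + acost hi + 31) \<le> (n - lo) * (T + acost hi + 40)" by simp
      then show "(\<Sum>k = lo..<n. 1 + bcost ?g + (T + 26)) + 1 + bcost ?g \<le> T' - 3"
        using time by (simp add: algebra_simps)
    qed
    then show "reach (While ?g (Seq c ?c2)) s1 (T' - 3) (\<lambda>s'. P s' \<and> Z s' \<and> s' b 0 = of_nat (Min (f ` {lo..<n})) \<and>
      (\<exists>k. lo \<le> k \<and> k < n \<and> s' a 0 = of_nat k \<and> f k = Min (f ` {lo..<n})))"
      by (rule reach_mono) (use \<open>lo < n\<close> in \<open>auto simp: I_def\<close>)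
  qed
qed

definition fill_table :: "string \<Rightarrow> aexp \<Rightarrow> com \<Rightarrow> string \<Rightarrow> string \<Rightarrow> string \<Rightarrow> string \<Rightarrow> com" where
  "fill_table x N c b a tab ch =
     Seq (Set x (Const 1))
      (While (Leq (V x) N)
        (Seq c
          (Seq (Assign tab (V x) (V b))
            (Seq (Assign ch (V x) (V a))
               (Set x (Plus (V x) (Const 1)))))))"

lemma writes_fill_table: "writes (fill_table x N c b a tab ch) = {x, tab, ch} \<union> writes c"
  by (auto simp: fill_table_def)

text \<open>Negative indices are part of the table: the store holds \<open>f 0\<close> there, so that reading at a difference
  of indices agrees with truncated subtraction on natural numbers and no case distinction is needed.\<close>

definition table :: "string \<Rightarrow> (nat \<Rightarrow> nat) \<Rightarrow> nat \<Rightarrow> store \<Rightarrow> bool" where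
  "table tab f n s \<longleftrightarrow> (\<forall>z \<le> int n. s tab z = of_nat (f (nat z)))"

text \<open>A relation instead of a function, since any minimiser will do for backtracking.\<close>

definition choices :: "string \<Rightarrow> (nat \<Rightarrow> nat \<Rightarrow> bool) \<Rightarrow> nat \<Rightarrow> store \<Rightarrow> bool" where
  "choices ch R n s \<longleftrightarrow> (\<forall>j \<in> {1..n}. \<exists>h. R j h \<and> s ch (int j) = of_nat h)"

lemma reach_fill_table:
  assumes distinct: "x \<notin> {tab, ch}" "tab \<noteq> ch" "b \<notin> {x, tab, ch}" "a \<notin> {x, tab, ch}"
    and fresh: "writes c \<inter> {x, tab, ch} = {}"
    and stable: "\<And>s s'. P s \<Longrightarrow> (\<And>y. y \<notin> {x, tab, ch} \<union> writes c \<Longrightarrow> s' y = s y) \<Longrightarrow> P s'"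
    and N: "\<And>s. P s \<Longrightarrow> aval N s = of_nat n"
    and body: "\<And>k s. 1 \<le> k \<Longrightarrow> k \<le> n \<Longrightarrow> P s \<Longrightarrow> s x 0 = of_nat k \<Longrightarrow> table tab f (k - 1) s \<Longrightarrow>
      reach c s T (\<lambda>s'. s' b 0 = of_nat (f k) \<and> (\<exists>h. R k h \<and> s' a 0 = of_nat h))"
    and P: "P s" and init: "\<And>z. z \<le> 0 \<Longrightarrow> s tab z = 0" "f 0 = 0"
    and time: "n * (T + acost N + 40) + acost N + 20 \<le> T'"
  shows "reach (fill_table x N c b a tab ch) s T'
    (\<lambda>s'. P s' \<and> table tab f n s' \<and> choices ch R n s')"
proof -
  define I where "I = (\<lambda>k s. P s \<and> s x 0 = of_nat k \<and> table tab f (k - 1) s \<and> choices ch R (k - 1) s)"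
  let ?g = "Leq (V x) N"
  let ?c2 = "Seq (Assign tab (V x) (V b)) (Seq (Assign ch (V x) (V a)) (Set x (Plus (V x) (Const 1))))"
  show ?thesis unfolding fill_table_def
  proof (rule reach_Seq[where ?T1.0 = 3 and ?T2.0 = "T' - 3" and ?Q1.0 = "I 1"])
    let ?s = "run (Set x (Const 1)) s"
    have "P ?s" by (rule stable[OF P]) auto
    moreover have "table tab f 0 ?s" using init distinct by (auto simp: table_def)
    ultimately have "I 1 ?s" by (auto simp: I_def choices_def)
    then show "reach (Set x (Const 1)) s 3 (I 1)"
      by (rule reach_loop_free[rotated 2]) auto
    show "3 + (T' - 3) \<le> T'" using time by auto
  next
    fix s1 assume I1: "I 1 s1"
    have "reach (While ?g (Seq c ?c2)) s1 (T' - 3) (I (Suc n))"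
    proof (rule reach_While_count[where lo = 1 and T = "\<lambda>_. T + 16"])
      fix k s assume k: "1 \<le> k" "k < Suc n" and I: "I k s"
      have "bval ?g s" using I k N[of s] by (auto simp: I_def)
      moreover have "reach (Seq c ?c2) s (T + 16) (I (Suc k))"
      proof (rule reach_Seq[where ?T2.0 = 16])
        show "reach c s T (\<lambda>s'. s' b 0 = of_nat (f k) \<and> (\<exists>h. R k h \<and> s' a 0 = of_nat h))"
          using body[of k s] k I by (auto simp: I_def)
      next
        fix s' assume v: "s' b 0 = of_nat (f k) \<and> (\<exists>h. R k h \<and> s' a 0 = of_nat h)"
          and fr: "\<And>x. x \<notin> writes c \<Longrightarrow> s' x = s x"
        obtain h where h: "R k h" "s' a 0 = of_nat h" using v by auto
        let ?s = "run ?c2 s'"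
        have eq: "s' x = s x" "s' tab = s tab" "s' ch = s ch" using fr fresh by auto
        have xk: "s' x 0 = of_nat k" using eq I by (simp add: I_def)
        have "?s y = s y" if "y \<notin> {x,tab,ch} \<union> writes c" for y using that fr[of y] by auto
        then have "P ?s" using stable[of s ?s] I unfolding I_def by blast
        moreover have "?s x 0 = of_nat (Suc k)" using distinct eq xk by auto
        moreover have tab: "?s tab = (s tab)(int k := of_nat (f k))"
          using distinct eq xk v by auto
        have "table tab f k ?s" unfolding table_def tab
        proof (intro allI impI)
          fix z :: int assume "z \<le> int k"
          show "((s tab)(int k := of_nat (f k))) z = of_nat (f (nat z))"
          proof (cases "z = int k")
            case False
            then have "z \<le> int (k - 1)" using \<open>z \<le> int k\<close> k by auto
            then show ?thesis using I False by (auto simp: I_def table_def)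
          qed simp
        qed
        moreover have ch: "?s ch = (s ch)(int k := of_nat h)"
          using distinct eq xk h by auto
        have "choices ch R k ?s" unfolding choices_def ch
        proof
          fix j assume "j \<in> {1..k}"
          then have "j = k \<or> j \<in> {1..k-1}" by auto
          then show "\<exists>h'. R j h' \<and> ((s ch)(int k := of_nat h)) (int j) = of_nat h'"
            using h I by (auto simp: I_def choices_def)
        qed
        ultimately have "I (Suc k) ?s" unfolding I_def by simp
        then show "reach ?c2 s' 16 (I (Suc k))"
          by (rule reach_loop_free[rotated 2]) auto
      qed simp
      ultimately show "bval ?g s \<and> reach (Seq c ?c2) s (T + 16) (I (Suc k))" by blast
    next
      show "\<not> bval ?g s" if "I (Suc n) s" for s using that N[of s] by (auto simp: I_def)
      show "I 1 s1" by fact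
      show "1 \<le> Suc n" by simp
      have "n * (T + acost N + 20) \<le> n * (T + acost N + 40)" by simp
      then show "(\<Sum>k = 1..<Suc n. 1 + bcost ?g + (T + 16)) + 1 + bcost ?g \<le> T' - 3"
        using time by (simp add: algebra_simps)
    qed
    then show "reach (While ?g (Seq c ?c2)) s1 (T' - 3) (\<lambda>s'. P s' \<and> table tab f n s' \<and> choices ch R n s')"
      by (rule reach_mono) (auto simp: I_def)
  qed
qed

section \<open>The cost of guarding one stretch\<close>

text \<open>The unbounded knapsack problem. The definition by witnesses gives both the lower bound for
  arbitrary covers and, through \<open>fleet_cost_rec\<close>, the recursion that fills the table.\<close>

definition fleet_cost :: "(nat \<times> nat) list \<Rightarrow> nat \<Rightarrow> nat" where
  "fleet_cost ty x = (LEAST c. \<exists>w. set w \<subseteq> set ty \<and> x \<le> sum_list (map fst w) \<and> c = sum_list (map snd w))"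

definition valid_types :: "(nat \<times> nat) list \<Rightarrow> bool" where
  "valid_types ty \<longleftrightarrow> ty \<noteq> [] \<and> (\<forall>(l, c) \<in> set ty. l > 0 \<and> c > 0)"

lemma valid_typesD: "valid_types ty \<Longrightarrow> p \<in> set ty \<Longrightarrow> 0 < fst p"
  by (cases p) (auto simp: valid_types_def)

lemma fleet_cost_le:
  "set w \<subseteq> set ty \<Longrightarrow> x \<le> sum_list (map fst w) \<Longrightarrow> fleet_cost ty x \<le> sum_list (map snd w)"
  unfolding fleet_cost_def by (rule Least_le) auto

lemma fleet_cost_attained:
  assumes "valid_types ty"
  obtains w where "set w \<subseteq> set ty" "x \<le> sum_list (map fst w)" "fleet_cost ty x = sum_list (map snd w)"
proof -
  obtain p where p: "p \<in> set ty" "fst p > 0"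
    using assms by (cases ty) (force simp: valid_types_def)+
  let ?w = "replicate x p"
  have "x \<le> sum_list (map fst ?w)" using p by (simp add: sum_list_replicate)
  then have "\<exists>c w. set w \<subseteq> set ty \<and> x \<le> sum_list (map fst w) \<and> c = sum_list (map snd w)"
    using p by (intro exI[of _ "sum_list (map snd ?w)"] exI[of _ ?w]) auto
  then have "\<exists>w. set w \<subseteq> set ty \<and> x \<le> sum_list (map fst w) \<and> fleet_cost ty x = sum_list (map snd w)"
    unfolding fleet_cost_def by (rule LeastI_ex)
  then show ?thesis using that by blast
qed

lemma fleet_cost_0: "fleet_cost ty 0 = 0"
  using fleet_cost_le[of "[]" ty 0] by simp

lemma fleet_cost_rec:
  assumes "valid_types ty" "0 < x"
  shows "fleet_cost ty x =
    Min ((\<lambda>h. snd (ty ! h) + fleet_cost ty (x - fst (ty ! h))) ` {..<length ty})"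
proof (rule antisym)
  let ?f = "\<lambda>h. snd (ty ! h) + fleet_cost ty (x - fst (ty ! h))"
  have ne: "?f ` {..<length ty} \<noteq> {}" using assms(1) by (auto simp: valid_types_def)
  have "fleet_cost ty x \<le> ?f h" if h: "h < length ty" for h
  proof -
    obtain w where w: "set w \<subseteq> set ty" "x - fst (ty ! h) \<le> sum_list (map fst w)"
        "fleet_cost ty (x - fst (ty ! h)) = sum_list (map snd w)"
      using fleet_cost_attained[OF assms(1)] by blast
    have "fleet_cost ty x \<le> sum_list (map snd (ty ! h # w))"
      using w h by (intro fleet_cost_le) auto
    then show ?thesis using w by simp
  qed
  then show "fleet_cost ty x \<le> Min (?f ` {..<length ty})"
    using ne by (subst Min_ge_iff) auto
  obtain w where w: "set w \<subseteq> set ty" "x \<le> sum_list (map fst w)"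
      "fleet_cost ty x = sum_list (map snd w)"
    using fleet_cost_attained[OF assms(1)] by blast
  then obtain p w' where pw: "w = p # w'" using assms(2) by (cases w) auto
  then obtain h where h: "h < length ty" "p = ty ! h"
    using w by (metis in_set_conv_nth list.set_intros(1) subsetD)
  have "Min (?f ` {..<length ty}) \<le> ?f h" using h by (intro Min_le) auto
  also have "fleet_cost ty (x - fst (ty ! h)) \<le> sum_list (map snd w')"
    using w pw h by (intro fleet_cost_le) auto
  finally show "Min (?f ` {..<length ty}) \<le> fleet_cost ty x" using w pw h by simp
qed

text \<open>Capacities are integers, so lengths may be rounded up. A segment may be a single point, of
  length \<open>0\<close>, and still needs a robot: hence the maximum with \<open>1\<close>.\<close>

definition need :: "rat \<Rightarrow> nat" where
  "need y = max 1 (nat \<lceil>y\<rceil>)"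

lemma need_pos: "0 < need y" by (simp add: need_def)

lemma le_need: "y \<le> of_nat (need y)"
proof -
  have "y \<le> of_int \<lceil>y\<rceil>" by simp
  also have "\<dots> \<le> of_int (int (need y))" unfolding of_int_le_iff need_def by auto
  finally show ?thesis by simp
qed

lemma need_minimal: "need y = 1 \<or> of_nat (need y - 1) < y"
proof (cases "nat \<lceil>y\<rceil> \<le> 1")
  case False
  then have "\<lceil>y\<rceil> > 1" by linarith
  then have n: "need y = nat \<lceil>y\<rceil>" "\<lceil>y\<rceil> > 1" unfolding need_def by linarith+
  then have "int (need y - 1) < \<lceil>y\<rceil>" by linarith
  then have "of_int (int (need y - 1)) < y" unfolding less_ceiling_iff .
  then show ?thesis unfolding of_int_of_nat_eq by blast
next
  case True
  then show ?thesis by (simp add: need_def)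
qed

lemma need_le: "0 < n \<Longrightarrow> y \<le> of_nat n \<Longrightarrow> need y \<le> n"
  unfolding need_def by (simp add: ceiling_le_iff nat_le_iff)

lemma fleet_cost_need_le:
  assumes "finite J" "J \<noteq> {}" "valid_types ty" "\<And>j. j \<in> J \<Longrightarrow> f j \<in> set ty"
    "y \<le> of_nat (\<Sum>j\<in>J. fst (f j))"
  shows "fleet_cost ty (need y) \<le> (\<Sum>j\<in>J. snd (f j))"
proof -
  obtain js where js: "set js = J" "distinct js"
    using finite_distinct_list[OF assms(1)] by blast
  have sums: "sum_list (map (\<lambda>j. g (f j)) js) = (\<Sum>j\<in>J. g (f j))" for g :: "_ \<Rightarrow> nat"
    using js by (metis sum_list_distinct_conv_sum_set)
  obtain j0 where "j0 \<in> J" using assms(2) by auto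
  then have "0 < fst (f j0)" using valid_typesD[OF assms(3)] assms(4) by blast
  then have "0 < (\<Sum>j\<in>J. fst (f j))" using \<open>j0 \<in> J\<close> assms(1) by (meson sum_pos2 zero_le)
  then have "need y \<le> (\<Sum>j\<in>J. fst (f j))" using assms(5) need_le by blast
  then show ?thesis
    using fleet_cost_le[of "map f js" ty "need y"] assms(4) js sums[of fst] sums[of snd]
    by (auto simp: comp_def)
qed

section \<open>Positions along the unrolled boundary\<close>

text \<open>Start and end of segment \<open>k\<close>, with indices running past the number of segments: the boundary is
  unrolled, so that a stretch containing the base point needs no special treatment.\<close>

definition pos :: "(rat \<times> rat) list \<Rightarrow> nat \<Rightarrow> rat" where
  "pos xs k = (\<Sum>i<k. fst (xs ! (i mod length xs)) + snd (xs ! (i mod length xs)))"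

definition epos :: "(rat \<times> rat) list \<Rightarrow> nat \<Rightarrow> rat" where
  "epos xs k = pos xs k + fst (xs ! (k mod length xs))"

definition perim_len :: "(rat \<times> rat) list \<Rightarrow> rat" where
  "perim_len xs = pos xs (length xs)"

lemma pos_0: "pos xs 0 = 0" by (simp add: pos_def)

lemma pos_Suc: "pos xs (Suc k) = epos xs k + snd (xs ! (k mod length xs))"
  by (simp add: pos_def epos_def)

lemma valid_perimD:
  assumes "valid_perim xs"
  shows "xs \<noteq> []" "k < length xs \<Longrightarrow> fst (xs ! k) \<ge> 0" "k < length xs \<Longrightarrow> snd (xs ! k) \<ge> 0"
proof -
  show "xs \<noteq> []" using assms by (simp add: valid_perim_def)
  have "fst w \<ge> 0 \<and> snd w \<ge> 0" if "w \<in> set xs" for w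
    using assms that by (cases w) (force simp: valid_perim_def)
  then show "k < length xs \<Longrightarrow> fst (xs ! k) \<ge> 0" "k < length xs \<Longrightarrow> snd (xs ! k) \<ge> 0"
    by simp_all
qed

lemma pos_le_epos: "valid_perim xs \<Longrightarrow> pos xs k \<le> epos xs k"
  using valid_perimD[of xs] by (simp add: epos_def)

lemma epos_le_pos: "valid_perim xs \<Longrightarrow> epos xs k \<le> pos xs (Suc k)"
  using valid_perimD[of xs] by (simp add: pos_Suc)

lemma pos_mono: assumes "valid_perim xs" "i \<le> j" shows "pos xs i \<le> pos xs j"
  by (rule lift_Suc_mono_le[OF _ assms(2)]) (meson assms(1) pos_le_epos epos_le_pos order_trans)

lemma pos_shift: "pos xs (k + length xs) = pos xs k + perim_len xs"
proof (induction k)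
  case (Suc k)
  have "pos xs (Suc k + length xs) = pos xs (k + length xs) + (fst (xs ! (k mod length xs)) + snd (xs ! (k mod length xs)))"
    by (simp add: pos_def)
  then show ?case using Suc by (simp add: pos_Suc epos_def)
qed (simp add: pos_0 perim_len_def)

lemma epos_shift: "epos xs (k + length xs) = epos xs k + perim_len xs"
  by (simp add: epos_def pos_shift)

lemma epos_less_pos:
  assumes "valid_perim xs" "length xs \<noteq> 1"
  shows "epos xs k < pos xs (Suc k)"
proof -
  have "\<forall>(s, g) \<in> set xs. g > 0" using assms by (auto simp: valid_perim_def)
  moreover have "xs ! (k mod length xs) \<in> set xs" using assms by (auto simp: valid_perim_def)
  ultimately have "snd (xs ! (k mod length xs)) > 0" by auto
  then show ?thesis by (simp add: pos_Suc)
qed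

lemma pos_less_pos:
  assumes "valid_perim xs"
  shows "pos xs k < pos xs (Suc k)"
proof -
  have "xs ! (k mod length xs) \<in> set xs" using assms by (auto simp: valid_perim_def)
  moreover have "fst w + snd w > 0" if "w \<in> set xs" for w
    using assms that by (cases w) (force simp: valid_perim_def add_nonneg_pos)
  ultimately have "fst (xs ! (k mod length xs)) + snd (xs ! (k mod length xs)) > 0"
    by blast
  then show ?thesis by (simp add: pos_Suc epos_def)
qed

lemma perim_len_pos: assumes "valid_perim xs" shows "perim_len xs > 0"
proof -
  obtain n where n: "length xs = Suc n" using assms by (cases xs) (auto simp: valid_perim_def)
  have "0 \<le> pos xs n" using pos_mono[OF assms, of 0 n] by (simp add: pos_0)
  then show ?thesis using pos_less_pos[OF assms, of n] by (simp add: perim_len_def n)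
qed

section \<open>Choosing the stretches\<close>

text \<open>Stretch \<open>k, \<dots>, j - 1\<close>, counted from the first segment \<open>i\<close>.\<close>

definition block_need :: "(rat \<times> rat) list \<Rightarrow> nat \<Rightarrow> nat \<Rightarrow> nat \<Rightarrow> nat" where
  "block_need xs i k j = need (epos xs (i + j - 1) - pos xs (i + k))"

function part_cost :: "(nat \<times> nat) list \<Rightarrow> (rat \<times> rat) list \<Rightarrow> nat \<Rightarrow> nat \<Rightarrow> nat" where
  "part_cost ty xs i j = (if j = 0 then 0 else
     Min ((\<lambda>k. part_cost ty xs i k + fleet_cost ty (block_need xs i k j)) ` {..<j}))"
  by auto
termination by (relation "Wellfounded.measure (\<lambda>(ty, xs, i, j). j)") auto

declare part_cost.simps [simp del]

lemma part_cost_0: "part_cost ty xs i 0 = 0"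
  by (simp add: part_cost.simps)

lemma part_cost_rec: "0 < j \<Longrightarrow> part_cost ty xs i j =
     Min ((\<lambda>k. part_cost ty xs i k + fleet_cost ty (block_need xs i k j)) ` {..<j})"
  by (subst part_cost.simps) simp

lemma part_cost_le: "k < j \<Longrightarrow> part_cost ty xs i j \<le> part_cost ty xs i k + fleet_cost ty (block_need xs i k j)"
  by (subst part_cost_rec) (auto intro!: Min_le)

text \<open>The first segment ranges over \<open>1, \<dots>, q\<close> instead of \<open>0, \<dots>, q - 1\<close>: then the gap in front of it, which is
  where the boundary is cut, lies at a nonnegative position too.\<close>

definition opt_cost :: "(nat \<times> nat) list \<Rightarrow> (rat \<times> rat) list \<Rightarrow> nat" where
  "opt_cost ty xs = Min ((\<lambda>i. part_cost ty xs i (length xs)) ` {1..length xs})"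

text \<open>The deployments \<open>(type, from, to)\<close> that backtracking through the tables may produce, on one stretch
  ending at \<open>p\<close> and on a sequence of stretches. Robots are placed from right to left, because the
  tables reveal the last stretch first.\<close>

inductive fills :: "(nat \<times> nat) list \<Rightarrow> rat \<Rightarrow> rat \<Rightarrow> nat \<Rightarrow> (nat \<times> rat \<times> rat) list \<Rightarrow> bool" for ty u where
  last: "h < length ty \<Longrightarrow> fleet_cost ty x = snd (ty ! h) \<Longrightarrow> x \<le> fst (ty ! h) \<Longrightarrow> fills ty u p x [(h, u, p)]"
| step: "h < length ty \<Longrightarrow> fleet_cost ty x = snd (ty ! h) + fleet_cost ty (x - fst (ty ! h)) \<Longrightarrow>
    fst (ty ! h) < x \<Longrightarrow> fills ty u (p - of_nat (fst (ty ! h))) (x - fst (ty ! h)) ws \<Longrightarrow>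
    fills ty u p x ((h, p - of_nat (fst (ty ! h)), p) # ws)"

inductive tiles :: "(nat \<times> nat) list \<Rightarrow> (rat \<times> rat) list \<Rightarrow> nat \<Rightarrow> nat \<Rightarrow> (nat \<times> rat \<times> rat) list \<Rightarrow> bool" for ty xs i where
  Nil: "tiles ty xs i 0 []"
| Block: "k < j \<Longrightarrow> part_cost ty xs i j = part_cost ty xs i k + fleet_cost ty (block_need xs i k j) \<Longrightarrow>
    fills ty (pos xs (i + k)) (epos xs (i + j - 1)) (block_need xs i k j) bs \<Longrightarrow>
    tiles ty xs i k ws \<Longrightarrow> tiles ty xs i j (bs @ ws)"

text \<open>Strictness keeps a one-point arc away from the left end of another arc. Together with left ends
  spanning less than one turn (\<open>region_plan\<close>), this rules out a one-point arc meeting an arc that goes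
  all the way round, which has no endpoint that the two could share.\<close>

definition before :: "nat \<times> rat \<times> rat \<Rightarrow> nat \<times> rat \<times> rat \<Rightarrow> bool" where
  "before w w' \<longleftrightarrow> fst (snd w') < fst (snd w) \<and> snd (snd w') \<le> fst (snd w)"

definition plan_cost :: "(nat \<times> nat) list \<Rightarrow> (nat \<times> rat \<times> rat) list \<Rightarrow> nat" where
  "plan_cost ty ws = (\<Sum>w\<leftarrow>ws. snd (ty ! fst w))"

text \<open>The last premise says that one unit of capacity less would not do. It survives each step, so a
  stretch of positive length is left for every further robot; hence the left ends strictly decrease.\<close>

lemma fills_props:
  assumes "fills ty u p x ws" "valid_types ty" "u \<le> p" "p - u \<le> of_nat x" "x = 1 \<or> of_nat (x - 1) < p - u"
  shows "sorted_wrt before ws" "plan_cost ty ws = fleet_cost ty x"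
    "\<forall>(h, a, b) \<in> set ws. h < length ty \<and> u \<le> a \<and> a \<le> b \<and> b \<le> p \<and> b - a \<le> of_nat (fst (ty ! h)) \<and> (u < p \<longrightarrow> a < p)"
    "\<forall>y. real_of_rat u \<le> y \<and> y \<le> real_of_rat p \<longrightarrow> (\<exists>(h, a, b) \<in> set ws. real_of_rat a \<le> y \<and> y \<le> real_of_rat b)"
proof -
  have "sorted_wrt before ws \<and> plan_cost ty ws = fleet_cost ty x \<and>
    (\<forall>(h, a, b) \<in> set ws. h < length ty \<and> u \<le> a \<and> a \<le> b \<and> b \<le> p \<and> b - a \<le> of_nat (fst (ty ! h)) \<and> (u < p \<longrightarrow> a < p)) \<and>
    (\<forall>y. real_of_rat u \<le> y \<and> y \<le> real_of_rat p \<longrightarrow> (\<exists>(h, a, b) \<in> set ws. real_of_rat a \<le> y \<and> y \<le> real_of_rat b))"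
    using assms
  proof (induction p x ws rule: fills.induct)
    case (last h x p)
    have "p - u \<le> of_nat (fst (ty ! h))" using last by (meson of_nat_le_iff order_trans)
    then show ?case using last by (auto simp: plan_cost_def)
  next
    case (step h x p ws)
    let ?l = "fst (ty ! h)"
    let ?p = "p - of_nat ?l"
    have l: "0 < ?l" using valid_typesD[OF step.prems(1)] step.hyps(1) by simp
    have x: "of_nat (x - 1) < p - u" using step.prems(4) step.hyps(3) l by auto
    have lt: "u < ?p"
    proof -
      have "?l \<le> x - 1" using step.hyps(3) by auto
      then have "rat_of_nat ?l \<le> of_nat (x - 1)" by (simp only: of_nat_le_iff)
      then show ?thesis using x by simp
    qed
    have p: "?p < p" using l by simp
    have x': "x - ?l = 1 \<or> of_nat (x - ?l - 1) < ?p - u"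
    proof -
      have "rat_of_nat (x - ?l - 1) = of_nat (x - 1) - of_nat ?l"
        using step.hyps(3) by (simp add: of_nat_diff)
      then show ?thesis using x by simp
    qed
    have IH: "sorted_wrt before ws \<and> plan_cost ty ws = fleet_cost ty (x - ?l) \<and>
      (\<forall>(h, a, b) \<in> set ws. h < length ty \<and> u \<le> a \<and> a \<le> b \<and> b \<le> ?p \<and> b - a \<le> of_nat (fst (ty ! h)) \<and> (u < ?p \<longrightarrow> a < ?p)) \<and>
      (\<forall>y. real_of_rat u \<le> y \<and> y \<le> real_of_rat ?p \<longrightarrow> (\<exists>(h, a, b) \<in> set ws. real_of_rat a \<le> y \<and> y \<le> real_of_rat b))"
      by (rule step.IH) (use step.prems step.hyps(3) lt x' in \<open>simp_all add: of_nat_diff\<close>)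
    have cover: "\<exists>(h, a, b) \<in> set ((h, ?p, p) # ws). real_of_rat a \<le> y \<and> y \<le> real_of_rat b"
      if "real_of_rat u \<le> y \<and> y \<le> real_of_rat p" for y
    proof (cases "y \<le> real_of_rat ?p")
      case True
      then show ?thesis using IH that by (meson list.set_intros(2))
    next
      case False
      then show ?thesis using that by (intro bexI[of _ "(h, ?p, p)"]) auto
    qed
    have "\<forall>w \<in> set ws. before (h, ?p, p) w"
    proof
      fix w assume "w \<in> set ws"
      then show "before (h, ?p, p) w" using IH lt by (cases w) (auto simp: before_def)
    qed
    then have "sorted_wrt before ((h, ?p, p) # ws)" using IH by simp
    moreover have "plan_cost ty ((h, ?p, p) # ws) = fleet_cost ty x" using IH step.hyps(2) by (simp add: plan_cost_def)
    moreover have "\<forall>(h, a, b) \<in> set ((h, ?p, p) # ws). h < length ty \<and> u \<le> a \<and> a \<le> b \<and> b \<le> p \<and> b - a \<le> of_nat (fst (ty ! h)) \<and> (u < p \<longrightarrow> a < p)"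
    proof
      fix w assume "w \<in> set ((h, ?p, p) # ws)"
      then consider "w = (h, ?p, p)" | "w \<in> set ws" by auto
      then show "case w of (h, a, b) \<Rightarrow> h < length ty \<and> u \<le> a \<and> a \<le> b \<and> b \<le> p \<and> b - a \<le> of_nat (fst (ty ! h)) \<and> (u < p \<longrightarrow> a < p)"
      proof cases
        case 1
        then show ?thesis using lt p step.hyps(1) by simp
      next
        case 2
        obtain h' a b where w: "w = (h', a, b)" by (cases w)
        then have "h' < length ty \<and> u \<le> a \<and> a \<le> b \<and> b \<le> ?p \<and> b - a \<le> of_nat (fst (ty ! h')) \<and> (u < ?p \<longrightarrow> a < ?p)"
          using IH 2 by blast
        then show ?thesis using w p lt by auto
      qed
    qed
    ultimately show ?case using cover by blast
  qed
  then show "sorted_wrt before ws" "plan_cost ty ws = fleet_cost ty x"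
    "\<forall>(h, a, b) \<in> set ws. h < length ty \<and> u \<le> a \<and> a \<le> b \<and> b \<le> p \<and> b - a \<le> of_nat (fst (ty ! h)) \<and> (u < p \<longrightarrow> a < p)"
    "\<forall>y. real_of_rat u \<le> y \<and> y \<le> real_of_rat p \<longrightarrow> (\<exists>(h, a, b) \<in> set ws. real_of_rat a \<le> y \<and> y \<le> real_of_rat b)"
    by blast+
qed

definition region_plan :: "(nat \<times> nat) list \<Rightarrow> (rat \<times> rat) list \<Rightarrow> nat \<Rightarrow> nat \<Rightarrow> (nat \<times> rat \<times> rat) list \<Rightarrow> bool" where
  "region_plan ty xs i j ws \<longleftrightarrow> sorted_wrt before ws \<and>
    (\<forall>(h, a, b) \<in> set ws. h < length ty \<and> pos xs i \<le> a \<and> a \<le> b \<and> b \<le> epos xs (i + j - 1) \<and>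
       b - a \<le> of_nat (fst (ty ! h)) \<and> a < pos xs i + perim_len xs) \<and>
    (\<forall>k \<in> {i..<i + j}. \<forall>y. real_of_rat (pos xs k) \<le> y \<and> y \<le> real_of_rat (epos xs k) \<longrightarrow>
       (\<exists>(h, a, b) \<in> set ws. real_of_rat a \<le> y \<and> y \<le> real_of_rat b))"

text \<open>Two stretches are separated by a gap of positive length, so the strict order of left ends carries
  over from single stretches to the whole tour. Every left end stays strictly below the position one
  full turn after the start; this is what keeps the first and the last robot apart.\<close>

lemma tiles_props:
  assumes "tiles ty xs i j ws" "valid_types ty" "valid_perim xs" "j \<le> length xs"
  shows "plan_cost ty ws = part_cost ty xs i j \<and> region_plan ty xs i j ws"
  using assms
proof (induction j ws rule: tiles.induct)
  case Nil
  then show ?case by (simp add: plan_cost_def part_cost_0 region_plan_def)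
next
  case (Block k j bs ws)
  let ?u = "pos xs (i + k)" and ?p = "epos xs (i + j - 1)"
  note vp = \<open>valid_perim xs\<close>
  have IH: "plan_cost ty ws = part_cost ty xs i k" "region_plan ty xs i k ws"
    using Block by auto
  have up: "?u \<le> ?p"
  proof -
    have "i + k \<le> i + j - 1" using Block.hyps(1) by simp
    then show ?thesis by (meson order_trans pos_mono[OF vp] pos_le_epos[OF vp])
  qed
  have pL: "?p \<le> pos xs i + perim_len xs"
  proof -
    have "?p \<le> pos xs (Suc (i + j - 1))" by (rule epos_le_pos[OF vp])
    also have "\<dots> \<le> pos xs (i + length xs)"
      using Block.hyps(1) Block.prems(3) by (intro pos_mono[OF vp]) simp
    finally show ?thesis by (simp add: pos_shift)
  qed
  have uL: "?u < pos xs i + perim_len xs"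
  proof -
    have "?u < pos xs (Suc (i + k))" by (rule pos_less_pos[OF vp])
    also have "\<dots> \<le> pos xs (i + length xs)"
      using Block.hyps(1) Block.prems(3) by (intro pos_mono[OF vp]) simp
    finally show ?thesis by (simp add: pos_shift)
  qed
  have bs: "sorted_wrt before bs" "plan_cost ty bs = fleet_cost ty (block_need xs i k j)"
    "\<And>h a b. (h, a, b) \<in> set bs \<Longrightarrow> h < length ty \<and> ?u \<le> a \<and> a \<le> b \<and> b \<le> ?p \<and> b - a \<le> of_nat (fst (ty ! h)) \<and> (?u < ?p \<longrightarrow> a < ?p)"
    "\<And>y. real_of_rat ?u \<le> y \<and> y \<le> real_of_rat ?p \<Longrightarrow> (\<exists>(h, a, b) \<in> set bs. real_of_rat a \<le> y \<and> y \<le> real_of_rat b)"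
    using fills_props[OF Block.hyps(3) Block.prems(1) up] le_need need_minimal
    unfolding block_need_def by blast+
  have ws: "sorted_wrt before ws"
    "\<And>h a b. (h, a, b) \<in> set ws \<Longrightarrow> h < length ty \<and> pos xs i \<le> a \<and> a \<le> b \<and> b \<le> epos xs (i + k - 1) \<and>
       b - a \<le> of_nat (fst (ty ! h)) \<and> a < pos xs i + perim_len xs"
    "\<And>l y. l \<in> {i..<i + k} \<Longrightarrow> real_of_rat (pos xs l) \<le> y \<and> y \<le> real_of_rat (epos xs l) \<Longrightarrow>
       (\<exists>(h, a, b) \<in> set ws. real_of_rat a \<le> y \<and> y \<le> real_of_rat b)"
    using IH(2) unfolding region_plan_def by blast+
  have ws_lt: "b < ?u" if "(h, a, b) \<in> set ws" for h a b
  proof -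
    have "k \<noteq> 0"
    proof
      assume "k = 0"
      with Block.hyps(4) have "ws = []" by (cases rule: tiles.cases) auto
      then show False using that by simp
    qed
    then have "length xs \<noteq> 1" using Block.hyps(1) Block.prems(3) by simp
    have "b \<le> epos xs (i + k - 1)" using ws(2)[OF that] by blast
    also have "\<dots> < pos xs (Suc (i + k - 1))" by (rule epos_less_pos[OF vp]) fact
    finally show ?thesis using \<open>k \<noteq> 0\<close> by simp
  qed
  have "before w w'" if "w \<in> set bs" "w' \<in> set ws" for w w'
  proof -
    obtain h a b h' a' b' where w: "w = (h, a, b)" "w' = (h', a', b')" by (cases w, cases w')
    then show ?thesis using bs(3)[of h a b] ws(2)[of h' a' b'] ws_lt[of h' a' b'] that
      by (auto simp: before_def)
  qed
  then have sorted: "sorted_wrt before (bs @ ws)" using bs(1) ws(1) by (simp add: sorted_wrt_append)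
  have bounds: "\<forall>(h, a, b) \<in> set (bs @ ws). h < length ty \<and> pos xs i \<le> a \<and> a \<le> b \<and> b \<le> ?p \<and>
       b - a \<le> of_nat (fst (ty ! h)) \<and> a < pos xs i + perim_len xs"
  proof
    fix w assume w: "w \<in> set (bs @ ws)"
    obtain h a b where wab: "w = (h, a, b)" by (cases w)
    from w consider "w \<in> set bs" | "w \<in> set ws" by auto
    then have "h < length ty \<and> pos xs i \<le> a \<and> a \<le> b \<and> b \<le> ?p \<and>
       b - a \<le> of_nat (fst (ty ! h)) \<and> a < pos xs i + perim_len xs"
    proof cases
      case 1
      have "pos xs i \<le> ?u" by (rule pos_mono[OF vp]) simp
      moreover have "a < pos xs i + perim_len xs" using bs(3)[of h a b] 1 wab up pL uL
        by (cases "?u < ?p") auto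
      ultimately show ?thesis using bs(3)[of h a b] 1 wab by auto
    next
      case 2
      then show ?thesis using ws(2)[of h a b] wab ws_lt[of h a b] up by auto
    qed
    then show "case w of (h, a, b) \<Rightarrow> h < length ty \<and> pos xs i \<le> a \<and> a \<le> b \<and> b \<le> ?p \<and>
       b - a \<le> of_nat (fst (ty ! h)) \<and> a < pos xs i + perim_len xs" using wab by simp
  qed
  have cover: "\<exists>(h, a, b) \<in> set (bs @ ws). real_of_rat a \<le> y \<and> y \<le> real_of_rat b"
    if l: "l \<in> {i..<i + j}" and y: "real_of_rat (pos xs l) \<le> y \<and> y \<le> real_of_rat (epos xs l)" for l y
  proof (cases "l < i + k")
    case True
    then show ?thesis using ws(3)[of l y] l y by auto
  next
    case False
    have "?u \<le> pos xs l" using False by (intro pos_mono[OF vp]) simp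
    moreover have "epos xs l \<le> ?p"
    proof (cases "l = i + j - 1")
      case False
      have "epos xs l \<le> pos xs (Suc l)" by (rule epos_le_pos[OF vp])
      also have "\<dots> \<le> pos xs (i + j - 1)" using False l by (intro pos_mono[OF vp]) auto
      also have "\<dots> \<le> ?p" by (rule pos_le_epos[OF vp])
      finally show ?thesis .
    qed simp
    ultimately have "real_of_rat ?u \<le> real_of_rat (pos xs l)" "real_of_rat (epos xs l) \<le> real_of_rat ?p"
      by (simp_all only: of_rat_less_eq)
    then have "\<exists>(h, a, b) \<in> set bs. real_of_rat a \<le> y \<and> y \<le> real_of_rat b"
      using y by (intro bs(4)) linarith
    then show ?thesis by auto
  qed
  have "plan_cost ty (bs @ ws) = part_cost ty xs i j"
    using IH(1) bs(2) Block.hyps(2) by (simp add: plan_cost_def)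
  then show ?case unfolding region_plan_def using sorted bounds cover by blast
qed

section \<open>Arcs of a closed curve\<close>

text \<open>The boundary of a region. Lengths of arcs are measured in the parameter, which for a
  parametrisation by arc length is their length.\<close>

locale closed_curve =
  fixes \<gamma> :: "real \<Rightarrow> 'a :: t2_space" and L :: real
  assumes L_pos: "L > 0"
    and cont: "continuous_on UNIV \<gamma>"
    and periodic: "\<gamma> (s + L) = \<gamma> s"
    and inj: "inj_on \<gamma> {0..<L}"
begin

definition hits :: "'a set \<Rightarrow> real \<Rightarrow> real \<Rightarrow> real set" where
  "hits C u v = {s \<in> {u..<v}. \<gamma> s \<in> C}"

lemma mem_hits: "s \<in> hits C u v \<longleftrightarrow> u \<le> s \<and> s < v \<and> \<gamma> s \<in> C"
  by (simp add: hits_def)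

definition len :: "'a set \<Rightarrow> real" where
  "len C = measure lborel (hits C 0 L)"

lemma periodic_nat: "\<gamma> (s + of_nat k * L) = \<gamma> s"
proof (induction k)
  case (Suc k)
  then show ?case using periodic[of "s + of_nat k * L"] by (simp add: algebra_simps)
qed simp

lemma periodic_int: "\<gamma> (s + of_int k * L) = \<gamma> s"
proof (cases "k \<ge> 0")
  case True
  then show ?thesis using periodic_nat[of s "nat k"] by simp
next
  case False
  then show ?thesis using periodic_nat[of "s + of_int k * L" "nat (- k)"] by (simp add: algebra_simps)
qed

lemma shift_into_period:
  obtains k :: int where "0 \<le> s + of_int k * L" "s + of_int k * L < L"
proof -
  let ?k = "- \<lfloor>s / L\<rfloor>"
  have "0 \<le> s + of_int ?k * L" "s + of_int ?k * L < L"
    using floor_divide_lower[OF L_pos, of s] floor_divide_upper[OF L_pos, of s]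
    by (simp_all add: algebra_simps)
  then show ?thesis using that by blast
qed

lemma eq_iff: "\<gamma> s = \<gamma> t \<longleftrightarrow> (\<exists>k :: int. s = t + of_int k * L)"
proof
  assume eq: "\<gamma> s = \<gamma> t"
  obtain k where k: "0 \<le> s + of_int k * L" "s + of_int k * L < L" using shift_into_period .
  obtain l where l: "0 \<le> t + of_int l * L" "t + of_int l * L < L" using shift_into_period .
  have "s + of_int k * L = t + of_int l * L"
    using inj_onD[OF inj] eq k l periodic_int by auto
  then have "s = t + of_int (l - k) * L" by (simp add: algebra_simps)
  then show "\<exists>k :: int. s = t + of_int k * L" by blast
qed (use periodic_int in auto)

lemma eq_within_period:
  assumes "\<gamma> s = \<gamma> t" "t \<le> s" "s \<le> t + L"
  shows "s = t \<or> s = t + L"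
proof -
  obtain k :: int where k: "s = t + of_int k * L" using assms(1) eq_iff by auto
  then have "0 \<le> of_int k * L" "of_int k * L \<le> 1 * L" using assms by auto
  then have "0 \<le> k" "k \<le> 1" using L_pos
    by (simp_all add: zero_le_mult_iff mult_le_cancel_right)
  then have "k = 0 \<or> k = 1" by auto
  then show ?thesis using k by auto
qed

lemma image_period: "\<gamma> ` {p..<p + L} = range \<gamma>"
proof -
  have "\<gamma> s \<in> \<gamma> ` {p..<p + L}" for s
  proof -
    obtain k where "0 \<le> (s - p) + of_int k * L" "(s - p) + of_int k * L < L"
      using shift_into_period .
    then have "s + of_int k * L \<in> {p..<p + L}" by auto
    then show ?thesis using periodic_int by (metis image_eqI)
  qed
  then show ?thesis by auto
qed

lemma image_period_closed: "\<gamma> ` {p..p + L} = range \<gamma>"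
proof -
  have "\<gamma> ` {p..<p + L} \<subseteq> \<gamma> ` {p..p + L}" by (intro image_mono) auto
  then show ?thesis using image_period[of p] by auto
qed

lemma compact_arc: "compact (\<gamma> ` {a..b})"
  by (rule compact_continuous_image[OF continuous_on_subset[OF cont]]) auto

lemma connected_arc: "connected (\<gamma> ` {a..b})"
  by (rule connected_continuous_image[OF continuous_on_subset[OF cont]]) auto

lemma hits_fmeasurable:
  assumes "closed C"
  shows "hits C u v \<in> fmeasurable lborel"
proof (rule fmeasurableI2[of "{u..v}"])
  show "{u..v} \<in> fmeasurable lborel" using fmeasurable_cbox[of u v] by simp
  show "hits C u v \<subseteq> {u..v}" by (auto simp: mem_hits)
  have "\<gamma> -` C \<inter> {u..<v} \<in> sets borel"
    using borel_closed[OF closed_vimage[OF assms(1)], of \<gamma>] cont by auto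
  moreover have "hits C u v = \<gamma> -` C \<inter> {u..<v}" by (auto simp: hits_def)
  ultimately show "hits C u v \<in> sets lborel" by simp
qed

lemma hits_sets: "closed C \<Longrightarrow> hits C u v \<in> sets borel"
  using fmeasurableD[OF hits_fmeasurable] by simp

lemma closed_arc: "closed (\<gamma> ` {a..b})"
  by (rule compact_imp_closed[OF compact_arc])

text \<open>Why an unguarded point cuts the boundary: \<open>p\<close> and \<open>a\<close> divide the curve into two closed arcs that
  share only these two points, so a connected set avoiding both lies in one of the arcs.\<close>

lemma split_connected:
  assumes C: "connected C" "C \<subseteq> range \<gamma>" and "\<gamma> p \<notin> C" "\<gamma> a \<notin> C" "p \<le> a" "a \<le> p + L"
  shows "C \<subseteq> \<gamma> ` {p..a} \<or> C \<inter> \<gamma> ` {p..a} = {}"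
proof -
  let ?A = "\<gamma> ` {p..a}" and ?B = "\<gamma> ` {a..p + L}"
  have "{p..p + L} = {p..a} \<union> {a..p + L}" using assms by auto
  then have cov: "C \<subseteq> ?A \<union> ?B"
    using C(2) image_period_closed[of p] by (metis image_Un)
  have "?A \<inter> ?B \<subseteq> {\<gamma> p, \<gamma> a}"
  proof
    fix z assume "z \<in> ?A \<inter> ?B"
    then obtain s t where st: "z = \<gamma> s" "z = \<gamma> t" "s \<in> {p..a}" "t \<in> {a..p + L}" by blast
    then have "t = s \<or> t = s + L" by (intro eq_within_period) auto
    then show "z \<in> {\<gamma> p, \<gamma> a}"
    proof
      assume "t = s"
      then have "s = a" using st by auto
      then show ?thesis using st by simp
    next
      assume "t = s + L"
      then have "s = p" using st by auto
      then show ?thesis using st by simp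
    qed
  qed
  then have "?A \<inter> ?B \<inter> C = {}" using assms(3,4) by auto
  moreover have "closed ?A" "closed ?B" using compact_arc compact_imp_closed by auto
  ultimately have "?A \<inter> C = {} \<or> ?B \<inter> C = {}"
    using connected_closedD[OF C(1)] cov by blast
  then show ?thesis using cov by auto
qed

lemma len_le_period: assumes "closed C" shows "len C \<le> L"
proof -
  have "len C \<le> measure lborel {0..L}"
    unfolding len_def using hits_sets[OF assms, of 0 L] fmeasurable_cbox[of 0 L]
    by (intro measure_mono_fmeasurable) (auto simp: mem_hits)
  then show ?thesis using L_pos by simp
qed

text \<open>An arc that contains the base point shows up in \<open>{0..<L}\<close> as two intervals; their lengths add up to
  that of the arc.\<close>

lemma len_arc_le:
  assumes "a \<le> b"
  shows "len (\<gamma> ` {a..b}) \<le> b - a"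
proof (cases "b - a < L")
  case False
  then show ?thesis using len_le_period[of "\<gamma> ` {a..b}"] closed_arc by force
next
  case True
  obtain k where k: "0 \<le> a + of_int k * L" "a + of_int k * L < L" using shift_into_period .
  define a' b' where "a' = a + of_int k * L" and "b' = b + of_int k * L"
  have ab: "0 \<le> a'" "a' < L" "a' \<le> b'" "b' < a' + L" "b' - a' = b - a"
    using k True assms by (auto simp: a'_def b'_def)
  have sub: "hits (\<gamma> ` {a..b}) 0 L \<subseteq> {a'..min b' L} \<union> {0..max 0 (b' - L)}"
  proof
    fix s assume "s \<in> hits (\<gamma> ` {a..b}) 0 L"
    then obtain w where s: "s \<in> {0..<L}" "\<gamma> s = \<gamma> w" "w \<in> {a..b}" by (auto simp: mem_hits)
    show "s \<in> {a'..min b' L} \<union> {0..max 0 (b' - L)}"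
    proof (cases "s \<in> {0..max 0 (b' - L)}")
      case out: False
    define w' where "w' = w + of_int k * L"
    have w': "w' \<in> {a'..b'}" "\<gamma> w' = \<gamma> s" using s periodic_int by (auto simp: w'_def a'_def b'_def)
    have "s \<in> {a'..min b' L}"
    proof (cases "s \<le> w'")
      case True
      then have "w' = s \<or> w' = s + L" using w' s ab out by (intro eq_within_period) auto
      then show ?thesis using w' s out by auto
    next
      case False
      then have "s = w' \<or> s = w' + L" using w' s ab by (intro eq_within_period) auto
      then show ?thesis using w' s ab False by auto
    qed
      then show ?thesis by simp
    qed simp
  qed
  have "len (\<gamma> ` {a..b}) \<le> measure lborel ({a'..min b' L} \<union> {0..max 0 (b' - L)})"
    unfolding len_def
    using hits_sets[OF closed_arc] fmeasurable_cbox[of a' "min b' L"] fmeasurable_cbox[of 0 "max 0 (b' - L)"]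
    by (intro measure_mono_fmeasurable[OF sub]) (auto intro: fmeasurable.Un)
  also have "\<dots> \<le> measure lborel {a'..min b' L} + measure lborel {0..max 0 (b' - L)}"
    by (rule measure_Un_le) auto
  also have "\<dots> = b - a" using ab by auto
  finally show ?thesis .
qed

text \<open>The measure of a set of parameters does not depend on the period in which it is taken; the
  inequality is all that subadditivity requires.\<close>

lemma len_window:
  assumes C: "closed C" and "u \<le> v" "v \<le> u + L"
  shows "measure lborel (hits C u v) \<le> len C"
proof -
  obtain k where k: "0 \<le> u + of_int k * L" "u + of_int k * L < L" using shift_into_period .
  define c where "c = of_int k * L"
  let ?X = "hits C u v"
  let ?X1 = "hits C (u + c) (min (v + c) L)"
  let ?X2 = "hits C L (max L (v + c))"
  let ?X3 = "hits C 0 (max 0 (v + c - L))"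
  have per: "\<gamma> (s + c) = \<gamma> s" for s using periodic_int by (simp add: c_def)
  have pers: "\<gamma> (s - L) = \<gamma> s" for s using periodic[of "s - L"] by simp
  note fin = hits_fmeasurable[OF C] and sts = hits_sets[OF C]
  have "(+) c ` ?X = ?X1 \<union> ?X2"
  proof (intro equalityI subsetI)
    fix s assume "s \<in> (+) c ` ?X"
    then obtain w where "w \<in> ?X" "s = c + w" by auto
    then show "s \<in> ?X1 \<union> ?X2" using per[of w] by (auto simp: mem_hits add.commute)
  next
    fix s assume "s \<in> ?X1 \<union> ?X2"
    then have "s - c \<in> ?X" using per[of "s - c"] k c_def by (auto simp: mem_hits)
    then show "s \<in> (+) c ` ?X" by (metis add.commute diff_add_cancel image_eqI)
  qed
  moreover have "(+) (-L) ` ?X2 = ?X3"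
  proof (intro equalityI subsetI)
    fix s assume "s \<in> (+) (-L) ` ?X2"
    then show "s \<in> ?X3" using pers by (auto simp: mem_hits)
  next
    fix s assume "s \<in> ?X3"
    then have "s + L \<in> ?X2" using periodic[of s] by (auto simp: mem_hits)
    then show "s \<in> (+) (-L) ` ?X2" by (intro image_eqI[of _ _ "s + L"]) auto
  qed
  moreover have tr: "measure lborel ((+) d ` A) = measure lborel A" if "A \<in> sets borel" for d :: real and A
  proof -
    have "(\<lambda>x. x - d) -` A \<inter> space borel \<in> sets borel"
      by (rule measurable_sets[OF _ that]) simp
    moreover have "(\<lambda>x. x - d) -` A \<inter> space borel = (+) d ` A"
      by (auto intro!: image_eqI[of _ _ "_ - d"])
    ultimately show ?thesis using measure_translation[of d A] that by (simp add: measure_completion)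
  qed
  ultimately have "measure lborel ?X \<le> measure lborel ?X1 + measure lborel ?X3"
  proof -
    have "measure lborel ?X = measure lborel (?X1 \<union> ?X2)"
      using tr[OF sts, of c u v] \<open>(+) c ` ?X = ?X1 \<union> ?X2\<close> by simp
    also have "\<dots> \<le> measure lborel ?X1 + measure lborel ?X2"
      using sts by (intro measure_Un_le) auto
    also have "measure lborel ?X2 = measure lborel ?X3"
      using tr[OF sts, of "-L" L "max L (v + c)"] \<open>(+) (-L) ` ?X2 = ?X3\<close> by simp
    finally show ?thesis .
  qed
  also have "\<dots> = measure lborel (?X1 \<union> ?X3)"
  proof -
    have "?X1 \<inter> ?X3 = {}" using assms(3) by (auto simp: mem_hits)
    then show ?thesis using fin by (simp add: measure_Un3)
  qed
  also have "\<dots> \<le> len C"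
  proof -
    have "?X1 \<union> ?X3 \<subseteq> hits C 0 L" using k assms by (auto simp: mem_hits c_def)
    then show ?thesis unfolding len_def
      using fin sts by (intro measure_mono_fmeasurable) auto
  qed
  finally show ?thesis .
qed

lemma covered_length:
  assumes "finite J" "\<And>j. j \<in> J \<Longrightarrow> closed (C j)" "u \<le> v" "v \<le> u + L" "\<gamma> ` {u..v} \<subseteq> (\<Union>j\<in>J. C j)"
  shows "v - u \<le> (\<Sum>j\<in>J. len (C j))"
proof -
  let ?X = "\<lambda>j. hits (C j) u v"
  have fin: "?X j \<in> fmeasurable lborel" if "j \<in> J" for j
    by (rule hits_fmeasurable) (rule assms that)+
  have "v - u = measure lborel {u..<v}" using assms by simp
  also have "\<dots> \<le> measure lborel (\<Union>j\<in>J. ?X j)"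
  proof -
    have "{u..<v} \<subseteq> (\<Union>j\<in>J. ?X j)"
    proof
      fix s assume s: "s \<in> {u..<v}"
      then have "\<gamma> s \<in> \<gamma> ` {u..v}" by simp
      then have "\<gamma> s \<in> (\<Union>j\<in>J. C j)" using assms(5) by blast
      then show "s \<in> (\<Union>j\<in>J. ?X j)" using s by (auto simp: mem_hits)
    qed
    then show ?thesis using fin assms(1)
      by (intro measure_mono_fmeasurable fmeasurable.finite_UN) auto
  qed
  also have "\<dots> \<le> (\<Sum>j\<in>J. measure lborel (?X j))"
    using fin by (intro measure_UNION_le assms) (auto simp: fmeasurable_def)
  also have "\<dots> \<le> (\<Sum>j\<in>J. len (C j))"
    using assms by (intro sum_mono len_window) auto
  finally show ?thesis .
qed

text \<open>The complementary open arc has \<open>b\<close> and \<open>a + L\<close> as limit points.\<close>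

lemma arc_ends:
  assumes "a \<le> b" "b < a + L"
  shows "\<gamma> a \<in> closure (range \<gamma> - \<gamma> ` {a..b})" "\<gamma> b \<in> closure (range \<gamma> - \<gamma> ` {a..b})"
proof -
  let ?S = "{b<..<a + L}"
  have "\<gamma> ` ?S \<subseteq> range \<gamma> - \<gamma> ` {a..b}"
  proof -
    have "\<gamma> s \<noteq> \<gamma> t" if st: "s \<in> ?S" "t \<in> {a..b}" for s t
    proof
      assume "\<gamma> s = \<gamma> t"
      then have "s = t \<or> s = t + L" using st by (intro eq_within_period) auto
      then show False using st by auto
    qed
    then show ?thesis by (auto simp del: greaterThanLessThan_iff atLeastAtMost_iff)
  qed
  then have "\<gamma> ` closure ?S \<subseteq> closure (range \<gamma> - \<gamma> ` {a..b})"
    using image_closure_subset[OF continuous_on_subset[OF cont], of ?S "closure (range \<gamma> - \<gamma> ` {a..b})"]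
      closure_subset by blast
  moreover have "closure ?S = {b..a + L}" using assms by simp
  ultimately have "\<gamma> x \<in> closure (range \<gamma> - \<gamma> ` {a..b})" if "x \<in> {b..a + L}" for x
    using that by blast
  from this[of "a + L"] this[of b]
  show "\<gamma> a \<in> closure (range \<gamma> - \<gamma> ` {a..b})" "\<gamma> b \<in> closure (range \<gamma> - \<gamma> ` {a..b})"
    using assms periodic[of a] by auto
qed

lemma arcs_meet_at_ends:
  assumes "lo \<le> a" "a < a'" "a \<le> b" "b \<le> a'" "a' \<le> b'" "b' \<le> lo + L" "a' < lo + L"
  shows "\<gamma> ` {a..b} \<inter> \<gamma> ` {a'..b'} \<subseteq>
    closure (range \<gamma> - \<gamma> ` {a..b}) \<inter> closure (range \<gamma> - \<gamma> ` {a'..b'})"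
proof
  fix z assume "z \<in> \<gamma> ` {a..b} \<inter> \<gamma> ` {a'..b'}"
  then obtain s t where st: "z = \<gamma> s" "z = \<gamma> t" "s \<in> {a..b}" "t \<in> {a'..b'}" by blast
  have "t = s \<or> t = s + L" using st assms by (intro eq_within_period) auto
  then have "(z = \<gamma> a \<or> z = \<gamma> b) \<and> (z = \<gamma> a' \<or> z = \<gamma> b')"
  proof
    assume "t = s"
    then have "s = b" "t = a'" using st assms by auto
    then show ?thesis using st by auto
  next
    assume "t = s + L"
    then have "s = a" "t = b'" using st assms by auto
    then show ?thesis using st by auto
  qed
  then show "z \<in> closure (range \<gamma> - \<gamma> ` {a..b}) \<inter> closure (range \<gamma> - \<gamma> ` {a'..b'})"
    using arc_ends[of a b] arc_ends[of a' b'] assms by auto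
qed

text \<open>The lower bound. If some gap contains an unguarded point \<open>p\<close>, the segment after it is taken as the
  first one, and induction over the further unguarded gaps shows that the robots working between \<open>p\<close> and
  an unguarded point \<open>c\<close> cost at least the optimum for the segments between \<open>p\<close> and \<open>c\<close>. Otherwise the
  whole curve is guarded, hence in particular the stretch from segment \<open>1\<close> to segment \<open>q\<close>.\<close>

lemma opt_cost_le_cover:
  fixes f :: "'j \<Rightarrow> nat \<times> nat"
  assumes xs: "valid_perim xs" "L = real_of_rat (perim_len xs)" and ty: "valid_types ty"
    and J: "finite J" "J \<noteq> {}"
    and C: "\<And>j. j \<in> J \<Longrightarrow> closed (C j)" "\<And>j. j \<in> J \<Longrightarrow> connected (C j)"
      "\<And>j. j \<in> J \<Longrightarrow> C j \<subseteq> range \<gamma>"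
    and f: "\<And>j. j \<in> J \<Longrightarrow> f j \<in> set ty" "\<And>j. j \<in> J \<Longrightarrow> len (C j) \<le> real (fst (f j))"
    and cover: "\<And>k. \<gamma> ` {real_of_rat (pos xs k)..real_of_rat (epos xs k)} \<subseteq> (\<Union>j\<in>J. C j)"
  shows "opt_cost ty xs \<le> (\<Sum>j\<in>J. snd (f j))"
proof -
  define U where "U = (\<Union>j\<in>J. C j)"
  define S where "S = (\<lambda>k. real_of_rat (pos xs k))"
  define E where "E = (\<lambda>k. real_of_rat (epos xs k))"
  define q where "q = length xs"
  have q: "q > 0" using valid_perimD(1)[OF xs(1)] by (simp add: q_def)
  have SE: "S k \<le> E k" "E k \<le> S (Suc k)" for k
    using pos_le_epos[OF xs(1)] epos_le_pos[OF xs(1)] by (simp_all add: S_def E_def of_rat_less_eq)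
  have S_mono: "S k \<le> S l" if "k \<le> l" for k l
    using pos_mono[OF xs(1) that] by (simp add: S_def of_rat_less_eq)
  have shift: "S (k + q) = S k + L" "E (k + q) = E k + L" for k
    by (simp_all add: S_def E_def q_def pos_shift epos_shift of_rat_add xs(2))
  \<comment> \<open>an unguarded point in the gap after segment \<open>n\<close>\<close>
  define cut where "cut = (\<lambda>n c. E n < c \<and> c < S (Suc n) \<and> \<gamma> c \<notin> U)"
  have cut_shift: "cut (n + q) (c + L)" if "cut n c" for n c
    using that shift[of n] shift[of "Suc n"] periodic[of c] by (simp add: cut_def)
  have covered: "\<gamma> ` {S m..E n} \<subseteq> U" if "m \<le> n" "\<And>k c. m \<le> k \<Longrightarrow> k < n \<Longrightarrow> \<not> cut k c" for m n
    using that
  proof (induction n rule: dec_induct)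
    case base
    then show ?case using cover by (simp add: S_def E_def U_def)
  next
    case (step n)
    have IH: "\<gamma> ` {S m..E n} \<subseteq> U" using step by simp
    have "\<gamma> s \<in> U" if s: "s \<in> {S m..E (Suc n)}" for s
    proof -
      consider "s \<in> {S m..E n}" | "E n < s" "s < S (Suc n)" | "s \<in> {S (Suc n)..E (Suc n)}"
        using s by (cases "s \<le> E n"; cases "s < S (Suc n)") auto
      then show ?thesis
      proof cases
        case 1
        then show ?thesis using IH by blast
      next
        case 2
        then show ?thesis using step.prems[of n s] step.hyps by (auto simp: cut_def)
      next
        case 3
        then show ?thesis using cover[of "Suc n"] unfolding S_def E_def U_def by blast
      qed
    qed
    then show ?case by blast
  qed
  have block: "fleet_cost ty (block_need xs i k j) \<le> (\<Sum>j\<in>J'. snd (f j))"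
    if "J' \<subseteq> J" "k < j" "S (i + k) \<le> E (i + j - 1)" "E (i + j - 1) \<le> S (i + k) + L"
      "\<gamma> ` {S (i + k)..E (i + j - 1)} \<subseteq> (\<Union>j\<in>J'. C j)" for J' i k j
    unfolding block_need_def
  proof (rule fleet_cost_need_le[OF _ _ ty])
    show "finite J'" using that(1) J(1) finite_subset by blast
    show "J' \<noteq> {}" using that(3,5) by auto
    show "f j \<in> set ty" if "j \<in> J'" for j using f(1) that \<open>J' \<subseteq> J\<close> by blast
    have "E (i + j - 1) - S (i + k) \<le> (\<Sum>j\<in>J'. len (C j))"
      using that(1) C(1) by (intro covered_length that \<open>finite J'\<close>) auto
    also have "\<dots> \<le> (\<Sum>j\<in>J'. real (fst (f j)))" using that(1) f(2) by (intro sum_mono) auto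
    also have "\<dots> = real_of_rat (of_nat (\<Sum>j\<in>J'. fst (f j)))"
      unfolding of_rat_of_nat_eq by simp
    finally show "epos xs (i + j - 1) - pos xs (i + k) \<le> of_nat (\<Sum>j\<in>J'. fst (f j))"
      unfolding S_def E_def of_rat_diff[symmetric] of_rat_less_eq .
  qed
  have opt_le: "opt_cost ty xs \<le> part_cost ty xs i q" if "1 \<le> i" "i \<le> q" for i
    unfolding opt_cost_def q_def using that by (intro Min_le) (auto simp: q_def)
  show ?thesis
  proof (cases "\<exists>n < q. \<exists>c. cut n c")
    case False
    have "\<gamma> ` {S 1..E q} \<subseteq> U" using q False by (intro covered) auto
    moreover have "S 1 \<le> E q" using S_mono[of 1 q] SE(1)[of q] q by simp
    moreover have "E q \<le> S 1 + L" using shift(2)[of 0] SE(2)[of 0] by simp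
    ultimately have "fleet_cost ty (block_need xs 1 0 q) \<le> (\<Sum>j\<in>J. snd (f j))"
      using q by (intro block) (auto simp: U_def)
    then show ?thesis using part_cost_le[of 0 q ty xs 1] part_cost_0[of ty xs 1] opt_le[of 1] q by simp
  next
    case True
    then obtain n p where n: "n < q" and p: "cut n p" by blast
    define inside where "inside = (\<lambda>c. {j \<in> J. C j \<subseteq> \<gamma> ` {p..c}})"
    have claim: "part_cost ty xs (Suc n) j \<le> (\<Sum>j\<in>inside c. snd (f j))"
      if "cut (n + j) c" "c \<le> p + L" for j c
      using that
    proof (induction j arbitrary: c rule: less_induct)
      case (less j)
      show ?case
      proof (cases "j = 0")
        case True
        then show ?thesis by (simp add: part_cost_0)
      next
        case False
        let ?K = "{k. k < j \<and> (\<exists>c. cut (n + k) c)}"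
        have K: "finite ?K" "0 \<in> ?K" using False p by auto
        \<comment> \<open>the last unguarded gap before \<open>j\<close>; what lies between is a single stretch\<close>
        define k where "k = Max ?K"
        have "k \<in> ?K" using Max_in[of ?K] K unfolding k_def by blast
        then have k: "k < j" "\<exists>c. cut (n + k) c" by auto
        have gap: "\<not> cut (n + l) c" if "k < l" "l < j" for l c
        proof
          assume "cut (n + l) c"
          then have "l \<in> ?K" using that by blast
          then have "l \<le> k" unfolding k_def by (rule Max_ge[OF K(1)])
          then show False using that by simp
        qed
        obtain c' where c': "cut (n + k) c'" "p \<le> c'"
        proof (cases "k = 0")
          case True
          then show ?thesis using p that by auto
        next
          case False
          obtain c' where "cut (n + k) c'" using k by blast
          moreover have "p < c'"
            using \<open>cut (n + k) c'\<close> p S_mono[of "Suc n" "n + k"] SE(1)[of "n + k"] False by (simp add: cut_def)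
          ultimately show ?thesis using that[of c'] by simp
        qed
        let ?u = "S (Suc n + k)" and ?v = "E (Suc n + j - 1)"
        have uv: "c' < ?u" "?u \<le> ?v" "?v < c"
          using c' less.prems S_mono[of "Suc n + k" "n + j"] SE(1)[of "n + j"] k by (auto simp: cut_def)
        have "\<gamma> ` {?u..?v} \<subseteq> U"
        proof (rule covered)
          show "\<not> cut l c" if "Suc n + k \<le> l" "l < Suc n + j - 1" for l c
            using gap[of "l - n" c] that by simp
        qed (use k in simp)
        then have inU: "\<gamma> ` {?u..?v} \<subseteq> (\<Union>j\<in>J. C j)" by (simp add: U_def)
        have sub: "inside c' \<subseteq> inside c" using uv by (fastforce simp: inside_def)
        have "\<gamma> ` {?u..?v} \<subseteq> (\<Union>j \<in> inside c - inside c'. C j)"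
        proof
          fix z assume z: "z \<in> \<gamma> ` {?u..?v}"
          then obtain s where s: "z = \<gamma> s" "?u \<le> s" "s \<le> ?v" by auto
          obtain i where i: "i \<in> J" "z \<in> C i" using inU z by blast
          have "z \<notin> \<gamma> ` {p..c'}"
          proof
            assume "z \<in> \<gamma> ` {p..c'}"
            then obtain t where t: "z = \<gamma> t" "p \<le> t" "t \<le> c'" by auto
            then have "s = t \<or> s = t + L" using s uv less.prems by (intro eq_within_period) auto
            then show False using s t uv less.prems by auto
          qed
          then have "i \<notin> inside c'" using i by (auto simp: inside_def)
          moreover have "C i \<subseteq> \<gamma> ` {p..c} \<or> C i \<inter> \<gamma> ` {p..c} = {}"
            using i p less.prems c' uv
            by (intro split_connected C) (auto simp: cut_def U_def)
          then have "i \<in> inside c" using i s c' uv by (auto simp: inside_def)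
          ultimately show "z \<in> (\<Union>j \<in> inside c - inside c'. C j)" using i by blast
        qed
        then have "fleet_cost ty (block_need xs (Suc n) k j) \<le> (\<Sum>j \<in> inside c - inside c'. snd (f j))"
          using k uv c' less.prems by (intro block) (auto simp: inside_def)
        moreover have "part_cost ty xs (Suc n) k \<le> (\<Sum>j \<in> inside c'. snd (f j))"
          using less.IH[OF k(1) c'(1)] uv less.prems by simp
        moreover have "(\<Sum>j \<in> inside c. snd (f j)) = (\<Sum>j \<in> inside c - inside c'. snd (f j)) + (\<Sum>j \<in> inside c'. snd (f j))"
          using sub J(1) by (intro sum.subset_diff) (auto simp: inside_def)
        ultimately show ?thesis using part_cost_le[OF k(1), of ty xs "Suc n"] by linarith
      qed
    qed
    have "opt_cost ty xs \<le> part_cost ty xs (Suc n) q" using n by (intro opt_le) auto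
    also have "\<dots> \<le> (\<Sum>j\<in>inside (p + L). snd (f j))"
      using claim[of q "p + L"] cut_shift[OF p] by simp
    also have "\<dots> \<le> (\<Sum>j\<in>J. snd (f j))" using J(1) by (intro sum_mono2) (auto simp: inside_def)
    finally show ?thesis .
  qed
qed

end

lemma valid_region_curve: "valid_region r \<Longrightarrow> closed_curve (bdry r) (circ r)"
  unfolding valid_region_def by unfold_locales auto

lemma valid_region_frontier:
  assumes "valid_region r"
  shows "frontier (body r) = range (bdry r)" "frontier (body r) \<subseteq> body r" "body r \<noteq> {}"
proof -
  interpret closed_curve "bdry r" "circ r" by (rule valid_region_curve[OF assms])
  show "frontier (body r) = range (bdry r)"
    using image_period[of 0] assms by (simp add: valid_region_def)
  have hom: "body r homeomorphic cball (0 :: real^2) 1" using assms by (simp add: valid_region_def)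
  then have "compact (body r)" using homeomorphic_compactness compact_cball by blast
  then show "frontier (body r) \<subseteq> body r" by (simp add: compact_imp_closed frontier_subset_closed)
  show "body r \<noteq> {}" using hom by (auto simp: homeomorphic_empty)
qed

lemma arc_len_eq: "valid_region r \<Longrightarrow> arc_len r C = closed_curve.len (bdry r) (circ r) C"
proof -
  assume "valid_region r"
  then interpret closed_curve "bdry r" "circ r" by (rule valid_region_curve)
  show ?thesis by (simp add: arc_len_def len_def hits_def)
qed

lemma seg_start_eq: "k \<le> length xs \<Longrightarrow> seg_start xs k = real_of_rat (pos xs k)"
proof (induction k)
  case (Suc k)
  then show ?case
    by (simp add: seg_start_def take_Suc_conv_app_nth pos_Suc epos_def of_rat_add case_prod_beta)
qed (simp add: seg_start_def pos_0)

lemma describes_perim: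
  assumes "describes xs r" "valid_region r" "valid_perim xs"
  shows "circ r = real_of_rat (perim_len xs)"
    "perim r = (\<Union>k. bdry r ` {real_of_rat (pos xs k)..real_of_rat (epos xs k)})"
    "card (segments r) = length xs"
proof -
  let ?A = "\<lambda>k. bdry r ` {real_of_rat (pos xs k)..real_of_rat (epos xs k)}"
  interpret closed_curve "bdry r" "circ r" by (rule valid_region_curve[OF assms(2)])
  show L: "circ r = real_of_rat (perim_len xs)"
    using assms(1) by (simp add: describes_def seg_start_eq perim_len_def)
  have bij: "bij_betw (\<lambda>k. bdry r ` {seg_start xs k .. seg_end xs k}) {..<length xs} (segments r)"
    using assms(1) by (simp add: describes_def)
  show "card (segments r) = length xs" using bij_betw_same_card[OF bij] by simp
  have "perim r = \<Union> (segments r)" by (simp add: segments_def)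
  also have "\<dots> = (\<Union>k<length xs. bdry r ` {seg_start xs k .. seg_end xs k})"
    using bij by (simp add: bij_betw_def flip: UN_extend_simps)
  also have "\<dots> = (\<Union>k<length xs. ?A k)"
    by (intro SUP_cong) (auto simp: seg_end_def seg_start_eq epos_def of_rat_add)
  also have "\<dots> = (\<Union>k. ?A k)"
  proof -
    have shift: "?A (k + length xs) = ?A k" for k
    proof -
      have "{real_of_rat (pos xs (k + length xs))..real_of_rat (epos xs (k + length xs))} =
          (\<lambda>s. s + circ r) ` {real_of_rat (pos xs k)..real_of_rat (epos xs k)}"
        by (simp add: pos_shift epos_shift of_rat_add L image_add_atLeastAtMost')
      then show ?thesis by (simp only: image_image periodic)
    qed
    have "?A (k + l * length xs) = ?A k" for k l
    proof (induction l)
      case (Suc l)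
      then show ?case using shift[of "k + l * length xs"] by (simp add: ac_simps)
    qed simp
    then have "?A k = ?A (k mod length xs)" for k by (metis mod_div_mult_eq)
    moreover have "k mod length xs < length xs" for k
      using valid_perimD(1)[OF assms(3)] by simp
    ultimately have "?A k \<subseteq> (\<Union>k<length xs. ?A k)" for k by blast
    then show ?thesis by blast
  qed
  finally show "perim r = (\<Union>k. ?A k)" .
qed

section \<open>Covers of several regions\<close>

text \<open>Robot type, region, and the positions between which the robot is deployed.\<close>

type_synonym placed = "nat \<times> nat \<times> rat \<times> rat"

definition on_region :: "nat \<Rightarrow> placed list \<Rightarrow> (nat \<times> rat \<times> rat) list" where
  "on_region r out = map (\<lambda>(h, r', a, b). (h, a, b)) (filter (\<lambda>e. fst (snd e) = r) out)"

text \<open>An optimal deployment on the first \<open>R\<close> regions, with no robot elsewhere: the state of the output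
  after \<open>R\<close> rounds of the program.\<close>

definition plan :: "(nat \<times> nat) list \<Rightarrow> (rat \<times> rat) list list \<Rightarrow> nat \<Rightarrow> placed list \<Rightarrow> bool" where
  "plan ty xss R out \<longleftrightarrow>
     (\<forall>e \<in> set out. fst (snd e) < R) \<and>
     (\<forall>r < R. plan_cost ty (on_region r out) = opt_cost ty (xss ! r) \<and>
        (\<exists>i. region_plan ty (xss ! r) i (length (xss ! r)) (on_region r out)))"

lemma plan_0: "plan ty xss 0 []"
  by (simp add: plan_def)

lemma plan_extend:
  assumes "plan ty xss R out" "plan_cost ty ws = opt_cost ty (xss ! R)"
    "region_plan ty (xss ! R) i (length (xss ! R)) ws"
  shows "plan ty xss (Suc R) (out @ map (\<lambda>(h, a, b). (h, R, a, b)) ws)"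
proof -
  let ?new = "map (\<lambda>(h, a, b). (h, R, a, b)) ws"
  have "on_region r (out @ ?new) = on_region r out" if "r < R" for r
    using that by (auto simp: on_region_def filter_empty_conv)
  moreover have "on_region R (out @ ?new) = ws"
  proof -
    have "filter (\<lambda>e. fst (snd e) = R) out = []" using assms(1) by (auto simp: plan_def filter_empty_conv)
    moreover have "filter (\<lambda>e. fst (snd e) = R) ?new = ?new" by (auto simp: filter_id_conv)
    ultimately show ?thesis by (simp add: on_region_def map_idI case_prod_beta)
  qed
  ultimately show ?thesis using assms by (fastforce simp: plan_def less_Suc_eq)
qed

lemma total_cost_eq_sum:
  assumes "length ns = length ty"
    "\<And>\<tau>. \<tau> < length ty \<Longrightarrow> card {j. j < length rs \<and> fst (rs ! j) = \<tau>} = ns ! \<tau>"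
    "\<And>j. j < length rs \<Longrightarrow> fst (rs ! j) < length ty"
  shows "total_cost ty ns = (\<Sum>j<length rs. snd (ty ! fst (rs ! j)))"
proof -
  have "total_cost ty ns = (\<Sum>\<tau><length ty. \<Sum>j \<in> {j \<in> {..<length rs}. fst (rs ! j) = \<tau>}. snd (ty ! fst (rs ! j)))"
    unfolding total_cost_def
  proof (rule sum.cong)
    fix \<tau> assume "\<tau> \<in> {..<length ty}"
    then have "ns ! \<tau> = card {j \<in> {..<length rs}. fst (rs ! j) = \<tau>}" using assms(2)[of \<tau>] by simp
    then show "ns ! \<tau> * snd (ty ! \<tau>) = (\<Sum>j \<in> {j \<in> {..<length rs}. fst (rs ! j) = \<tau>}. snd (ty ! fst (rs ! j)))"
      by simp
  qed simp
  also have "\<dots> = (\<Sum>j<length rs. snd (ty ! fst (rs ! j)))"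
    using assms(3) by (intro sum.group) auto
  finally show ?thesis .
qed

lemma plan_total:
  "\<forall>e \<in> set out. fst (snd e) < R \<Longrightarrow>
    (\<Sum>e\<leftarrow>out. snd (ty ! fst e)) = (\<Sum>r<R. plan_cost ty (on_region r out))"
proof (induction out)
  case Nil
  then show ?case by (simp add: on_region_def plan_cost_def)
next
  case (Cons e out)
  obtain h r a b where e: "e = (h, r, a, b)" by (cases e)
  have "plan_cost ty (on_region r' (e # out)) =
      (if r' = r then snd (ty ! h) else 0) + plan_cost ty (on_region r' out)" for r'
    by (auto simp: e on_region_def plan_cost_def)
  then have "(\<Sum>r<R. plan_cost ty (on_region r (e # out))) =
      (\<Sum>r'<R. if r' = r then snd (ty ! h) else 0) + (\<Sum>r<R. plan_cost ty (on_region r out))"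
    by (simp add: sum.distrib)
  then show ?case using Cons e by simp
qed

lemma sorted_wrt_filter_iff: "sorted_wrt Q (filter P xs) \<longleftrightarrow> sorted_wrt (\<lambda>x y. P x \<longrightarrow> P y \<longrightarrow> Q x y) xs"
  by (induction xs) auto

locale instance_regions =
  fixes ty :: "(nat \<times> nat) list" and xss :: "(rat \<times> rat) list list" and Rs :: "region list"
  assumes ty: "valid_types ty"
    and xss: "\<And>xs. xs \<in> set xss \<Longrightarrow> valid_perim xs"
    and desc: "list_all2 describes xss Rs"
    and regions: "\<And>r. r \<in> set Rs \<Longrightarrow> valid_region r"
    and disjoint: "\<And>i j. i < length Rs \<Longrightarrow> j < length Rs \<Longrightarrow> i \<noteq> j \<Longrightarrow> body (Rs ! i) \<inter> body (Rs ! j) = {}"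
begin

lemma len_Rs: "length Rs = length xss"
  using desc by (simp add: list_all2_lengthD)

lemma region_facts:
  assumes "r < length xss"
  shows "valid_region (Rs ! r)" "valid_perim (xss ! r)" "describes (xss ! r) (Rs ! r)"
    "closed_curve (bdry (Rs ! r)) (circ (Rs ! r))"
  using assms regions xss desc len_Rs valid_region_curve by (auto simp: list_all2_conv_all_nth)

lemma same_region:
  assumes "i < length xss" "j < length xss" "z \<in> frontier (body (Rs ! i))" "z \<in> frontier (body (Rs ! j))"
  shows "i = j"
proof (rule ccontr)
  assume "i \<noteq> j"
  then have "body (Rs ! i) \<inter> body (Rs ! j) = {}" using disjoint assms(1,2) len_Rs by simp
  moreover have "z \<in> body (Rs ! i)" "z \<in> body (Rs ! j)"
    using valid_region_frontier(2)[OF region_facts(1)] assms by blast+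
  ultimately show False by blast
qed

text \<open>The regions are disjoint and arcs are nonempty, so every robot serves exactly one region and the
  bounds for single regions add up.\<close>

lemma opt_cost_le_feasible:
  assumes feas: "feasible_cover ty Rs ns rs"
  shows "(\<Sum>r<length xss. opt_cost ty (xss ! r)) \<le> total_cost ty ns"
proof -
  let ?F = "\<lambda>r. frontier (body (Rs ! r))"
  define J where "J = (\<lambda>r. {j. j < length rs \<and> snd (rs ! j) \<subseteq> ?F r})"
  have robot: "fst (rs ! j) < length ty \<and> (\<exists>r < length xss. boundary_arc (Rs ! r) (snd (rs ! j)) \<and>
      arc_len (Rs ! r) (snd (rs ! j)) \<le> real (fst (ty ! fst (rs ! j))))" if "j < length rs" for j
  proof -
    have "rs ! j \<in> set rs" using that by simp
    then have "case rs ! j of (\<tau>, C) \<Rightarrow> \<tau> < length ty \<and>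
        (\<exists>r \<in> set Rs. boundary_arc r C \<and> arc_len r C \<le> real (fst (ty ! \<tau>)))"
      using feas by (auto simp: feasible_cover_def)
    then show ?thesis using len_Rs by (auto simp: in_set_conv_nth split: prod.splits)
  qed
  have arc: "boundary_arc (Rs ! r) (snd (rs ! j)) \<and> arc_len (Rs ! r) (snd (rs ! j)) \<le> real (fst (ty ! fst (rs ! j)))"
    if "r < length xss" "j \<in> J r" for r j
  proof -
    have j: "j < length rs" "snd (rs ! j) \<subseteq> ?F r" using that by (auto simp: J_def)
    obtain r' where r': "r' < length xss" "boundary_arc (Rs ! r') (snd (rs ! j))"
        "arc_len (Rs ! r') (snd (rs ! j)) \<le> real (fst (ty ! fst (rs ! j)))"
      using robot[OF j(1)] by blast
    then have "r' = r" using same_region[OF r'(1) that(1)] j(2) unfolding boundary_arc_def by blast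
    then show ?thesis using r' by simp
  qed
  have region: "opt_cost ty (xss ! r) \<le> (\<Sum>j\<in>J r. snd (ty ! fst (rs ! j)))" if r: "r < length xss" for r
  proof -
    note facts = region_facts[OF r]
    interpret closed_curve "bdry (Rs ! r)" "circ (Rs ! r)" by (rule facts)
    note dp = describes_perim[OF facts(3,1,2)]
    have perim: "perim (Rs ! r) \<subseteq> (\<Union>j\<in>J r. snd (rs ! j))"
    proof
      fix z assume z: "z \<in> perim (Rs ! r)"
      moreover have "Rs ! r \<in> set Rs" using r len_Rs by simp
      moreover have "(\<Union>r \<in> set Rs. perim r) \<subseteq> (\<Union>(\<tau>, C) \<in> set rs. C)"
        using feas unfolding feasible_cover_def by simp
      ultimately obtain \<tau> C where C: "(\<tau>, C) \<in> set rs" "z \<in> C" by blast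
      then obtain j where j: "j < length rs" "rs ! j = (\<tau>, C)" by (auto simp: in_set_conv_nth)
      obtain r' where r': "r' < length xss" "boundary_arc (Rs ! r') C" using robot[OF j(1)] j by auto
      have "z \<in> ?F r" using facts(1) z by (auto simp: valid_region_def)
      then have "r' = r" using same_region[OF r'(1) r, of z] r' C by (auto simp: boundary_arc_def)
      then have "j \<in> J r" using j r' by (auto simp: J_def boundary_arc_def)
      then show "z \<in> (\<Union>j\<in>J r. snd (rs ! j))" using j C by force
    qed
    have "perim (Rs ! r) \<noteq> {}" using facts(1) by (simp add: valid_region_def)
    then have ne: "J r \<noteq> {}" using perim by auto
    show ?thesis
    proof (rule opt_cost_le_cover[where C = "\<lambda>j. snd (rs ! j)"])
      show "finite (J r)" by (simp add: J_def)
      show "closed (snd (rs ! j))" "connected (snd (rs ! j))" "snd (rs ! j) \<subseteq> range (bdry (Rs ! r))"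
        if "j \<in> J r" for j
        using arc[OF r that] valid_region_frontier(1)[OF facts(1)] by (auto simp: boundary_arc_def)
      show "ty ! fst (rs ! j) \<in> set ty" if "j \<in> J r" for j using robot[of j] that by (auto simp: J_def)
      show "len (snd (rs ! j)) \<le> real (fst (ty ! fst (rs ! j)))" if "j \<in> J r" for j
        using arc[OF r that] arc_len_eq[OF facts(1)] by simp
      show "bdry (Rs ! r) ` {real_of_rat (pos (xss ! r) k)..real_of_rat (epos (xss ! r) k)}
          \<subseteq> (\<Union>j\<in>J r. snd (rs ! j))" for k
        using perim dp(2) by blast
    qed (use facts dp ty ne in auto)
  qed
  have disj: "J r \<inter> J r' = {}" if "r < length xss" "r' < length xss" "r \<noteq> r'" for r r'
  proof -
    have False if j: "j \<in> J r" "j \<in> J r'" for j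
    proof -
      obtain z where "z \<in> snd (rs ! j)" using arc[OF \<open>r < length xss\<close> j(1)] by (auto simp: boundary_arc_def)
      then show False using same_region[of r r' z] \<open>r \<noteq> r'\<close> j \<open>r < length xss\<close> \<open>r' < length xss\<close>
        by (auto simp: J_def)
    qed
    then show ?thesis by blast
  qed
  have "(\<Sum>r<length xss. opt_cost ty (xss ! r)) \<le> (\<Sum>r<length xss. \<Sum>j\<in>J r. snd (ty ! fst (rs ! j)))"
    using region by (intro sum_mono) auto
  also have "\<dots> = (\<Sum>j\<in>(\<Union>r<length xss. J r). snd (ty ! fst (rs ! j)))"
    using disj by (intro sum.UNION_disjoint[symmetric]) (auto simp: J_def)
  also have "\<dots> \<le> (\<Sum>j<length rs. snd (ty ! fst (rs ! j)))"
    by (intro sum_mono2) (auto simp: J_def)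
  also have "\<dots> = total_cost ty ns"
    using feas robot by (intro total_cost_eq_sum[symmetric]) (auto simp: feasible_cover_def)
  finally show ?thesis .
qed

definition robots :: "placed list \<Rightarrow> (nat \<times> (real^2) set) list" where
  "robots out = map (\<lambda>(h, r, a, b). (h, bdry (Rs ! r) ` {real_of_rat a..real_of_rat b})) out"

definition counts :: "placed list \<Rightarrow> nat list" where
  "counts out = map (\<lambda>\<tau>. length (filter (\<lambda>e. fst e = \<tau>) out)) [0..<length ty]"

lemma plan_optimal:
  assumes plan: "plan ty xss (length xss) out"
  shows "optimal_cover ty Rs (counts out) (robots out)"
    "total_cost ty (counts out) = (\<Sum>r<length xss. opt_cost ty (xss ! r))"
proof -
  let ?rs = "robots out" and ?ns = "counts out"
  have len: "length ?rs = length out" by (simp add: robots_def)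
  have nth: "?rs ! j = (h, bdry (Rs ! r) ` {real_of_rat a..real_of_rat b})"
    if "j < length out" "out ! j = (h, r, a, b)" for j h r a b
    using that by (simp add: robots_def)
  have fst_nth: "fst (?rs ! j) = fst (out ! j)" if "j < length out" for j
    using that by (cases "out ! j") (simp add: robots_def)
  have r_lt: "r < length xss" if "(h, r, a, b) \<in> set out" for h r a b
    using plan that by (force simp: plan_def)
  have bounds: "\<exists>i. h < length ty \<and> pos (xss ! r) i \<le> a \<and> a \<le> b \<and> b \<le> epos (xss ! r) (i + length (xss ! r) - 1) \<and>
       b - a \<le> of_nat (fst (ty ! h)) \<and> a < pos (xss ! r) i + perim_len (xss ! r)"
    if e: "(h, r, a, b) \<in> set out" for h r a b
  proof -
    obtain i where i: "region_plan ty (xss ! r) i (length (xss ! r)) (on_region r out)"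
      using plan r_lt[OF e] by (auto simp: plan_def)
    moreover have "(h, a, b) \<in> set (on_region r out)" using e by (force simp: on_region_def)
    ultimately show ?thesis unfolding region_plan_def by blast
  qed
  have count: "card {j. j < length ?rs \<and> fst (?rs ! j) = \<tau>} = ?ns ! \<tau>" if "\<tau> < length ty" for \<tau>
  proof -
    have "{j. j < length ?rs \<and> fst (?rs ! j) = \<tau>} = {j. j < length out \<and> fst (out ! j) = \<tau>}"
      using len fst_nth by auto
    then show ?thesis using that by (simp add: counts_def length_filter_conv_card)
  qed
  have type_lt: "fst (?rs ! j) < length ty" if "j < length ?rs" for j
    using bounds that len fst_nth by (cases "out ! j") (metis fst_conv nth_mem)
  have cost: "total_cost ty ?ns = (\<Sum>r<length xss. opt_cost ty (xss ! r))"
  proof -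
    have "total_cost ty ?ns = (\<Sum>j<length ?rs. snd (ty ! fst (?rs ! j)))"
      using count type_lt by (intro total_cost_eq_sum) (auto simp: counts_def)
    also have "\<dots> = (\<Sum>j<length out. snd (ty ! fst (out ! j)))" using len fst_nth by simp
    also have "\<dots> = (\<Sum>e\<leftarrow>out. snd (ty ! fst e))"
      by (simp add: sum_list_sum_nth atLeast0LessThan)
    also have "\<dots> = (\<Sum>r<length xss. plan_cost ty (on_region r out))"
      using plan by (intro plan_total) (simp add: plan_def)
    also have "\<dots> = (\<Sum>r<length xss. opt_cost ty (xss ! r))" using plan by (simp add: plan_def)
    finally show ?thesis .
  qed
  have length: "length ?rs = sum_list ?ns"
  proof -
    have "sum_list ?ns = (\<Sum>\<tau><length ty. \<Sum>j\<in>{j \<in> {..<length out}. fst (out ! j) = \<tau>}. 1)"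
      by (simp add: counts_def length_filter_conv_card sum_list_distinct_conv_sum_set atLeast0LessThan)
    also have "\<dots> = (\<Sum>j<length out. 1)"
      using type_lt len fst_nth by (intro sum.group) auto
    finally show ?thesis using len by simp
  qed
  have arcs: "\<forall>(\<tau>, C) \<in> set ?rs. \<tau> < length ty \<and>
        (\<exists>r \<in> set Rs. boundary_arc r C \<and> arc_len r C \<le> real (fst (ty ! \<tau>)))"
  proof
    fix w assume "w \<in> set ?rs"
    then obtain h r a b where e: "(h, r, a, b) \<in> set out"
        and w: "w = (h, bdry (Rs ! r) ` {real_of_rat a..real_of_rat b})"
      by (auto simp: robots_def)
    note facts = region_facts[OF r_lt[OF e]]
    interpret closed_curve "bdry (Rs ! r)" "circ (Rs ! r)" by (rule facts)
    let ?C = "bdry (Rs ! r) ` {real_of_rat a..real_of_rat b}"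
    have ab: "h < length ty" "a \<le> b" "b - a \<le> of_nat (fst (ty ! h))" using bounds[OF e] by auto
    then have "real_of_rat a \<le> real_of_rat b" "real_of_rat (b - a) \<le> real_of_rat (of_nat (fst (ty ! h)))"
      by (simp_all only: of_rat_less_eq)
    then have "len ?C \<le> real (fst (ty ! h))" "?C \<noteq> {}"
      using len_arc_le[of "real_of_rat a" "real_of_rat b"] by (auto simp: of_rat_diff)
    then have "boundary_arc (Rs ! r) ?C \<and> arc_len (Rs ! r) ?C \<le> real (fst (ty ! h))"
      unfolding boundary_arc_def arc_len_eq[OF facts(1)] valid_region_frontier(1)[OF facts(1)]
      using closed_arc connected_arc by auto
    moreover have "Rs ! r \<in> set Rs" using r_lt[OF e] len_Rs by simp
    ultimately show "case w of (\<tau>, C) \<Rightarrow> \<tau> < length ty \<and>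
        (\<exists>r \<in> set Rs. boundary_arc r C \<and> arc_len r C \<le> real (fst (ty ! \<tau>)))"
      using w ab(1) by auto
  qed
  have meet: "snd (?rs ! i) \<inter> snd (?rs ! j) \<inter> frontier (body r)
           \<subseteq> endpoints r (snd (?rs ! i)) \<inter> endpoints r (snd (?rs ! j))"
    if ij: "i < j" "j < length out" and r: "r \<in> set Rs" for i j r
  proof -
    obtain h1 r1 a1 b1 where e1: "out ! i = (h1, r1, a1, b1)" by (cases "out ! i")
    obtain h2 r2 a2 b2 where e2: "out ! j = (h2, r2, a2, b2)" by (cases "out ! j")
    have mem: "(h1, r1, a1, b1) \<in> set out" "(h2, r2, a2, b2) \<in> set out"
      using ij e1 e2 by (metis nth_mem less_trans)+
    obtain r0 where r0: "r0 < length xss" "r = Rs ! r0" using r len_Rs by (auto simp: in_set_conv_nth)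
    let ?C1 = "bdry (Rs ! r1) ` {real_of_rat a1..real_of_rat b1}"
    let ?C2 = "bdry (Rs ! r2) ` {real_of_rat a2..real_of_rat b2}"
    have nths: "snd (?rs ! i) = ?C1" "snd (?rs ! j) = ?C2" using nth e1 e2 ij by auto
    have front: "frontier (body (Rs ! r1)) = range (bdry (Rs ! r1))" "frontier (body (Rs ! r2)) = range (bdry (Rs ! r2))"
      using valid_region_frontier(1)[OF region_facts(1)] r_lt mem by blast+
    show ?thesis
    proof (cases "r1 = r0 \<and> r2 = r0")
      case False
      have "?C1 \<inter> ?C2 \<inter> frontier (body r) = {}"
      proof (rule ccontr)
        assume "?C1 \<inter> ?C2 \<inter> frontier (body r) \<noteq> {}"
        then obtain z where z: "z \<in> ?C1" "z \<in> ?C2" "z \<in> frontier (body (Rs ! r0))" using r0 by blast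
        then have "r1 = r0" "r2 = r0"
          using same_region[OF r_lt[OF mem(1)] r0(1), of z] same_region[OF r_lt[OF mem(2)] r0(1), of z] front by auto
        then show False using False by simp
      qed
      then show ?thesis using nths by simp
    next
      case True
      note facts = region_facts[OF r0(1)]
      interpret closed_curve "bdry (Rs ! r0)" "circ (Rs ! r0)" by (rule facts)
      have L: "circ (Rs ! r0) = real_of_rat (perim_len (xss ! r0))"
        using describes_perim(1)[OF facts(3,1,2)] .
      obtain k where k: "region_plan ty (xss ! r0) k (length (xss ! r0)) (on_region r0 out)"
        using plan r0(1) by (auto simp: plan_def)
      have "sorted_wrt before (on_region r0 out)" using k by (simp add: region_plan_def)
      then have "before (h1, a1, b1) (h2, a2, b2)"
        unfolding on_region_def sorted_wrt_map sorted_wrt_filter_iff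
        using sorted_wrt_nth_less[OF _ ij] e1 e2 True by fastforce
      then have bf: "a2 < a1" "b2 \<le> a1" by (auto simp: before_def)
      have "(h1, a1, b1) \<in> set (on_region r0 out)" "(h2, a2, b2) \<in> set (on_region r0 out)"
        using mem True by (force simp: on_region_def)+
      then have bd: "a1 \<le> b1" "b1 \<le> epos (xss ! r0) (k + length (xss ! r0) - 1)"
          "a1 < pos (xss ! r0) k + perim_len (xss ! r0)" "pos (xss ! r0) k \<le> a2" "a2 \<le> b2"
        using k unfolding region_plan_def by blast+
      have b1: "b1 \<le> pos (xss ! r0) k + perim_len (xss ! r0)"
      proof -
        have "b1 \<le> pos (xss ! r0) (Suc (k + length (xss ! r0) - 1))"
          using bd(2) epos_le_pos[OF facts(2)] order_trans by blast
        moreover have "length (xss ! r0) > 0" using valid_perimD(1)[OF facts(2)] by simp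
        ultimately show ?thesis by (simp add: pos_shift)
      qed
      let ?lo = "real_of_rat (pos (xss ! r0) k)"
      have reals: "?lo \<le> real_of_rat a2" "real_of_rat a2 < real_of_rat a1" "real_of_rat a2 \<le> real_of_rat b2"
         "real_of_rat b2 \<le> real_of_rat a1" "real_of_rat a1 \<le> real_of_rat b1"
        using bf bd by (simp_all only: of_rat_less_eq of_rat_less)
      have reals2: "real_of_rat b1 \<le> ?lo + circ (Rs ! r0)" "real_of_rat a1 < ?lo + circ (Rs ! r0)"
        using b1 bd(3) unfolding L of_rat_add[symmetric] by (simp_all only: of_rat_less_eq of_rat_less)
      show ?thesis
        using arcs_meet_at_ends[OF reals reals2] nths True r0 front
        unfolding endpoints_def by auto
    qed
  qed
  have perims: "(\<Union>r \<in> set Rs. perim r) \<subseteq> (\<Union>(\<tau>, C) \<in> set ?rs. C)"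
  proof
    fix z assume "z \<in> (\<Union>r \<in> set Rs. perim r)"
    then obtain r where r: "r < length xss" "z \<in> perim (Rs ! r)" using len_Rs by (auto simp: in_set_conv_nth)
    note facts = region_facts[OF r(1)]
    interpret closed_curve "bdry (Rs ! r)" "circ (Rs ! r)" by (rule facts)
    let ?xs = "xss ! r" and ?q = "length (xss ! r)"
    note dp = describes_perim[OF facts(3,1,2)]
    obtain i where i: "region_plan ty ?xs i ?q (on_region r out)"
      using plan r(1) by (auto simp: plan_def)
    obtain k y where y: "z = bdry (Rs ! r) y" "real_of_rat (pos ?xs k) \<le> y" "y \<le> real_of_rat (epos ?xs k)"
      using r(2) dp(2) by auto
    have q: "?q > 0" using valid_perimD(1)[OF facts(2)] by simp
    have shift: "pos ?xs (k + l * ?q) = pos ?xs k + of_nat l * perim_len ?xs \<and>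
        epos ?xs (k + l * ?q) = epos ?xs k + of_nat l * perim_len ?xs" for k l
    proof (induction l)
      case (Suc l)
      have "k + Suc l * ?q = (k + l * ?q) + ?q" by simp
      then show ?case using Suc by (simp only: pos_shift epos_shift) (simp add: algebra_simps)
    qed simp
    \<comment> \<open>the index congruent to \<open>k\<close> among those from \<open>i\<close> on; \<open>k + i * q\<close> keeps the subtraction from truncating\<close>
    define k0 where "k0 = i + (k + i * ?q - i) mod ?q"
    have ik: "i \<le> k + i * ?q" using q by (cases ?q) auto
    define l where "l = (k + i * ?q - i) div ?q"
    have k0: "k0 \<in> {i..<i + ?q}" "k0 + l * ?q = k + i * ?q"
      using q ik unfolding k0_def l_def by (auto simp: add.assoc)
    define y0 where "y0 = y + (real i - real l) * circ (Rs ! r)"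
    have "pos ?xs k0 = pos ?xs k + (of_nat i - of_nat l) * perim_len ?xs"
        "epos ?xs k0 = epos ?xs k + (of_nat i - of_nat l) * perim_len ?xs"
      using shift[of k0 l] shift[of k i] unfolding k0(2) by (auto simp: algebra_simps)
    then have "real_of_rat (pos ?xs k0) = real_of_rat (pos ?xs k) + (real i - real l) * circ (Rs ! r)"
        "real_of_rat (epos ?xs k0) = real_of_rat (epos ?xs k) + (real i - real l) * circ (Rs ! r)"
      using dp(1) by (simp_all add: of_rat_add of_rat_mult of_rat_diff)
    then have "real_of_rat (pos ?xs k0) \<le> y0 \<and> y0 \<le> real_of_rat (epos ?xs k0)"
      using y by (simp add: y0_def)
    then obtain h a b where w: "(h, a, b) \<in> set (on_region r out)" "real_of_rat a \<le> y0" "y0 \<le> real_of_rat b"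
      using i k0(1) unfolding region_plan_def by blast
    have "bdry (Rs ! r) y0 = z"
      using periodic_int[of y "int i - int l"] y(1) by (simp add: y0_def)
    then have "z \<in> bdry (Rs ! r) ` {real_of_rat a..real_of_rat b}" using w by auto
    moreover have "(h, r, a, b) \<in> set out" using w(1) by (auto simp: on_region_def)
    ultimately show "z \<in> (\<Union>(\<tau>, C) \<in> set ?rs. C)" by (force simp: robots_def)
  qed
  have "feasible_cover ty Rs ?ns ?rs"
    unfolding feasible_cover_def
  proof (intro conjI)
    show "\<forall>i < length ?rs. \<forall>j < length ?rs. i \<noteq> j \<longrightarrow>
        (\<forall>r \<in> set Rs. snd (?rs ! i) \<inter> snd (?rs ! j) \<inter> frontier (body r)
           \<subseteq> endpoints r (snd (?rs ! i)) \<inter> endpoints r (snd (?rs ! j)))"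
    proof (intro allI impI ballI)
      fix i j r assume "i < length ?rs" "j < length ?rs" "i \<noteq> j" "r \<in> set Rs"
      then show "snd (?rs ! i) \<inter> snd (?rs ! j) \<inter> frontier (body r)
           \<subseteq> endpoints r (snd (?rs ! i)) \<inter> endpoints r (snd (?rs ! j))"
        using meet[of i j r] meet[of j i r] len by (cases "i < j") (auto simp: Int_commute)
    qed
  qed (use length count arcs perims in \<open>auto simp: counts_def\<close>)
  then show "optimal_cover ty Rs ?ns ?rs"
    unfolding optimal_cover_def using opt_cost_le_feasible cost by auto
  show "total_cost ty ?ns = (\<Sum>r<length xss. opt_cost ty (xss ! r))" by (rule cost)
qed

end

section \<open>Filling the tables\<close>

definition types_ok :: "(nat \<times> nat) list \<Rightarrow> store \<Rightarrow> bool" where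
  "types_ok ty s \<longleftrightarrow> s ''t'' 0 = of_nat (length ty) \<and>
     (\<forall>h < length ty. s ''ell'' (int h) = of_nat (fst (ty ! h)) \<and> s ''cost'' (int h) = of_nat (snd (ty ! h)))"

lemma types_ok_frame: "types_ok ty s \<Longrightarrow> s' ''t'' = s ''t'' \<Longrightarrow> s' ''ell'' = s ''ell'' \<Longrightarrow> s' ''cost'' = s ''cost'' \<Longrightarrow> types_ok ty s'"
  by (simp add: types_ok_def)

definition fleet_com :: com where
  "fleet_com = fill_table ''x'' (V ''N'')
     (argmin_loop ''h'' 0 (V ''t'')
       (Set ''v'' (Plus (Arr ''cost'' (V ''h'')) (Arr ''G'' (Minus (V ''x'') (Arr ''ell'' (V ''h''))))))
       ''v'' ''b'' ''a'')
     ''b'' ''a'' ''G'' ''T''"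

definition last_robot :: "(nat \<times> nat) list \<Rightarrow> nat \<Rightarrow> nat \<Rightarrow> bool" where
  "last_robot ty x h \<longleftrightarrow> h < length ty \<and> fleet_cost ty x = snd (ty ! h) + fleet_cost ty (x - fst (ty ! h))"

lemma writes_fleet_com: "writes fleet_com = {''x'', ''G'', ''T'', ''h'', ''b'', ''a'', ''v''}"
  by (auto simp: fleet_com_def writes_fill_table writes_argmin_loop)

lemma reach_fleet_com:
  assumes ty: "valid_types ty" and s: "types_ok ty s" "s ''N'' 0 = of_nat N" "\<And>z. z \<le> 0 \<Longrightarrow> s ''G'' z = 0"
  shows "reach fleet_com s (N * (55 * length ty + 54) + 22)
    (\<lambda>s'. table ''G'' (fleet_cost ty) N s' \<and> choices ''T'' (last_robot ty) N s')"
proof -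
  define P where "P = (\<lambda>s :: store. types_ok ty s \<and> s ''N'' 0 = of_nat N)"
  have "reach fleet_com s (N * (55 * length ty + 54) + 22)
    (\<lambda>s'. P s' \<and> table ''G'' (fleet_cost ty) N s' \<and> choices ''T'' (last_robot ty) N s')"
    unfolding fleet_com_def
  proof (rule reach_fill_table[where T = "length ty * 55 + 12"])
    fix k s assume k: "1 \<le> k" "k \<le> N" and P: "P s" and x: "s ''x'' 0 = of_nat k"
      and G: "table ''G'' (fleet_cost ty) (k - 1) s"
    let ?c = "Set ''v'' (Plus (Arr ''cost'' (V ''h'')) (Arr ''G'' (Minus (V ''x'') (Arr ''ell'' (V ''h'')))))"
    let ?f = "\<lambda>h. snd (ty ! h) + fleet_cost ty (k - fst (ty ! h))"
    define Q where "Q = (\<lambda>s :: store. P s \<and> s ''x'' 0 = of_nat k \<and> table ''G'' (fleet_cost ty) (k - 1) s)"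
    have "reach (argmin_loop ''h'' (of_nat 0) (V ''t'') ?c ''v'' ''b'' ''a'') s (length ty * 55 + 12)
      (\<lambda>s'. Q s' \<and> True \<and> s' ''b'' 0 = of_nat (Min (?f ` {0..<length ty})) \<and>
        (\<exists>h. 0 \<le> h \<and> h < length ty \<and> s' ''a'' 0 = of_nat h \<and> ?f h = Min (?f ` {0..<length ty})))"
    proof (rule reach_argmin_loop[where T = 13])
      fix h s assume h: "h < length ty" and Q: "Q s" and sh: "s ''h'' 0 = of_nat h"
      have "0 < fst (ty ! h)" using valid_typesD[OF ty] h by simp
      then have le: "int k - int (fst (ty ! h)) \<le> int (k - 1)" using k by simp
      have eq: "rat_of_nat k - rat_of_nat l = of_int (int k - int l)" for l by simp
      have "s ''G'' (int k - int (fst (ty ! h))) = of_nat (fleet_cost ty (k - fst (ty ! h)))"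
        using Q le by (auto simp: Q_def table_def nat_minus_as_int)
      then have "run ?c s ''v'' 0 = of_nat (?f h)"
        using Q h sh by (auto simp: Q_def P_def types_ok_def eq simp del: of_int_diff of_int_of_nat_eq)
      then show "reach ?c s 13 (\<lambda>s'. s' ''v'' 0 = of_nat (?f h) \<and> True)"
        by (intro reach_loop_free) auto
    next
      show "Q s" using P x G by (simp add: Q_def)
      show "Q s'" if "Q s" "\<And>x. x \<notin> {''h'', ''a'', ''b''} \<union> writes ?c \<Longrightarrow> s' x = s x" for s s'
        using that by (auto simp: Q_def P_def types_ok_def table_def)
    qed (use ty in \<open>auto simp: Q_def P_def types_ok_def valid_types_def\<close>)
    then show "reach (argmin_loop ''h'' 0 (V ''t'') ?c ''v'' ''b'' ''a'') s (length ty * 55 + 12)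
      (\<lambda>s'. s' ''b'' 0 = of_nat (fleet_cost ty k) \<and> (\<exists>h. last_robot ty k h \<and> s' ''a'' 0 = of_nat h))"
      unfolding of_nat_0
      by (rule reach_mono) (use k fleet_cost_rec[OF ty, of k] in \<open>auto simp: last_robot_def atLeast0LessThan\<close>)
  next
    show "P s'" if "P s" "\<And>y. y \<notin> {''x'', ''G'', ''T''} \<union> writes (argmin_loop ''h'' 0 (V ''t'')
       (Set ''v'' (Plus (Arr ''cost'' (V ''h'')) (Arr ''G'' (Minus (V ''x'') (Arr ''ell'' (V ''h'')))))) ''v'' ''b'' ''a'') \<Longrightarrow> s' y = s y" for s s'
      using that by (auto simp: P_def types_ok_def writes_argmin_loop)
  qed (use s in \<open>auto simp: P_def writes_argmin_loop fleet_cost_0 algebra_simps\<close>)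
  then show ?thesis by (rule reach_mono) auto
qed

text \<open>The language has no ceiling: it is the negated floor of the negative.\<close>

definition need_com :: "aexp \<Rightarrow> com" where
  "need_com e = Seq (Set ''y'' (Minus (Const 0) (Floor (Minus (Const 0) e))))
     (If (Leq (V ''y'') (Const 0)) (Set ''y'' (Const 1)) SKIP)"

lemma run_need_com: "run (need_com e) s = s(''y'' := (s ''y'')(0 := of_nat (need (aval e s))))"
proof -
  have "need y = (if \<lceil>y\<rceil> \<le> 0 then 1 else nat \<lceil>y\<rceil>)" for y
    unfolding need_def by (rule if_split[THEN iffD2]) (intro conjI impI; linarith)
  then show ?thesis
    by (auto simp: need_com_def ceiling_def fun_eq_iff)
qed

definition part_com :: com where
  "part_com = fill_table ''j'' (V ''Q'')
     (argmin_loop ''k'' 0 (V ''j'')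
       (Seq (need_com (Minus (Arr ''E'' (Minus (Plus (V ''i'') (V ''j'')) (Const 1))) (Arr ''S'' (Plus (V ''i'') (V ''k'')))))
         (Set ''v'' (Plus (Arr ''D'' (V ''k'')) (Arr ''G'' (V ''y'')))))
       ''v'' ''b'' ''a'')
     ''b'' ''a'' ''D'' ''K''"

lemma writes_part_com: "writes part_com = {''j'', ''D'', ''K'', ''k'', ''b'', ''a'', ''v'', ''y''}"
  by (auto simp: part_com_def need_com_def writes_fill_table writes_argmin_loop)

definition positions_ok :: "(rat \<times> rat) list \<Rightarrow> store \<Rightarrow> bool" where
  "positions_ok xs s \<longleftrightarrow> s ''Q'' 0 = of_nat (length xs) \<and>
     (\<forall>k < 2 * length xs. s ''S'' (int k) = pos xs k \<and> s ''E'' (int k) = epos xs k)"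

definition last_block :: "(nat \<times> nat) list \<Rightarrow> (rat \<times> rat) list \<Rightarrow> nat \<Rightarrow> nat \<Rightarrow> nat \<Rightarrow> bool" where
  "last_block ty xs i j k \<longleftrightarrow> k < j \<and>
     part_cost ty xs i j = part_cost ty xs i k + fleet_cost ty (block_need xs i k j)"

lemma block_le_perim:
  assumes "valid_perim xs" "k < j" "j \<le> length xs"
  shows "epos xs (i + j - 1) - pos xs (i + k) \<le> perim_len xs"
proof -
  have "epos xs (i + j - 1) \<le> pos xs (Suc (i + j - 1))" by (rule epos_le_pos[OF assms(1)])
  also have "\<dots> \<le> pos xs (i + k + length xs)" using assms by (intro pos_mono) auto
  finally show ?thesis by (simp add: pos_shift)
qed

definition perim_ceil :: "(rat \<times> rat) list \<Rightarrow> nat" where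
  "perim_ceil xs = nat \<lceil>perim_len xs\<rceil>"

lemma block_need_le:
  assumes "valid_perim xs" "k < j" "j \<le> length xs"
  shows "block_need xs i k j \<le> perim_ceil xs"
  unfolding block_need_def
proof (rule need_le)
  show "0 < perim_ceil xs" using perim_len_pos[OF assms(1)] by (simp add: perim_ceil_def)
  have "perim_len xs \<le> of_nat (perim_ceil xs)" by (simp add: perim_ceil_def of_nat_ceiling)
  then show "epos xs (i + j - 1) - pos xs (i + k) \<le> of_nat (perim_ceil xs)"
    using block_le_perim[OF assms, of i] by simp
qed

lemma reach_part_com:
  assumes xs: "valid_perim xs" and i: "1 \<le> i" "i \<le> length xs"
    and s: "positions_ok xs s" "table ''G'' (fleet_cost ty) (perim_ceil xs) s" "s ''i'' 0 = of_nat i"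
      "\<And>z. z \<le> 0 \<Longrightarrow> s ''D'' z = 0"
  shows "reach part_com s (178 * length xs ^ 2)
    (\<lambda>s'. table ''D'' (part_cost ty xs i) (length xs) s' \<and> choices ''K'' (last_block ty xs i) (length xs) s')"
proof -
  let ?q = "length xs"
  have q: "?q \<ge> 1" using i by simp
  define P where "P = (\<lambda>s :: store. positions_ok xs s \<and> table ''G'' (fleet_cost ty) (perim_ceil xs) s \<and> s ''i'' 0 = of_nat i)"
  let ?e = "Minus (Arr ''E'' (Minus (Plus (V ''i'') (V ''j'')) (Const 1))) (Arr ''S'' (Plus (V ''i'') (V ''k'')))"
  let ?c = "Seq (need_com ?e) (Set ''v'' (Plus (Arr ''D'' (V ''k'')) (Arr ''G'' (V ''y''))))"
  have wc: "writes ?c = {''y'', ''v''}" by (auto simp: need_com_def)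
  have "reach part_com s (178 * ?q ^ 2)
    (\<lambda>s'. P s' \<and> table ''D'' (part_cost ty xs i) ?q s' \<and> choices ''K'' (last_block ty xs i) ?q s')"
    unfolding part_com_def
  proof (rule reach_fill_table[where T = "102 * ?q + 12"])
    fix j s assume j: "1 \<le> j" "j \<le> ?q" and P: "P s" and sj: "s ''j'' 0 = of_nat j"
      and D: "table ''D'' (part_cost ty xs i) (j - 1) s"
    let ?f = "\<lambda>k. part_cost ty xs i k + fleet_cost ty (block_need xs i k j)"
    define R where "R = (\<lambda>s :: store. P s \<and> s ''j'' 0 = of_nat j \<and> table ''D'' (part_cost ty xs i) (j - 1) s)"
    have "reach (argmin_loop ''k'' (of_nat 0) (V ''j'') ?c ''v'' ''b'' ''a'') s (102 * ?q + 12)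
      (\<lambda>s'. R s' \<and> True \<and> s' ''b'' 0 = of_nat (Min (?f ` {0..<j})) \<and>
        (\<exists>k. 0 \<le> k \<and> k < j \<and> s' ''a'' 0 = of_nat k \<and> ?f k = Min (?f ` {0..<j})))"
    proof (rule reach_argmin_loop[where T = 60])
      fix k s assume k: "k < j" and R: "R s" and sk: "s ''k'' 0 = of_nat k"
      have eq: "int i + int j - 1 = int (i + j - 1)" "int i + int k = int (i + k)" using i by simp_all
      have "s ''S'' (int l) = pos xs l" "s ''E'' (int l) = epos xs l" if "l < 2 * ?q" for l
        using R that by (auto simp: R_def P_def positions_ok_def)
      from this(2)[of "i + j - 1"] this(1)[of "i + k"]
      have "s ''E'' (int i + int j - 1) = epos xs (i + j - 1)" "s ''S'' (int i + int k) = pos xs (i + k)"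
        unfolding eq using i j k by auto
      moreover have "\<lfloor>rat_of_nat i + rat_of_nat j - 1\<rfloor> = int i + int j - 1" "\<lfloor>rat_of_nat i + rat_of_nat k\<rfloor> = int i + int k"
        by linarith+
      ultimately have "aval ?e s = epos xs (i + j - 1) - pos xs (i + k)"
        using R sk by (simp add: R_def P_def)
      then have run: "run (need_com ?e) s = s(''y'' := (s ''y'')(0 := of_nat (block_need xs i k j)))"
        by (simp only: run_need_com block_need_def)
      have "s ''D'' (int k) = of_nat (part_cost ty xs i k)" using R k by (auto simp: R_def table_def)
      moreover have "s ''G'' (int (block_need xs i k j)) = of_nat (fleet_cost ty (block_need xs i k j))"
        using R block_need_le[OF xs k j(2), of i] by (auto simp: R_def P_def table_def)
      ultimately have "run ?c s ''v'' 0 = of_nat (?f k)"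
        using sk by (simp add: run)
      moreover have "loop_free ?c" "max_time ?c \<le> 60" by (auto simp: need_com_def)
      ultimately show "reach ?c s 60 (\<lambda>s'. s' ''v'' 0 = of_nat (?f k) \<and> True)"
        by (intro reach_loop_free) auto
    next
      show "R s" using P sj D by (simp add: R_def)
      show "R s'" if "R s" "\<And>x. x \<notin> {''k'', ''a'', ''b''} \<union> writes ?c \<Longrightarrow> s' x = s x" for s s'
        using that(1) that(2)[unfolded wc] by (auto simp: R_def P_def positions_ok_def table_def)
    qed (use j in \<open>auto simp: R_def wc[simplified] need_com_def\<close>)
    then show "reach (argmin_loop ''k'' 0 (V ''j'') ?c ''v'' ''b'' ''a'') s (102 * ?q + 12)
      (\<lambda>s'. s' ''b'' 0 = of_nat (part_cost ty xs i j) \<and> (\<exists>k. last_block ty xs i j k \<and> s' ''a'' 0 = of_nat k))"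
      unfolding of_nat_0
      by (rule reach_mono) (use j part_cost_rec[of j ty xs i] in \<open>auto simp: last_block_def atLeast0LessThan\<close>)
  next
    show "P s'" if "P s" "\<And>y. y \<notin> {''j'', ''D'', ''K''} \<union> writes (argmin_loop ''k'' 0 (V ''j'') ?c ''v'' ''b'' ''a'') \<Longrightarrow> s' y = s y" for s s'
      using that(1) that(2)[unfolded writes_argmin_loop wc] by (auto simp: P_def positions_ok_def table_def)
    have "?q \<le> ?q ^ 2" "1 \<le> ?q ^ 2" using q by (auto simp: self_le_power)
    moreover have "?q * ?q = ?q ^ 2" by (simp add: power2_eq_square)
    ultimately show "?q * (102 * ?q + 12 + acost (V ''Q'') + 40) + acost (V ''Q'') + 20 \<le> 178 * ?q ^ 2"
      by (simp add: add_mult_distrib2 mult.left_commute)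
  qed (use s in \<open>auto simp: P_def positions_ok_def writes_argmin_loop need_com_def part_cost_0\<close>)
  then show ?thesis by (rule reach_mono) auto
qed

definition search_com :: com where
  "search_com = argmin_loop ''i'' 1 (Plus (V ''Q'') (Const 1))
     (Seq part_com (Set ''v'' (Arr ''D'' (V ''Q'')))) ''v'' ''B'' ''A''"

lemma writes_search_com: "writes search_com = {''i'', ''B'', ''A''} \<union> writes part_com"
  by (auto simp: search_com_def writes_argmin_loop writes_part_com)

lemma reach_search_com:
  assumes xs: "valid_perim xs"
    and s: "positions_ok xs s" "table ''G'' (fleet_cost ty) (perim_ceil xs) s" "\<And>z. z \<le> 0 \<Longrightarrow> s ''D'' z = 0"
  shows "reach search_com s (241 * length xs ^ 3)
    (\<lambda>s'. (\<forall>z \<le> 0. s' ''D'' z = 0) \<and>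
      (\<exists>i \<in> {1..length xs}. s' ''A'' 0 = of_nat i \<and> part_cost ty xs i (length xs) = opt_cost ty xs))"
proof -
  let ?q = "length xs"
  let ?c = "Seq part_com (Set ''v'' (Arr ''D'' (V ''Q'')))"
  let ?f = "\<lambda>i. part_cost ty xs i ?q"
  have q: "?q \<ge> 1" using valid_perimD(1)[OF xs] by (cases xs) auto
  define P where "P = (\<lambda>s :: store. positions_ok xs s \<and> table ''G'' (fleet_cost ty) (perim_ceil xs) s)"
  have "reach (argmin_loop ''i'' (of_nat 1) (Plus (V ''Q'') (Const 1)) ?c ''v'' ''B'' ''A'') s (241 * ?q ^ 3)
    (\<lambda>s'. P s' \<and> (\<forall>z \<le> 0. s' ''D'' z = 0) \<and> s' ''B'' 0 = of_nat (Min (?f ` {1..<Suc ?q})) \<and>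
        (\<exists>i. 1 \<le> i \<and> i < Suc ?q \<and> s' ''A'' 0 = of_nat i \<and> ?f i = Min (?f ` {1..<Suc ?q})))"
  proof (rule reach_argmin_loop[where T = "178 * ?q ^ 2 + 5"])
    fix i s assume i: "1 \<le> i" "i < Suc ?q" and P: "P s" and si: "s ''i'' 0 = of_nat i"
      and Z: "\<forall>z \<le> 0. s ''D'' z = 0" 
    show "reach ?c s (178 * ?q ^ 2 + 5) (\<lambda>s'. s' ''v'' 0 = of_nat (?f i) \<and> (\<forall>z \<le> 0. s' ''D'' z = 0))"
    proof (rule reach_Seq[OF reach_part_com[OF xs, of i]])
      fix s' assume D: "table ''D'' (part_cost ty xs i) ?q s' \<and> choices ''K'' (last_block ty xs i) ?q s'"
        and fr: "\<And>x. x \<notin> writes part_com \<Longrightarrow> s' x = s x"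
      have "s' ''Q'' 0 = of_nat ?q" using fr[of "''Q''"] P by (simp add: writes_part_com P_def positions_ok_def)
      then show "reach (Set ''v'' (Arr ''D'' (V ''Q''))) s' 5 (\<lambda>s'. s' ''v'' 0 = of_nat (?f i) \<and> (\<forall>z \<le> 0. s' ''D'' z = 0))"
        using D by (intro reach_loop_free) (auto simp: table_def part_cost_0)
    qed (use i P si Z in \<open>auto simp: P_def\<close>)
  next
    show "P s'" if "P s" "\<And>x. x \<notin> {''i'', ''A'', ''B''} \<union> writes ?c \<Longrightarrow> s' x = s x" for s s'
      using that by (auto simp: P_def positions_ok_def table_def writes_part_com)
    have "?q \<le> ?q ^ 3" "1 \<le> ?q ^ 3" using q by (auto simp: self_le_power)
    moreover have "?q * ?q ^ 2 = ?q ^ 3" by (simp add: power2_eq_square power3_eq_cube)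
    ultimately show "(Suc ?q - 1) * (178 * ?q ^ 2 + 5 + acost (Plus (V ''Q'') (Const 1)) + 40) + acost (Plus (V ''Q'') (Const 1)) + 10 \<le> 241 * ?q ^ 3"
      by (simp add: add_mult_distrib2)
  qed (use s q in \<open>auto simp: P_def positions_ok_def writes_part_com\<close>)
  then show ?thesis unfolding search_com_def of_nat_1
    by (rule reach_mono) (auto simp: opt_cost_def atLeastLessThanSuc_atLeastAtMost)
qed

section \<open>Processing one region\<close>

text \<open>Two rounds of positions suffice: the first segment has index at most \<open>q\<close>, and a tour from there
  comprises \<open>q\<close> segments. Indices into the input are reduced by subtraction, there being no
  multiplication or division.\<close>

definition setup_com :: com where
  "setup_com =
    Seq (Set ''Q'' (Arr ''q'' (V ''r'')))
   (Seq (Set ''S'' (Const 0))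
   (Seq (Set ''k'' (Const 0))
   (Seq (While (Less (V ''k'') (Plus (V ''Q'') (V ''Q'')))
     (Seq (If (Less (V ''k'') (V ''Q''))
           (Set ''w'' (Plus (V ''o'') (V ''k'')))
           (Set ''w'' (Minus (Plus (V ''o'') (V ''k'')) (V ''Q''))))
     (Seq (Assign ''E'' (V ''k'') (Plus (Arr ''S'' (V ''k'')) (Arr ''seg'' (V ''w''))))
     (Seq (Assign ''S'' (Plus (V ''k'') (Const 1)) (Plus (Arr ''E'' (V ''k'')) (Arr ''gap'' (V ''w''))))
          (Set ''k'' (Plus (V ''k'') (Const 1)))))))
   (Set ''N'' (Minus (Const 0) (Floor (Minus (Const 0) (Arr ''S'' (V ''Q'')))))))))"

lemma writes_setup_com: "writes setup_com = {''Q'', ''S'', ''k'', ''w'', ''E'', ''N''}"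
  by (auto simp: setup_com_def)

definition listing_ok :: "(rat \<times> rat) list \<Rightarrow> nat \<Rightarrow> store \<Rightarrow> bool" where
  "listing_ok xs off s \<longleftrightarrow> s ''o'' 0 = of_nat off \<and>
     (\<forall>k < length xs. s ''seg'' (int (off + k)) = fst (xs ! k) \<and> s ''gap'' (int (off + k)) = snd (xs ! k))"

lemma reach_setup_com:
  assumes xs: "valid_perim xs" and s: "listing_ok xs off s" "s ''r'' 0 = of_nat r"
    "s ''q'' (int r) = of_nat (length xs)"
  shows "reach setup_com s (130 * length xs + 40)
    (\<lambda>s'. positions_ok xs s' \<and> s' ''N'' 0 = of_nat (perim_ceil xs))"
proof -
  let ?q = "length xs"
  have q: "?q \<ge> 1" using valid_perimD(1)[OF xs] by (cases xs) auto
  let ?b = "Less (V ''k'') (Plus (V ''Q'') (V ''Q''))"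
  let ?if = "If (Less (V ''k'') (V ''Q''))
           (Set ''w'' (Plus (V ''o'') (V ''k'')))
           (Set ''w'' (Minus (Plus (V ''o'') (V ''k'')) (V ''Q'')))"
  let ?rest = "Seq (Assign ''E'' (V ''k'') (Plus (Arr ''S'' (V ''k'')) (Arr ''seg'' (V ''w''))))
     (Seq (Assign ''S'' (Plus (V ''k'') (Const 1)) (Plus (Arr ''E'' (V ''k'')) (Arr ''gap'' (V ''w''))))
          (Set ''k'' (Plus (V ''k'') (Const 1))))"
  define I where "I = (\<lambda>k s. listing_ok xs off s \<and> s ''Q'' 0 = of_nat ?q \<and> s ''k'' 0 = of_nat k \<and>
     (\<forall>l \<le> k. s ''S'' (int l) = pos xs l) \<and> (\<forall>l < k. s ''E'' (int l) = epos xs l))"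
  have loop: "reach (While ?b (Seq ?if ?rest)) s1 (62 * (2 * ?q) + 10) (I (2 * ?q))" if "I 0 s1" for s1
  proof (rule reach_While_count[where lo = 0 and T = "\<lambda>_. 52"])
    fix k s assume k: "k < 2 * ?q" and I: "I k s"
    have facts: "s ''Q'' 0 = of_nat ?q" "s ''k'' 0 = of_nat k" "s ''o'' 0 = of_nat off"
      "s ''S'' (int k) = pos xs k" using I by (auto simp: I_def listing_ok_def)
    let ?w = "int (off + k mod ?q)"
    have w: "run ?if s = s(''w'' := (s ''w'')(0 := of_int ?w))"
    proof (cases "k < ?q")
      case False
      then have "k mod ?q = k - ?q" using k by (simp add: mod_if)
      then show ?thesis using False facts by (simp add: of_nat_diff fun_eq_iff)
    qed (use facts in \<open>simp add: fun_eq_iff\<close>)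
    have "k mod ?q < ?q" using q by (intro mod_less_divisor) linarith
    then have sg: "s ''seg'' ?w = fst (xs ! (k mod ?q))" "s ''gap'' ?w = snd (xs ! (k mod ?q))"
      using I unfolding I_def listing_ok_def by blast+
    let ?s = "run (Seq ?if ?rest) s"
    have eq: "\<lfloor>rat_of_nat k + 1\<rfloor> = int (Suc k)" by linarith
    define W where "W = ?w"
    have st: "?s ''S'' = (s ''S'')(int (Suc k) := pos xs (Suc k))" "?s ''E'' = (s ''E'')(int k := epos xs k)"
        "?s ''k'' 0 = of_nat (Suc k)"
      unfolding run.simps(3) w using facts sg eq unfolding W_def[symmetric]
      by (simp_all add: pos_Suc epos_def add.commute[of 1])
    have other: "?s x = s x" if "x \<notin> {''w'', ''E'', ''S'', ''k''}" for x
      using that by auto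
    have "I (Suc k) ?s" unfolding I_def st
    proof (intro conjI allI impI)
      show "listing_ok xs off ?s" using I other unfolding I_def listing_ok_def by (simp del: run.simps)
      show "?s ''Q'' 0 = of_nat ?q" using facts other by (simp del: run.simps)
      show "rat_of_nat (Suc k) = of_nat (Suc k)" ..
    next
      fix l assume "l \<le> Suc k"
      then show "((s ''S'')(int (Suc k) := pos xs (Suc k))) (int l) = pos xs l"
        using I by (cases "l = Suc k") (auto simp: I_def)
    next
      fix l assume "l < Suc k"
      then show "((s ''E'')(int k := epos xs k)) (int l) = epos xs l"
        using I by (cases "l = k") (auto simp: I_def)
    qed
    moreover have "bval ?b s" using facts k by (simp flip: of_nat_add)
    ultimately show "bval ?b s \<and> reach (Seq ?if ?rest) s 52 (I (Suc k))"
      by (intro conjI reach_loop_free) simp_all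
  next
    show "\<not> bval ?b s" if "I (2 * ?q) s" for s using that by (simp add: I_def)
  qed (use that in auto)
  show ?thesis unfolding setup_com_def
  proof (rule reach_Seq[where ?T1.0 = 5 and ?T2.0 = "130 * ?q + 35" and ?Q1.0 = "\<lambda>s'. s' ''Q'' 0 = of_nat ?q"])
    show "reach (Set ''Q'' (Arr ''q'' (V ''r''))) s 5 (\<lambda>s'. s' ''Q'' 0 = of_nat ?q)"
      by (intro reach_loop_free) (use s in auto)
  next
    fix s1 assume Q: "s1 ''Q'' 0 = of_nat ?q" and fr: "\<And>x. x \<notin> writes (Set ''Q'' (Arr ''q'' (V ''r''))) \<Longrightarrow> s1 x = s x"
    have l1: "listing_ok xs off s1" using fr s by (simp add: listing_ok_def)
    show "reach (Seq (Set ''S'' (Const 0)) (Seq (Set ''k'' (Const 0)) (Seq (While ?b (Seq ?if ?rest))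
       (Set ''N'' (Minus (Const 0) (Floor (Minus (Const 0) (Arr ''S'' (V ''Q''))))))))) s1 (130 * ?q + 35)
      (\<lambda>s'. positions_ok xs s' \<and> s' ''N'' 0 = of_nat (perim_ceil xs))"
    proof (rule reach_Seq[where ?T1.0 = 3 and ?T2.0 = "130 * ?q + 32" and ?Q1.0 = "\<lambda>s'. s' ''S'' 0 = 0"])
      fix s2 assume S: "s2 ''S'' 0 = 0" and fr: "\<And>x. x \<notin> writes (Set ''S'' (Const 0)) \<Longrightarrow> s2 x = s1 x"
      show "reach (Seq (Set ''k'' (Const 0)) (Seq (While ?b (Seq ?if ?rest))
       (Set ''N'' (Minus (Const 0) (Floor (Minus (Const 0) (Arr ''S'' (V ''Q'')))))))) s2 (130 * ?q + 32)
      (\<lambda>s'. positions_ok xs s' \<and> s' ''N'' 0 = of_nat (perim_ceil xs))"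
      proof (rule reach_Seq[where ?T1.0 = 3 and ?T2.0 = "130 * ?q + 29" and ?Q1.0 = "I 0"])
        have "I 0 (run (Set ''k'' (Const 0)) s2)"
          using S fr Q l1 by (simp add: I_def listing_ok_def pos_0)
        then show "reach (Set ''k'' (Const 0)) s2 3 (I 0)"
          by (rule reach_loop_free[rotated 2]) auto
      next
        fix s3 assume "I 0 s3"
        then show "reach (Seq (While ?b (Seq ?if ?rest))
            (Set ''N'' (Minus (Const 0) (Floor (Minus (Const 0) (Arr ''S'' (V ''Q''))))))) s3 (130 * ?q + 29)
          (\<lambda>s'. positions_ok xs s' \<and> s' ''N'' 0 = of_nat (perim_ceil xs))"
        proof (rule reach_Seq[OF loop])
          fix s4 assume I: "I (2 * ?q) s4"
          have SQ: "s4 ''S'' (int ?q) = perim_len xs" using I by (simp add: I_def perim_len_def)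
          have "perim_len xs > 0" by (rule perim_len_pos[OF xs])
          then have "of_int \<lceil>perim_len xs\<rceil> = rat_of_nat (perim_ceil xs)" by (simp add: perim_ceil_def)
          then have "- of_int \<lfloor>- perim_len xs\<rfloor> = rat_of_nat (perim_ceil xs)" by (simp add: ceiling_def)
          then show "reach (Set ''N'' (Minus (Const 0) (Floor (Minus (Const 0) (Arr ''S'' (V ''Q'')))))) s4 10
             (\<lambda>s'. positions_ok xs s' \<and> s' ''N'' 0 = of_nat (perim_ceil xs))"
            using I SQ by (intro reach_loop_free) (auto simp: I_def positions_ok_def)
        qed simp
      qed simp
    qed (auto intro!: reach_loop_free)
  qed simp
qed

text \<open>The output arrays hold the deployments \<open>out\<close>. Cells of \<open>num\<close> are counters that start at \<open>0\<close>.\<close>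

definition emitted :: "placed list \<Rightarrow> store \<Rightarrow> bool" where
  "emitted out s \<longleftrightarrow> s ''n'' 0 = of_nat (length out) \<and>
     (\<forall>j < length out. s ''type'' (int j) = of_nat (fst (out ! j)) \<and>
        s ''region'' (int j) = of_nat (fst (snd (out ! j))) \<and>
        s ''from'' (int j) = fst (snd (snd (out ! j))) \<and> s ''to'' (int j) = snd (snd (snd (out ! j)))) \<and>
     (\<forall>\<tau>. s ''num'' (int \<tau>) = of_nat (length (filter (\<lambda>e. fst e = \<tau>) out)))"

lemma emitted_frame:
  assumes "emitted out s" "\<And>x. x \<in> {''n'', ''type'', ''region'', ''from'', ''to'', ''num''} \<Longrightarrow> s' x = s x"
  shows "emitted out s'"
  using assms by (simp add: emitted_def)

lemma emitted_snoc:
  assumes "emitted out s" "s' ''n'' 0 = of_nat (Suc (length out))"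
    "s' ''type'' = (s ''type'')(int (length out) := of_nat h)"
    "s' ''region'' = (s ''region'')(int (length out) := of_nat r)"
    "s' ''from'' = (s ''from'')(int (length out) := a)"
    "s' ''to'' = (s ''to'')(int (length out) := b)"
    "s' ''num'' = (s ''num'')(int h := s ''num'' (int h) + 1)"
  shows "emitted (out @ [(h, r, a, b)]) s'"
  using assms by (auto simp: emitted_def nth_append less_Suc_eq)

definition robot_com :: com where
  "robot_com =
    Seq (Set ''h'' (Arr ''T'' (V ''x'')))
   (Seq (Assign ''num'' (V ''h'') (Plus (Arr ''num'' (V ''h'')) (Const 1)))
   (Seq (Assign ''type'' (V ''n'') (V ''h''))
   (Seq (Assign ''region'' (V ''n'') (V ''r''))
   (Seq (Assign ''to'' (V ''n'') (V ''p''))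
   (Seq (If (Leq (V ''x'') (Arr ''ell'' (V ''h'')))
          (Seq (Set ''p'' (V ''u'')) (Set ''x'' (Const 0)))
          (Seq (Set ''p'' (Minus (V ''p'') (Arr ''ell'' (V ''h''))))
               (Set ''x'' (Minus (V ''x'') (Arr ''ell'' (V ''h''))))))
   (Seq (Assign ''from'' (V ''n'') (V ''p''))
        (Set ''n'' (Plus (V ''n'') (Const 1)))))))))"

lemma run_robot_com:
  assumes x: "s ''x'' 0 = of_nat x" "s ''T'' (int x) = of_nat h" and e: "emitted out s"
    and r: "s ''r'' 0 = of_nat r" and ell: "s ''ell'' (int h) = of_nat l"
  defines "s' \<equiv> run robot_com s" and "a \<equiv> if x \<le> l then s ''u'' 0 else s ''p'' 0 - of_nat l"
  shows "emitted (out @ [(h, r, a, s ''p'' 0)]) s'" "s' ''p'' 0 = a" "s' ''x'' 0 = of_nat (x - l)"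
proof -
  have n: "s ''n'' 0 = of_nat (length out)" using e by (simp add: emitted_def)
  show "emitted (out @ [(h, r, a, s ''p'' 0)]) s'"
    by (rule emitted_snoc[OF e]) (use assms n in \<open>auto simp: robot_com_def\<close>)
  show "s' ''p'' 0 = a" "s' ''x'' 0 = of_nat (x - l)"
    using assms n by (auto simp: robot_com_def of_nat_diff)
qed

definition block_out_com :: com where
  "block_out_com = While (Less (Const 0) (V ''x'')) robot_com"

lemma writes_robot_com: "writes robot_com = {''h'', ''num'', ''type'', ''region'', ''to'', ''p'', ''x'', ''from'', ''n''}"
  by (auto simp: robot_com_def)

definition tag :: "nat \<Rightarrow> (nat \<times> rat \<times> rat) list \<Rightarrow> placed list" where
  "tag r = map (\<lambda>(h, a, b). (h, r, a, b))"

lemma reach_block_out_com: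
  assumes ty: "valid_types ty"
  assumes "types_ok ty s" "choices ''T'' (last_robot ty) N s" "0 < x" "x \<le> N" "s ''x'' 0 = of_nat x"
    "s ''p'' 0 = p" "s ''u'' 0 = u" "s ''r'' 0 = of_nat r" "emitted out s"
  shows "reach block_out_com s (70 * x + 6)
    (\<lambda>s'. \<exists>ws. fills ty u p x ws \<and> emitted (out @ tag r ws) s')"
  using assms(2-)
proof (induction x arbitrary: s p out rule: less_induct)
  case (less x)
  let ?b = "Less (Const 0) (V ''x'')"
  obtain h where h: "last_robot ty x h" "s ''T'' (int x) = of_nat h"
  proof -
    have "x \<in> {1..N}" using less.prems(3,4) by simp
    then show ?thesis using less.prems(2) that unfolding choices_def by blast
  qed
  let ?l = "fst (ty ! h)"
  have ht: "h < length ty" and cost: "fleet_cost ty x = snd (ty ! h) + fleet_cost ty (x - ?l)"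
    using h(1) by (auto simp: last_robot_def)
  have l: "0 < ?l" using valid_typesD[OF ty] ht by simp
  have "s ''ell'' (int h) = of_nat ?l" using less.prems(1) ht by (simp add: types_ok_def)
  note run = run_robot_com[OF less.prems(5) h(2) less.prems(9,8) this]
  let ?a = "if x \<le> ?l then u else p - of_nat ?l"
  let ?s = "run robot_com s"
  have body: "reach robot_com s 64 (\<lambda>s'. emitted (out @ [(h, r, ?a, p)]) s' \<and> s' ''p'' 0 = ?a \<and> s' ''x'' 0 = of_nat (x - ?l))"
    by (rule reach_loop_free) (use run less.prems in \<open>auto simp: robot_com_def[simplified] simp del: run.simps\<close>)
  show ?case unfolding block_out_com_def
  proof (rule reach_While_True[OF _ body])
    show "bval ?b s" using less.prems by simp
  next
    fix s' assume s': "emitted (out @ [(h, r, ?a, p)]) s' \<and> s' ''p'' 0 = ?a \<and> s' ''x'' 0 = of_nat (x - ?l)"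
      and fr: "\<And>x. x \<notin> writes robot_com \<Longrightarrow> s' x = s x"
    show "reach (While ?b robot_com) s' (70 * (x - ?l) + 6)
      (\<lambda>s'. \<exists>ws. fills ty u p x ws \<and> emitted (out @ tag r ws) s')"
    proof (cases "x \<le> ?l")
      case True
      then have "fills ty u p x [(h, u, p)]"
        using ht cost by (intro fills.last) (auto simp: fleet_cost_0)
      then show ?thesis using s' True by (intro reach_While_False) (auto simp: tag_def intro!: exI[of _ "[(h, u, p)]"])
    next
      case False
      have "reach block_out_com s' (70 * (x - ?l) + 6)
        (\<lambda>s'. \<exists>ws. fills ty u (p - of_nat ?l) (x - ?l) ws \<and> emitted ((out @ [(h, r, p - of_nat ?l, p)]) @ tag r ws) s')"
      proof (rule less.IH)
        show "types_ok ty s'" using fr by (intro types_ok_frame[OF less.prems(1)]) (auto simp: writes_robot_com)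
        show "choices ''T'' (last_robot ty) N s'" using less.prems(2) fr by (simp add: choices_def writes_robot_com)
        show "s' ''u'' 0 = u" "s' ''r'' 0 = of_nat r" using less.prems fr by (auto simp: writes_robot_com)
      qed (use False l less.prems s' in auto)
      then show ?thesis unfolding block_out_com_def
      proof (rule reach_mono)
        fix s'' assume "\<exists>ws. fills ty u (p - of_nat ?l) (x - ?l) ws \<and> emitted ((out @ [(h, r, p - of_nat ?l, p)]) @ tag r ws) s''"
        then obtain ws where ws: "fills ty u (p - of_nat ?l) (x - ?l) ws"
            "emitted ((out @ [(h, r, p - of_nat ?l, p)]) @ tag r ws) s''" by blast
        have "fills ty u p x ((h, p - of_nat ?l, p) # ws)" using ht cost False ws(1) by (intro fills.step) auto
        then show "\<exists>ws. fills ty u p x ws \<and> emitted (out @ tag r ws) s''"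
          using ws(2) by (intro exI[of _ "(h, p - of_nat ?l, p) # ws"]) (simp add: tag_def)
      qed simp
    qed
  next
    show "1 + bcost ?b + 64 + (70 * (x - ?l) + 6) \<le> 70 * x + 6" using l less.prems(3) by simp
  qed
qed

text \<open>Backtracking through the stretches; \<open>block_out_com\<close> handles each of them.\<close>

definition region_out_body :: com where
  "region_out_body =
    Seq (Set ''k'' (Arr ''K'' (V ''j'')))
   (Seq (Set ''u'' (Arr ''S'' (Plus (V ''i'') (V ''k''))))
   (Seq (Set ''p'' (Arr ''E'' (Minus (Plus (V ''i'') (V ''j'')) (Const 1))))
   (Seq (need_com (Minus (V ''p'') (V ''u'')))
        (Set ''x'' (V ''y'')))))"

definition region_out_com :: com where
  "region_out_com = While (Less (Const 0) (V ''j''))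
     (Seq region_out_body (Seq block_out_com (Set ''j'' (V ''k''))))"

lemma writes_region_out:
  "writes region_out_body = {''k'', ''u'', ''p'', ''y'', ''x''}"
  "writes block_out_com = {''h'', ''num'', ''type'', ''region'', ''to'', ''p'', ''x'', ''from'', ''n''}"
  by (auto simp: region_out_body_def need_com_def block_out_com_def writes_robot_com)

lemma block_need_le_floor:
  assumes "valid_perim xs" "k < j"
  shows "int (block_need xs i k j) \<le> \<lfloor>pos xs (i + j) - pos xs (i + k)\<rfloor> + 1"
proof -
  let ?y = "epos xs (i + j - 1) - pos xs (i + k)" and ?z = "pos xs (i + j) - pos xs (i + k)"
  have "epos xs (i + j - 1) \<le> pos xs (Suc (i + j - 1))" by (rule epos_le_pos[OF assms(1)])
  then have "?y \<le> ?z" using assms(2) by simp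
  then have "\<lceil>?y\<rceil> \<le> \<lfloor>?z\<rfloor> + 1" by linarith
  moreover have "0 \<le> \<lfloor>?z\<rfloor>" using pos_mono[OF assms(1), of "i + k" "i + j"] assms(2) by simp
  ultimately show ?thesis unfolding block_need_def need_def by linarith
qed

text \<open>Rounding up wastes less than one unit per stretch, so the number of robots is at most the number
  of stretches plus the length covered. Bounding each stretch by the perimeter instead would cost a
  factor \<open>q\<close> and exceed the time allowed for one region.\<close>

lemma reach_region_out_com:
  assumes ty: "valid_types ty" and xs: "valid_perim xs" and i: "1 \<le> i" "i \<le> length xs"
  assumes "types_ok ty s" "choices ''T'' (last_robot ty) (perim_ceil xs) s" "positions_ok xs s"
    "choices ''K'' (last_block ty xs i) (length xs) s" "s ''i'' 0 = of_nat i" "s ''r'' 0 = of_nat r"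
    "j \<le> length xs" "s ''j'' 0 = of_nat j" "emitted out s"
  shows "reach region_out_com s (70 * (2 * j + nat \<lfloor>pos xs (i + j) - pos xs i\<rfloor>) + 6)
    (\<lambda>s'. \<exists>ws. tiles ty xs i j ws \<and> emitted (out @ tag r ws) s')"
  using assms(5-)
proof (induction j arbitrary: s out rule: less_induct)
  case (less j)
  let ?q = "length xs"
  let ?b = "Less (Const 0) (V ''j'')"
  let ?body = "Seq region_out_body (Seq block_out_com (Set ''j'' (V ''k'')))"
  show ?case
  proof (cases "j = 0")
    case True
    then show ?thesis unfolding region_out_com_def
      using less.prems by (intro reach_While_False) (auto simp: tag_def intro!: exI[of _ "[]"] tiles.Nil)
  next
    case False
    then have "j \<in> {1..?q}" using less.prems by simp
    then obtain k where k: "last_block ty xs i j k" "s ''K'' (int j) = of_nat k"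
      using less.prems(4) unfolding choices_def by blast
    have kj: "k < j" using k(1) by (simp add: last_block_def)
    let ?u = "pos xs (i + k)" and ?p = "epos xs (i + j - 1)" and ?x = "block_need xs i k j"
    have eq: "int i + int j - 1 = int (i + j - 1)" "int i + int k = int (i + k)" using i by simp_all
    have "s ''S'' (int l) = pos xs l" "s ''E'' (int l) = epos xs l" if "l < 2 * ?q" for l
      using less.prems(3) that by (auto simp: positions_ok_def)
    from this(2)[of "i + j - 1"] this(1)[of "i + k"]
    have SE: "s ''E'' (int i + int j - 1) = ?p" "s ''S'' (int i + int k) = ?u"
      unfolding eq using i less.prems(7) kj by auto
    have fl: "\<lfloor>rat_of_nat i + rat_of_nat j - 1\<rfloor> = int i + int j - 1" "\<lfloor>rat_of_nat i + rat_of_nat k\<rfloor> = int i + int k"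
      by linarith+
    let ?s = "run region_out_body s"
    have runs: "?s ''k'' 0 = of_nat k" "?s ''u'' 0 = ?u" "?s ''p'' 0 = ?p" "?s ''x'' 0 = of_nat ?x"
      using less.prems k SE fl
      by (simp_all add: region_out_body_def run_need_com block_need_def)
    have body: "reach ?body s (70 * ?x + 60)
      (\<lambda>s'. s' ''j'' 0 = of_nat k \<and> (\<exists>bs. fills ty ?u ?p ?x bs \<and> emitted (out @ tag r bs) s'))"
    proof (rule reach_Seq[where ?T1.0 = 50 and ?T2.0 = "70 * ?x + 10"])
      show "reach region_out_body s 50 (\<lambda>s'. s' ''k'' 0 = of_nat k \<and> s' ''u'' 0 = ?u \<and> s' ''p'' 0 = ?p \<and> s' ''x'' 0 = of_nat ?x)"
        by (rule reach_loop_free) (use runs in \<open>simp_all add: region_out_body_def need_com_def\<close>)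
    next
      fix s1 assume s1: "s1 ''k'' 0 = of_nat k \<and> s1 ''u'' 0 = ?u \<and> s1 ''p'' 0 = ?p \<and> s1 ''x'' 0 = of_nat ?x"
        and fr: "\<And>x. x \<notin> writes region_out_body \<Longrightarrow> s1 x = s x"
      show "reach (Seq block_out_com (Set ''j'' (V ''k''))) s1 (70 * ?x + 10)
        (\<lambda>s'. s' ''j'' 0 = of_nat k \<and> (\<exists>bs. fills ty ?u ?p ?x bs \<and> emitted (out @ tag r bs) s'))"
      proof (rule reach_Seq[OF reach_block_out_com[OF ty]])
        show "types_ok ty s1" using fr by (intro types_ok_frame[OF less.prems(1)]) (auto simp: writes_region_out)
        show "choices ''T'' (last_robot ty) (perim_ceil xs) s1"
          using less.prems(2) fr by (simp add: choices_def writes_region_out)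
        show "emitted out s1" using less.prems(9) fr by (rule emitted_frame) (auto simp: writes_region_out)
        show "s1 ''r'' 0 = of_nat r" using less.prems fr by (simp add: writes_region_out)
        show "0 < ?x" by (simp add: block_need_def need_pos)
        show "?x \<le> perim_ceil xs" by (rule block_need_le[OF xs kj less.prems(7)])
      next
        fix s2 assume s2: "\<exists>ws. fills ty ?u ?p ?x ws \<and> emitted (out @ tag r ws) s2"
          and fr2: "\<And>x. x \<notin> writes block_out_com \<Longrightarrow> s2 x = s1 x"
        let ?s3 = "run (Set ''j'' (V ''k'')) s2"
        obtain bs where bs: "fills ty ?u ?p ?x bs" "emitted (out @ tag r bs) s2" using s2 by blast
        have "?s3 ''j'' 0 = of_nat k" using s1 fr2 by (simp add: writes_region_out)
        moreover have "emitted (out @ tag r bs) ?s3" using bs(2) by (rule emitted_frame) auto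
        then have "\<exists>bs. fills ty ?u ?p ?x bs \<and> emitted (out @ tag r bs) ?s3" using bs(1) by blast
        ultimately show "reach (Set ''j'' (V ''k'')) s2 4
          (\<lambda>s'. s' ''j'' 0 = of_nat k \<and> (\<exists>bs. fills ty ?u ?p ?x bs \<and> emitted (out @ tag r bs) s'))"
          by (intro reach_loop_free) (auto simp del: run.simps)
      qed (use s1 in auto)
    qed simp
    show ?thesis unfolding region_out_com_def
    proof (rule reach_While_True[OF _ body])
      show "bval ?b s" using less.prems False by simp
    next
      fix s' assume s': "s' ''j'' 0 = of_nat k \<and> (\<exists>bs. fills ty ?u ?p ?x bs \<and> emitted (out @ tag r bs) s')"
        and fr: "\<And>x. x \<notin> writes ?body \<Longrightarrow> s' x = s x"
      obtain bs where bs: "fills ty ?u ?p ?x bs" "emitted (out @ tag r bs) s'" using s' by blast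
      have "reach region_out_com s' (70 * (2 * k + nat \<lfloor>pos xs (i + k) - pos xs i\<rfloor>) + 6)
        (\<lambda>s'. \<exists>ws. tiles ty xs i k ws \<and> emitted ((out @ tag r bs) @ tag r ws) s')"
      proof (rule less.IH[OF kj])
        show "types_ok ty s'" using fr by (intro types_ok_frame[OF less.prems(1)]) (auto simp: writes_region_out)
        show "choices ''T'' (last_robot ty) (perim_ceil xs) s'"
          using less.prems(2) fr by (simp add: choices_def writes_region_out)
        show "choices ''K'' (last_block ty xs i) ?q s'"
          using less.prems(4) fr by (simp add: choices_def writes_region_out)
        show "positions_ok xs s'" using less.prems(3) fr by (simp add: positions_ok_def writes_region_out)
        show "s' ''i'' 0 = of_nat i" "s' ''r'' 0 = of_nat r" using less.prems fr by (auto simp: writes_region_out)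
      qed (use s' bs kj less.prems(7) in auto)
      then show "reach (While ?b ?body) s' (70 * (2 * k + nat \<lfloor>pos xs (i + k) - pos xs i\<rfloor>) + 6)
        (\<lambda>s'. \<exists>ws. tiles ty xs i j ws \<and> emitted (out @ tag r ws) s')"
        unfolding region_out_com_def
      proof (rule reach_mono)
        fix s'' assume "\<exists>ws. tiles ty xs i k ws \<and> emitted ((out @ tag r bs) @ tag r ws) s''"
        then obtain ws where ws: "tiles ty xs i k ws" "emitted ((out @ tag r bs) @ tag r ws) s''" by blast
        have "tiles ty xs i j (bs @ ws)" using k(1) bs(1) ws(1) by (intro tiles.Block) (auto simp: last_block_def)
        then show "\<exists>ws. tiles ty xs i j ws \<and> emitted (out @ tag r ws) s''"
          using ws(2) by (intro exI[of _ "bs @ ws"]) (simp add: tag_def)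
      qed simp
    next
      have x: "int ?x \<le> \<lfloor>pos xs (i + j) - pos xs (i + k)\<rfloor> + 1" by (rule block_need_le_floor[OF xs kj])
      have "\<lfloor>pos xs (i + j) - pos xs (i + k)\<rfloor> + \<lfloor>pos xs (i + k) - pos xs i\<rfloor> \<le> \<lfloor>pos xs (i + j) - pos xs i\<rfloor>"
        by linarith
      moreover have "0 \<le> \<lfloor>pos xs (i + k) - pos xs i\<rfloor>" using pos_mono[OF xs, of i "i + k"] by simp
      ultimately have "?x + nat \<lfloor>pos xs (i + k) - pos xs i\<rfloor> \<le> nat \<lfloor>pos xs (i + j) - pos xs i\<rfloor> + 1"
        using x by linarith
      then show "1 + bcost ?b + (70 * ?x + 60) + (70 * (2 * k + nat \<lfloor>pos xs (i + k) - pos xs i\<rfloor>) + 6)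
        \<le> 70 * (2 * j + nat \<lfloor>pos xs (i + j) - pos xs i\<rfloor>) + 6"
        using kj by simp
    qed
  qed
qed

lemma writes_region_out_com: "writes region_out_com = writes region_out_body \<union> writes block_out_com \<union> {''j''}"
  by (auto simp: region_out_com_def)

text \<open>The search leaves behind the table for the last first segment tried, so the table for the best one
  is computed once more before backtracking.\<close>

definition region_com :: com where
  "region_com =
    Seq setup_com
   (Seq fleet_com
   (Seq search_com
   (Seq (Set ''i'' (V ''A''))
   (Seq part_com
   (Seq (Seq (Set ''mincost'' (Plus (V ''mincost'') (Arr ''D'' (V ''Q'')))) (Set ''j'' (V ''Q'')))
   (Seq region_out_com
        (Seq (Set ''o'' (Plus (V ''o'') (V ''Q''))) (Set ''r'' (Plus (V ''r'') (Const 1))))))))))"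

definition tables_clear :: "store \<Rightarrow> bool" where
  "tables_clear s \<longleftrightarrow> (\<forall>z \<le> 0. s ''G'' z = 0 \<and> s ''D'' z = 0)"

definition region_time :: "(nat \<times> nat) list \<Rightarrow> (rat \<times> rat) list \<Rightarrow> nat" where
  "region_time ty xs = length xs ^ 3 + length ty * perim_ceil xs"

lemma reach_region_com:
  assumes ty: "valid_types ty" and xs: "valid_perim xs"
    and s: "types_ok ty s" "listing_ok xs off s" "s ''r'' 0 = of_nat r" "s ''q'' (int r) = of_nat (length xs)"
      "tables_clear s" "emitted out s" "s ''mincost'' 0 = of_nat c"
  shows "reach region_com s (1000 * region_time ty xs)
    (\<lambda>s'. s' ''r'' 0 = of_nat (Suc r) \<and> s' ''o'' 0 = of_nat (off + length xs) \<and> tables_clear s' \<and>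
      s' ''mincost'' 0 = of_nat (c + opt_cost ty xs) \<and>
      (\<exists>i ws. part_cost ty xs i (length xs) = opt_cost ty xs \<and> tiles ty xs i (length xs) ws \<and>
         emitted (out @ tag r ws) s'))"
    (is "reach _ _ _ ?Q")
proof -
  let ?q = "length xs" and ?N = "perim_ceil xs" and ?t = "length ty"
  note w = writes_setup_com writes_fleet_com writes_search_com writes_part_com writes_region_out_com writes_region_out
  have q: "?q \<ge> 1" using valid_perimD(1)[OF xs] by (cases xs) auto
  have N: "?N \<ge> 1" using perim_len_pos[OF xs] by (simp add: perim_ceil_def Suc_le_eq)
  have t: "?t \<ge> 1" using ty by (cases ty) (auto simp: valid_types_def)
  \<comment> \<open>time left from each stage on, backwards from the last one\<close>
  define T7 where "T7 = 70 * (2 * ?q + ?N) + 30"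
  define T6 where "T6 = T7 + 30"
  define T5 where "T5 = T6 + 178 * ?q ^ 2"
  define T4 where "T4 = T5 + 4"
  define T3 where "T3 = T4 + 241 * ?q ^ 3"
  define T2 where "T2 = T3 + (?N * (55 * ?t + 54) + 22)"
  define T1 where "T1 = T2 + (130 * ?q + 40)"
  have time: "T1 \<le> 1000 * region_time ty xs"
  proof -
    have "?q \<le> ?q ^ 3" "1 \<le> ?q ^ 3" "?q ^ 2 \<le> ?q ^ 3" using q by (auto simp: self_le_power power_increasing)
    moreover have "?N \<le> ?t * ?N" using t by simp
    moreover have "?N * (55 * ?t + 54) = 55 * (?t * ?N) + 54 * ?N" by (simp add: algebra_simps)
    moreover have "70 * (2 * a + n) + 30 + 30 + 178 * b + 4 + 241 * c + (55 * w + 54 * n + 22) + (130 * a + 40)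
        \<le> 1000 * (c + w)" if "a \<le> c" "1 \<le> c" "b \<le> c" "n \<le> w" for a b c n w :: nat
      using that by simp
    ultimately show ?thesis unfolding region_time_def T1_def T2_def T3_def T4_def T5_def T6_def T7_def by metis
  qed
  have "reach region_com s T1 ?Q" unfolding region_com_def
  proof (rule reach_Seq[OF reach_setup_com[OF xs s(2-4)]])
    fix s1 assume s1: "positions_ok xs s1 \<and> s1 ''N'' 0 = of_nat ?N"
      and f1: "\<And>x. x \<notin> writes setup_com \<Longrightarrow> s1 x = s x"
    have ty1: "types_ok ty s1" using f1 by (intro types_ok_frame[OF s(1)]) (auto simp: w)
    have G1: "s1 ''G'' z = 0" "s1 ''D'' z = 0" if "z \<le> 0" for z
      using s(5) f1 that by (auto simp: tables_clear_def w)
    show "reach (Seq fleet_com (Seq search_com (Seq (Set ''i'' (V ''A'')) (Seq part_com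
        (Seq (Seq (Set ''mincost'' (Plus (V ''mincost'') (Arr ''D'' (V ''Q'')))) (Set ''j'' (V ''Q'')))
        (Seq region_out_com
        (Seq (Set ''o'' (Plus (V ''o'') (V ''Q''))) (Set ''r'' (Plus (V ''r'') (Const 1)))))))))) s1 T2 ?Q"
    proof (rule reach_Seq[OF reach_fleet_com[OF ty ty1]])
      fix s2 assume s2: "table ''G'' (fleet_cost ty) ?N s2 \<and> choices ''T'' (last_robot ty) ?N s2"
        and f2: "\<And>x. x \<notin> writes fleet_com \<Longrightarrow> s2 x = s1 x"
      have p2: "positions_ok xs s2" using s1 f2 by (simp add: positions_ok_def w)
      have D2: "s2 ''D'' z = 0" if "z \<le> 0" for z using G1(2)[OF that] f2 by (simp add: w)
      show "reach (Seq search_com (Seq (Set ''i'' (V ''A'')) (Seq part_com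
        (Seq (Seq (Set ''mincost'' (Plus (V ''mincost'') (Arr ''D'' (V ''Q'')))) (Set ''j'' (V ''Q'')))
        (Seq region_out_com
        (Seq (Set ''o'' (Plus (V ''o'') (V ''Q''))) (Set ''r'' (Plus (V ''r'') (Const 1))))))))) s2 T3 ?Q"
      proof (rule reach_Seq[OF reach_search_com[OF xs p2]])
        fix s3 assume s3: "(\<forall>z \<le> 0. s3 ''D'' z = 0) \<and>
            (\<exists>i \<in> {1..?q}. s3 ''A'' 0 = of_nat i \<and> part_cost ty xs i ?q = opt_cost ty xs)"
          and f3: "\<And>x. x \<notin> writes search_com \<Longrightarrow> s3 x = s2 x"
        obtain i where i: "1 \<le> i" "i \<le> ?q" "s3 ''A'' 0 = of_nat i" "part_cost ty xs i ?q = opt_cost ty xs"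
          using s3 by auto
        show "reach (Seq (Set ''i'' (V ''A'')) (Seq part_com
            (Seq (Seq (Set ''mincost'' (Plus (V ''mincost'') (Arr ''D'' (V ''Q'')))) (Set ''j'' (V ''Q'')))
            (Seq region_out_com
            (Seq (Set ''o'' (Plus (V ''o'') (V ''Q''))) (Set ''r'' (Plus (V ''r'') (Const 1)))))))) s3 T4 ?Q"
        proof (rule reach_Seq[where ?T1.0 = 4 and ?T2.0 = T5 and ?Q1.0 = "\<lambda>s'. s' ''i'' 0 = of_nat i"])
          show "reach (Set ''i'' (V ''A'')) s3 4 (\<lambda>s'. s' ''i'' 0 = of_nat i)"
            by (rule reach_loop_free) (use i in auto)
        next
          fix s4 assume s4: "s4 ''i'' 0 = of_nat i"
            and f4: "\<And>x. x \<notin> writes (Set ''i'' (V ''A'')) \<Longrightarrow> s4 x = s3 x"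
          have p4: "positions_ok xs s4" using p2 f3 f4 by (simp add: positions_ok_def w)
          have G4: "table ''G'' (fleet_cost ty) ?N s4" using s2 f3 f4 by (simp add: table_def w)
          have D4: "s4 ''D'' z = 0" if "z \<le> 0" for z using s3 that f4 by simp
          show "reach (Seq part_com
            (Seq (Seq (Set ''mincost'' (Plus (V ''mincost'') (Arr ''D'' (V ''Q'')))) (Set ''j'' (V ''Q'')))
            (Seq region_out_com
            (Seq (Set ''o'' (Plus (V ''o'') (V ''Q''))) (Set ''r'' (Plus (V ''r'') (Const 1))))))) s4 T5 ?Q"
          proof (rule reach_Seq[OF reach_part_com[OF xs i(1,2) p4 G4 s4]])
            fix s5 assume s5: "table ''D'' (part_cost ty xs i) ?q s5 \<and> choices ''K'' (last_block ty xs i) ?q s5"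
              and f5: "\<And>x. x \<notin> writes part_com \<Longrightarrow> s5 x = s4 x"
            let ?c = "Seq (Set ''mincost'' (Plus (V ''mincost'') (Arr ''D'' (V ''Q'')))) (Set ''j'' (V ''Q''))"
            have "s5 ''Q'' 0 = of_nat ?q" using p4 f5 by (simp add: positions_ok_def w)
            moreover have "s5 ''mincost'' 0 = of_nat c" using s(7) f1 f2 f3 f4 f5 by (simp add: w)
            moreover have "s5 ''D'' (int ?q) = of_nat (opt_cost ty xs)" using s5 i(4) by (simp add: table_def)
            ultimately have c6: "run ?c s5 ''mincost'' 0 = of_nat (c + opt_cost ty xs)" "run ?c s5 ''j'' 0 = of_nat ?q"
              by simp_all
            show "reach (Seq ?c (Seq region_out_com
              (Seq (Set ''o'' (Plus (V ''o'') (V ''Q''))) (Set ''r'' (Plus (V ''r'') (Const 1)))))) s5 T6 ?Q"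
            proof (rule reach_Seq[where ?T1.0 = 30 and ?T2.0 = T7])
              show "reach ?c s5 30 (\<lambda>s'. s' ''mincost'' 0 = of_nat (c + opt_cost ty xs) \<and> s' ''j'' 0 = of_nat ?q)"
                by (rule reach_loop_free) (use c6 in \<open>auto simp del: run.simps\<close>)
            next
              fix s6 assume s6: "s6 ''mincost'' 0 = of_nat (c + opt_cost ty xs) \<and> s6 ''j'' 0 = of_nat ?q"
                and f6: "\<And>x. x \<notin> writes ?c \<Longrightarrow> s6 x = s5 x"
              have frame: "s6 x = s x" if "x \<notin> writes setup_com" "x \<notin> writes fleet_com" "x \<notin> writes search_com"
                  "x \<notin> {''i'', ''j'', ''mincost''}" for x
                using that f1[of x] f2[of x] f3[of x] f4[of x] f5[of x] f6[of x] by (auto simp: writes_search_com)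
              have ty6: "types_ok ty s6" using frame by (intro types_ok_frame[OF s(1)]) (auto simp: w)
              have T6: "choices ''T'' (last_robot ty) ?N s6"
                using s2 f3[of "''T''"] f4[of "''T''"] f5[of "''T''"] f6[of "''T''"] by (simp add: choices_def w)
              have p6: "positions_ok xs s6"
                using p4 f5 f6 by (simp add: positions_ok_def w)
              have K6: "choices ''K'' (last_block ty xs i) ?q s6" using s5 f6[of "''K''"] by (simp add: choices_def)
              have i6: "s6 ''i'' 0 = of_nat i" using s4 f5[of "''i''"] f6[of "''i''"] by (simp add: w)
              have r6: "s6 ''r'' 0 = of_nat r" using s(3) frame[of "''r''"] by (simp add: w)
              have e6: "emitted out s6" using s(6) by (rule emitted_frame) (auto intro!: frame simp: w)
              have o6: "s6 ''o'' 0 = of_nat off" "s6 ''Q'' 0 = of_nat ?q"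
                using s(2) frame[of "''o''"] p6 by (auto simp: w listing_ok_def positions_ok_def)
              have clear6: "tables_clear s6"
                using G4 s5 f5[of "''G''"] f6[of "''G''"] f6[of "''D''"]
                by (auto simp: tables_clear_def table_def w part_cost_0 fleet_cost_0)
              let ?d = "Seq (Set ''o'' (Plus (V ''o'') (V ''Q''))) (Set ''r'' (Plus (V ''r'') (Const 1)))"
              show "reach (Seq region_out_com ?d) s6 T7 ?Q"
              proof (rule reach_Seq[OF reach_region_out_com[OF ty xs i(1,2) ty6 T6 p6 K6 i6 r6 order_refl _ e6]])
                fix s7 assume s7: "\<exists>ws. tiles ty xs i ?q ws \<and> emitted (out @ tag r ws) s7"
                  and f7: "\<And>x. x \<notin> writes region_out_com \<Longrightarrow> s7 x = s6 x"
                obtain ws where ws: "tiles ty xs i ?q ws" "emitted (out @ tag r ws) s7" using s7 by blast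
                have "emitted (out @ tag r ws) (run ?d s7)" using ws(2) by (rule emitted_frame) auto
                moreover have "run ?d s7 ''r'' 0 = of_nat (Suc r)" "run ?d s7 ''o'' 0 = of_nat (off + ?q)"
                  "run ?d s7 ''mincost'' 0 = of_nat (c + opt_cost ty xs)"
                  using f7[of "''r''"] f7[of "''o''"] f7[of "''Q''"] f7[of "''mincost''"] r6 o6 s6 by (simp_all add: w)
                moreover have "tables_clear (run ?d s7)"
                  using clear6 f7[of "''G''"] f7[of "''D''"] by (simp add: tables_clear_def w)
                ultimately have "?Q (run ?d s7)" using ws(1) i(4) by blast
                then show "reach ?d s7 24 ?Q" by (rule reach_loop_free[rotated 2]) auto
              next
                have "pos xs (i + ?q) - pos xs i = perim_len xs" by (simp add: pos_shift)
                moreover have "nat \<lfloor>perim_len xs\<rfloor> \<le> ?N" unfolding perim_ceil_def by linarith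
                ultimately show "70 * (2 * ?q + nat \<lfloor>pos xs (i + ?q) - pos xs i\<rfloor>) + 6 + 24 \<le> T7"
                  by (simp add: T7_def)
              qed (use s6 in simp)
            qed (simp add: T6_def)
          qed (use D4 in \<open>auto simp: T5_def\<close>)
        qed (simp add: T4_def)
      qed (use s2 D2 in \<open>auto simp: T3_def\<close>)
    qed (use s1 G1 in \<open>auto simp: T2_def\<close>)
  qed (simp add: T1_def)
  then show ?thesis by (rule reach_mono) (use time in auto)
qed

section \<open>The whole program\<close>

definition opg_program :: com where
  "opg_program = While (Less (V ''r'') (V ''m'')) region_com"

lemma concat_nth:
  assumes "r < length xss" "k < length (xss ! r)"
  shows "concat xss ! (length (concat (take r xss)) + k) = xss ! r ! k"
    "length (concat (take r xss)) + k < length (concat xss)"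
proof -
  have eq: "concat xss = concat (take r xss) @ xss ! r @ concat (drop (Suc r) xss)"
    using id_take_nth_drop[OF assms(1)] by (metis concat.simps(2) concat_append)
  show "concat xss ! (length (concat (take r xss)) + k) = xss ! r ! k"
    by (subst eq) (simp add: nth_append assms)
  show "length (concat (take r xss)) + k < length (concat xss)"
    by (subst eq) (use assms in simp)
qed

lemma input_listing:
  assumes "r < length (perims I)" "\<And>x. x \<in> {''seg'', ''gap''} \<Longrightarrow> s x = input_store I x"
    "s ''o'' 0 = of_nat (length (concat (take r (perims I))))"
  shows "listing_ok (perims I ! r) (length (concat (take r (perims I)))) s"
proof -
  have "s ''seg'' = arr (map fst (concat (perims I)))" "s ''gap'' = arr (map snd (concat (perims I)))"
    using assms(2)[of "''seg''"] assms(2)[of "''gap''"] by (simp_all add: input_store_def)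
  then show ?thesis using assms(3) concat_nth[OF assms(1)]
    by (simp add: listing_ok_def arr_def del: of_nat_add)
qed

lemma input_types: "types_ok (rtypes I) (input_store I)"
  by (auto simp: types_ok_def input_store_def arr_def case_prod_beta)

lemma writes_region_com: "writes region_com = {''Q'', ''S'', ''k'', ''w'', ''E'', ''N'', ''x'', ''G'', ''T'', ''h'', ''b'', ''a'',
    ''v'', ''i'', ''B'', ''A'', ''j'', ''D'', ''K'', ''y'', ''mincost'', ''u'', ''p'', ''num'', ''type'', ''region'', ''to'', ''from'', ''n'', ''o'', ''r''}"
  by (auto simp: region_com_def writes_setup_com writes_fleet_com writes_search_com writes_part_com
      writes_region_out_com writes_region_out)

lemma reach_opg_program:
  assumes "valid_instance I"
  shows "reach opg_program (input_store I) (1014 * (\<Sum>r<length (perims I). region_time (rtypes I) (perims I ! r)))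
    (\<lambda>s. s ''mincost'' 0 = of_nat (\<Sum>r<length (perims I). opt_cost (rtypes I) (perims I ! r)) \<and>
      (\<exists>out. plan (rtypes I) (perims I) (length (perims I)) out \<and> emitted out s))"
proof -
  let ?xss = "perims I" and ?ty = "rtypes I"
  let ?b = "Less (V ''r'') (V ''m'')"
  have ty: "valid_types ?ty" using assms by (simp add: valid_instance_def valid_types_def)
  have xs: "valid_perim (?xss ! r)" if "r < length ?xss" for r using assms that by (simp add: valid_instance_def)
  let ?inputs = "{''m'', ''t'', ''q'', ''seg'', ''gap'', ''ell'', ''cost''}"
  define Inv where "Inv = (\<lambda>r s. (\<forall>x \<in> ?inputs. s x = input_store I x) \<and> s ''r'' 0 = of_nat r \<and>
     s ''o'' 0 = of_nat (length (concat (take r ?xss))) \<and> tables_clear s \<and>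
     s ''mincost'' 0 = of_nat (\<Sum>i<r. opt_cost ?ty (?xss ! i)) \<and>
     (\<exists>out. plan ?ty ?xss r out \<and> emitted out s))"
  have "reach opg_program (input_store I) (1014 * (\<Sum>r<length ?xss. region_time ?ty (?xss ! r))) (Inv (length ?xss))"
    unfolding opg_program_def
  proof (rule reach_While_count[where lo = 0 and T = "\<lambda>r. 1000 * region_time ?ty (?xss ! r)"])
    fix r s assume r: "r < length ?xss" and inv: "Inv r s"
    obtain out where out: "plan ?ty ?xss r out" "emitted out s" using inv by (auto simp: Inv_def)
    have inp: "s x = input_store I x" if "x \<in> ?inputs" for x using inv that by (auto simp: Inv_def)
    have "s ''m'' 0 = of_nat (length ?xss)" "s ''q'' (int r) = of_nat (length (?xss ! r))"
      using r inp[of "''m''"] inp[of "''q''"] by (auto simp: input_store_def arr_def)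
    have b: "bval ?b s" using inv r \<open>s ''m'' 0 = _\<close> by (simp add: Inv_def)
    have "types_ok ?ty s" by (rule types_ok_frame[OF input_types]) (simp_all add: inp)
    moreover have "listing_ok (?xss ! r) (length (concat (take r ?xss))) s"
      by (rule input_listing[OF r]) (use inp inv in \<open>auto simp: Inv_def\<close>)
    ultimately have "reach region_com s (1000 * region_time ?ty (?xss ! r))
        (\<lambda>s'. s' ''r'' 0 = of_nat (Suc r) \<and> s' ''o'' 0 = of_nat (length (concat (take r ?xss)) + length (?xss ! r)) \<and> tables_clear s' \<and>
      s' ''mincost'' 0 = of_nat ((\<Sum>i<r. opt_cost ?ty (?xss ! i)) + opt_cost ?ty (?xss ! r)) \<and>
      (\<exists>i ws. part_cost ?ty (?xss ! r) i (length (?xss ! r)) = opt_cost ?ty (?xss ! r) \<and>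
         tiles ?ty (?xss ! r) i (length (?xss ! r)) ws \<and> emitted (out @ tag r ws) s'))"
      using inv out(2) \<open>s ''q'' (int r) = _\<close> by (intro reach_region_com[OF ty xs[OF r]]) (auto simp: Inv_def)
    then have "reach region_com s (1000 * region_time ?ty (?xss ! r)) (Inv (Suc r))"
    proof (rule reach_mono[OF reach_frame], goal_cases)
      case (2 s')
      then have s': "s' ''r'' 0 = of_nat (Suc r)" "s' ''o'' 0 = of_nat (length (concat (take r ?xss)) + length (?xss ! r))"
        "tables_clear s'" "s' ''mincost'' 0 = of_nat ((\<Sum>i<r. opt_cost ?ty (?xss ! i)) + opt_cost ?ty (?xss ! r))"
        and fr: "\<And>x. x \<notin> writes region_com \<Longrightarrow> s' x = s x" by blast+
      obtain i ws where ws: "part_cost ?ty (?xss ! r) i (length (?xss ! r)) = opt_cost ?ty (?xss ! r)"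
         "tiles ?ty (?xss ! r) i (length (?xss ! r)) ws" "emitted (out @ tag r ws) s'" using 2 by blast
      have "plan ?ty ?xss (Suc r) (out @ tag r ws)" unfolding tag_def
        using tiles_props[OF ws(2) ty xs[OF r]] ws(1) by (intro plan_extend[OF out(1), of _ i]) auto
      moreover have "\<forall>x \<in> ?inputs. s' x = input_store I x"
        using inp fr by (auto simp: writes_region_com)
      moreover have "length (concat (take (Suc r) ?xss)) = length (concat (take r ?xss)) + length (?xss ! r)"
        using r by (simp add: take_Suc_conv_app_nth)
      ultimately show ?case unfolding Inv_def using s' ws(3) by auto
    qed simp
    then show "bval ?b s \<and> reach region_com s (1000 * region_time ?ty (?xss ! r)) (Inv (Suc r))" using b by blast
  next
    show "\<not> bval ?b s" if "Inv (length ?xss) s" for s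
    proof -
      have "s ''m'' = input_store I ''m''" using that by (simp add: Inv_def)
      then show ?thesis using that by (simp add: Inv_def input_store_def arr_def)
    qed
  next
    have z: "input_store I x = (\<lambda>_. 0)" if "x \<notin> ?inputs" for x using that by (auto simp: input_store_def)
    have "emitted [] (input_store I)" by (simp add: emitted_def z)
    then show "Inv 0 (input_store I)" unfolding Inv_def
      using plan_0 by (auto simp: z tables_clear_def)
  next
    let ?R = "\<lambda>r. region_time ?ty (?xss ! r)"
    have pos: "1 \<le> ?R r" if "r < length ?xss" for r
      using valid_perimD(1)[OF xs[OF that]] by (simp add: region_time_def Suc_le_eq)
    have "length ?xss = (\<Sum>r<length ?xss. 1)" by simp
    also have "\<dots> \<le> (\<Sum>r<length ?xss. ?R r)" using pos by (intro sum_mono) auto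
    finally have le: "length ?xss \<le> (\<Sum>r<length ?xss. ?R r)" .
    have "1 \<le> length ?xss" using assms by (cases ?xss) (auto simp: valid_instance_def)
    moreover have b: "bcost ?b = 6" by simp
    have "(\<Sum>r = 0..<length ?xss. 1 + bcost ?b + 1000 * ?R r) = 7 * length ?xss + 1000 * (\<Sum>r<length ?xss. ?R r)"
      unfolding b by (simp add: sum.distrib atLeast0LessThan sum_distrib_left)
    ultimately show "(\<Sum>r = 0..<length ?xss. 1 + bcost ?b + 1000 * ?R r) + 1 + bcost ?b \<le> 1014 * (\<Sum>r<length ?xss. ?R r)"
      using le unfolding b by linarith
  qed simp
  then show ?thesis by (rule reach_mono) (auto simp: Inv_def)
qed

lemma opg_program_correct:
  assumes "valid_instance I" "realizes I Rs"
  obtains n s ns rs where "exec opg_program (input_store I) n s"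
    "n \<le> 1014 * (\<Sum>r<length (perims I). region_time (rtypes I) (perims I ! r))"
    "optimal_cover (rtypes I) Rs ns rs" "outputs_cover s Rs ns rs"
    "s ''mincost'' 0 = of_nat (total_cost (rtypes I) ns)"
proof -
  interpret instance_regions "rtypes I" "perims I" Rs
    using assms by unfold_locales (auto simp: valid_instance_def realizes_def valid_types_def)
  obtain n s out where s: "exec opg_program (input_store I) n s"
      "n \<le> 1014 * (\<Sum>r<length (perims I). region_time (rtypes I) (perims I ! r))"
      "s ''mincost'' 0 = of_nat (\<Sum>r<length (perims I). opt_cost (rtypes I) (perims I ! r))"
      "plan (rtypes I) (perims I) (length (perims I)) out" "emitted out s"
    using reach_opg_program[OF assms(1)] unfolding reach_def by blast
  have "outputs_cover s Rs (counts out) (robots out)"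
    unfolding outputs_cover_def
  proof (intro conjI allI impI)
    fix \<tau> assume "\<tau> < length (counts out)"
    then show "s ''num'' (int \<tau>) = of_nat (counts out ! \<tau>)"
      using s(5) by (simp add: counts_def emitted_def)
  next
    fix j assume "j < length (robots out)"
    then have j: "j < length out" by (simp add: robots_def)
    obtain h r a b where e: "out ! j = (h, r, a, b)" by (cases "out ! j")
    have "(h, r, a, b) \<in> set out" using j e nth_mem by metis
    then have "r < length Rs" using s(4) len_Rs by (force simp: plan_def)
    moreover have "s ''type'' (int j) = of_nat h" "s ''region'' (int j) = of_nat r"
      "s ''from'' (int j) = a" "s ''to'' (int j) = b"
      using s(5) j e by (auto simp: emitted_def)
    moreover have "robots out ! j = (h, bdry (Rs ! r) ` {real_of_rat a..real_of_rat b})"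
      using j e by (simp add: robots_def)
    ultimately show "s ''type'' (int j) = of_nat (fst (robots out ! j))"
      "\<exists>i < length Rs. s ''region'' (int j) = of_nat i \<and> snd (robots out ! j) =
             bdry (Rs ! i) ` {of_rat (s ''from'' (int j)) .. of_rat (s ''to'' (int j))}"
      by auto
  qed
  then show ?thesis using that s(1,2,3) plan_optimal[OF s(4)] by simp
qed

section \<open>Pseudo-polynomial running time\<close>

lemma bit_size_pos: "1 \<le> bit_size x"
proof -
  obtain a b where ab: "quotient_of x = (a, b)" by (cases "quotient_of x")
  then have "0 < nat b" using quotient_of_denom_pos by simp
  then have "floorlog 2 (nat b) \<noteq> 0" by (simp add: floorlog_eq_zero_iff)
  then show ?thesis by (simp add: bit_size_def ab)
qed

lemma length_concat_pairs: "length (concat (map (\<lambda>(a, b). [f a, g b]) xs)) = 2 * length xs"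
  by (induction xs) auto

lemma mem_concat_pairs:
  "w \<in> set ws \<Longrightarrow> fst w \<in> set (concat (map (\<lambda>(a, b). [a, b]) ws)) \<and> snd w \<in> set (concat (map (\<lambda>(a, b). [a, b]) ws))"
  by (induction ws) auto

lemma input_size_ge:
  "(\<Sum>r<length (perims I). length (perims I ! r)) \<le> input_size I" "length (rtypes I) \<le> input_size I"
proof -
  have "length (input_numbers I) \<le> (\<Sum>x\<leftarrow>input_numbers I. bit_size x)"
    using sum_list_mono[of "input_numbers I" "\<lambda>_. 1" bit_size] bit_size_pos by (simp add: sum_list_triv)
  moreover have "length (input_numbers I) = 2 * length (concat (perims I)) + 2 * length (rtypes I)"
    using length_concat_pairs[of "\<lambda>x. x" "\<lambda>x. x" "concat (perims I)"] length_concat_pairs[of of_nat of_nat "rtypes I"]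
    by (simp add: input_numbers_def)
  ultimately have "2 * length (concat (perims I)) + 2 * length (rtypes I) \<le> input_size I"
    by (simp add: input_size_def)
  moreover have "length (concat (perims I)) = (\<Sum>r<length (perims I). length (perims I ! r))"
    by (simp add: length_concat sum_list_sum_nth atLeast0LessThan)
  ultimately show "(\<Sum>r<length (perims I). length (perims I ! r)) \<le> input_size I" "length (rtypes I) \<le> input_size I"
    by simp_all
qed

lemma perim_ceil_le:
  assumes "r < length (perims I)" "valid_perim (perims I ! r)"
  shows "perim_ceil (perims I ! r) \<le> 2 * length (perims I ! r) * input_magnitude I"
proof -
  let ?xs = "perims I ! r" and ?M = "input_magnitude I"
  have num: "y \<le> of_nat ?M" if "y \<in> set (input_numbers I)" for y
  proof -
    have "nat \<lceil>y\<rceil> \<le> ?M" unfolding input_magnitude_def using that by (intro Max_ge) auto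
    moreover have "y \<le> of_nat (nat \<lceil>y\<rceil>)" by (rule of_nat_ceiling)
    ultimately show ?thesis by (meson of_nat_le_iff order_trans)
  qed
  have bound: "fst w \<le> of_nat ?M \<and> snd w \<le> of_nat ?M" if "w \<in> set ?xs" for w
  proof -
    have "w \<in> set (concat (perims I))"
      unfolding set_concat using that nth_mem[OF assms(1)] by (rule UN_I[rotated])
    note w = mem_concat_pairs[OF this]
    have "fst w \<in> set (input_numbers I)" "snd w \<in> set (input_numbers I)"
      unfolding input_numbers_def set_append
      by (rule UnI1, rule w[THEN conjunct1]) (rule UnI1, rule w[THEN conjunct2])
    then show ?thesis using num by blast
  qed
  have step: "fst (?xs ! (i mod length ?xs)) + snd (?xs ! (i mod length ?xs)) \<le> of_nat (2 * ?M)" for i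
  proof -
    have "?xs ! (i mod length ?xs) \<in> set ?xs" using valid_perimD(1)[OF assms(2)] by simp
    moreover have "rat_of_nat (2 * ?M) = of_nat ?M + of_nat ?M" by simp
    ultimately show ?thesis using bound add_mono by metis
  qed
  have "perim_len ?xs \<le> of_nat (length ?xs * (2 * ?M))"
    unfolding perim_len_def pos_def
    using sum_bounded_above[of "{..<length ?xs}" "\<lambda>i. fst (?xs ! (i mod length ?xs)) + snd (?xs ! (i mod length ?xs))", OF step]
    by simp
  then have "\<lceil>perim_len ?xs\<rceil> \<le> int (length ?xs * (2 * ?M))" by (simp add: ceiling_le_iff)
  then show ?thesis by (simp add: perim_ceil_def nat_le_iff ac_simps)
qed

lemma sum_cubes_le: "(\<Sum>r<n. f r ^ 3) \<le> (\<Sum>r<n. f r) ^ 3" for f :: "nat \<Rightarrow> nat"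
proof (induction n)
  case (Suc n)
  have "a ^ 3 + b ^ 3 \<le> (a + b) ^ 3" for a b :: nat by (simp add: power3_eq_cube algebra_simps)
  then show ?case using Suc by (metis (no_types, lifting) add_le_mono order_refl order_trans sum.lessThan_Suc)
qed simp

lemma time_pseudo_polynomial:
  assumes "valid_instance I"
  shows "(\<Sum>r<length (perims I). region_time (rtypes I) (perims I ! r)) \<le> 3 * (input_size I + input_magnitude I) ^ 3"
proof -
  let ?Z = "input_size I + input_magnitude I" and ?q = "\<lambda>r. length (perims I ! r)" and ?m = "length (perims I)"
  let ?t = "length (rtypes I)"
  have "(\<Sum>r<?m. ?q r ^ 3) \<le> (\<Sum>r<?m. ?q r) ^ 3" by (rule sum_cubes_le)
  also have "\<dots> \<le> ?Z ^ 3" using input_size_ge(1)[of I] by (intro power_mono) auto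
  finally have 1: "(\<Sum>r<?m. ?q r ^ 3) \<le> ?Z ^ 3" .
  have "(\<Sum>r<?m. ?t * perim_ceil (perims I ! r)) \<le> (\<Sum>r<?m. ?t * (2 * ?q r * input_magnitude I))"
    using assms by (intro sum_mono mult_le_mono2 perim_ceil_le) (auto simp: valid_instance_def)
  also have "\<dots> = 2 * (?t * ((\<Sum>r<?m. ?q r) * input_magnitude I))"
    by (simp add: sum_distrib_left sum_distrib_right ac_simps)
  also have "\<dots> \<le> 2 * (?Z * (?Z * ?Z))"
    using input_size_ge[of I] by (intro mult_le_mono) auto
  finally have "(\<Sum>r<?m. ?t * perim_ceil (perims I ! r)) \<le> 2 * ?Z ^ 3" by (simp add: power3_eq_cube ac_simps)
  then show ?thesis using 1 by (simp add: region_time_def sum.distrib)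
qed

text \<open>\<open>perim_ceil\<close> rounds the rational perimeter given in the input, the theorem the real length of the
  boundary; the two agree because the input describes the region.\<close>

lemma region_time_single:
  assumes "valid_instance I" "realizes I [r]"
  shows "(\<Sum>k<length (perims I). region_time (rtypes I) (perims I ! k)) \<le>
    card (segments r) ^ 3 + length (rtypes I) * nat \<lceil>circ r\<rceil>"
proof -
  obtain xs where xs: "perims I = [xs]" "describes xs r"
    using assms(2) by (auto simp: realizes_def list_all2_Cons2)
  have vr: "valid_region r" and vp: "valid_perim xs" using assms xs by (auto simp: realizes_def valid_instance_def)
  note dp = describes_perim[OF xs(2) vr vp]
  have "real_of_rat (perim_len xs) \<le> real_of_rat (of_int \<lceil>circ r\<rceil>)" unfolding dp(1)[symmetric] by simp
  then have "perim_len xs \<le> of_int \<lceil>circ r\<rceil>" unfolding of_rat_less_eq .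
  then have "perim_ceil xs \<le> nat \<lceil>circ r\<rceil>" unfolding perim_ceil_def by (simp add: ceiling_le_iff nat_mono)
  then show ?thesis using xs(1) dp(3) by (simp add: region_time_def)
qed

theorem mainTheorem4:
  shows
    "(\<exists>(p :: com) (a :: nat) (d :: nat). \<forall>(I :: opg_instance) (Rs :: region list).
        valid_instance I \<and> realizes I Rs \<longrightarrow>
        (\<exists>(n :: nat) (s :: store). exec p (input_store I) n s \<and>
           n \<le> a * (input_size I + input_magnitude I) ^ d \<and>
           (\<exists>ns rs. optimal_cover (rtypes I) Rs ns rs \<and> outputs_cover s Rs ns rs))) \<and>
     (\<exists>(p :: com) (a :: nat). \<forall>(I :: opg_instance) (r :: region).
        valid_instance I \<and> realizes I [r] \<longrightarrow>
        (\<exists>(n :: nat) (s :: store). exec p (input_store I) n s \<and>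
           n \<le> a * (card (segments r) ^ 3 + length (rtypes I) * nat \<lceil>circ r\<rceil>) \<and>
           (\<exists>ns rs. optimal_cover (rtypes I) [r] ns rs \<and>
              s ''mincost'' 0 = of_nat (total_cost (rtypes I) ns))))"
proof (intro conjI)
  have "\<exists>n s. exec opg_program (input_store I) n s \<and>
      n \<le> 3042 * (input_size I + input_magnitude I) ^ 3 \<and>
      (\<exists>ns rs. optimal_cover (rtypes I) Rs ns rs \<and> outputs_cover s Rs ns rs)"
    if "valid_instance I" "realizes I Rs" for I Rs
  proof -
    obtain n s ns rs where s: "exec opg_program (input_store I) n s"
      "n \<le> 1014 * (\<Sum>r<length (perims I). region_time (rtypes I) (perims I ! r))"
      "optimal_cover (rtypes I) Rs ns rs" "outputs_cover s Rs ns rs"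
      using \<open>valid_instance I\<close> \<open>realizes I Rs\<close> by (rule opg_program_correct)
    then show ?thesis using time_pseudo_polynomial[OF \<open>valid_instance I\<close>] by force
  qed
  then show "\<exists>(p :: com) (a :: nat) (d :: nat). \<forall>(I :: opg_instance) (Rs :: region list).
        valid_instance I \<and> realizes I Rs \<longrightarrow>
        (\<exists>(n :: nat) (s :: store). exec p (input_store I) n s \<and>
           n \<le> a * (input_size I + input_magnitude I) ^ d \<and>
           (\<exists>ns rs. optimal_cover (rtypes I) Rs ns rs \<and> outputs_cover s Rs ns rs))"
    by blast
  have "\<exists>n s. exec opg_program (input_store I) n s \<and>
      n \<le> 1014 * (card (segments r) ^ 3 + length (rtypes I) * nat \<lceil>circ r\<rceil>) \<and>
      (\<exists>ns rs. optimal_cover (rtypes I) [r] ns rs \<and> s ''mincost'' 0 = of_nat (total_cost (rtypes I) ns))"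
    if "valid_instance I" "realizes I [r]" for I r
  proof -
    obtain n s ns rs where s: "exec opg_program (input_store I) n s"
      "n \<le> 1014 * (\<Sum>r<length (perims I). region_time (rtypes I) (perims I ! r))"
      "optimal_cover (rtypes I) [r] ns rs" "s ''mincost'' 0 = of_nat (total_cost (rtypes I) ns)"
      using \<open>valid_instance I\<close> \<open>realizes I [r]\<close> by (rule opg_program_correct)
    moreover have "n \<le> 1014 * (card (segments r) ^ 3 + length (rtypes I) * nat \<lceil>circ r\<rceil>)"
      using s(2) region_time_single[OF \<open>valid_instance I\<close> \<open>realizes I [r]\<close>]
      by (meson mult_le_mono2 order_trans)
    ultimately show ?thesis by blast
  qed
  then show "\<exists>(p :: com) (a :: nat). \<forall>(I :: opg_instance) (r :: region).
        valid_instance I \<and> realizes I [r] \<longrightarrow>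
        (\<exists>(n :: nat) (s :: store). exec p (input_store I) n s \<and>
           n \<le> a * (card (segments r) ^ 3 + length (rtypes I) * nat \<lceil>circ r\<rceil>) \<and>
           (\<exists>ns rs. optimal_cover (rtypes I) [r] ns rs \<and>
              s ''mincost'' 0 = of_nat (total_cost (rtypes I) ns)))"
    by blast
qed

end
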